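(* The Boolean power functor $\mathfrak{P}\colon \mathsf{BA}\to\mathcal{A}$ is naturally isomorphic to the dual $\Pi_{\mathbf{L}}\circ \mathsf{V}^{\top}\circ\Sigma\colon \mathsf{BA}\to\mathcal{A}$ of the functor $\mathsf{V}^{\top}\colon \mathsf{Stone}\to\mathsf{Stone}_{\mathbf{L}}$, and, therefore, $\mathfrak{P}$ is right adjoint to the Boolean skeleton functor $\mathfrak{S}\colon\mathcal{A}\to\mathsf{BA}$, i.e. $\mathfrak{S}\dashv\mathfrak{P}$.
   Context: Setting: $\mathbf{L}$ is a finite algebra with an underlying bounded lattice $(L,\wedge,\vee,0,1)$, $0\neq 1$ (the lattice operations and the bounds belong to the signature of $\mathbf{L}$, so every subalgebra contains $0,1$), and $\mathbf{L}$ is semi-primal: for every $n\ge 1$, every function $f\colon L^n\to L$ that preserves subalgebras (meaning $f(a_1,\dots,a_n)$ always lies in the subalgebra generated by $a_1,\dots,a_n$) is term-definable in $\mathbf{L}$. $\mathcal{A}=\mathbb{HSP}(\mathbf{L})$ is the variety generated by $\mathbf{L}$, considered as a category with homomorphisms. $\mathbb{S}(\mathbf{L})$ is the finite lattice of subalgebras of $\mathbf{L}$ ordered by inclusion. For $\ell\in L$, $T_\ell\colon L\to L$ is given by $T_\ell(\ell)=1$ and $T_\ell(x)=0$ for $x\ne\ell$; these are term-definable in $\mathbf{L}$ and hence interpreted in every $\mathbf{A}\in\mathcal{A}$. $\mathsf{BA}$ is the category of Boolean algebras; $\mathbf{2}$ is the two-element one. $\mathsf{Stone}$ is the category of Stone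 spaces (compact, Hausdorff, zero-dimensional) and continuous maps. $\Sigma\colon\mathsf{BA}\to\mathsf{Stone}$ is the contravariant Stone duality functor $\Sigma(\mathbf{B})=\mathsf{BA}(\mathbf{B},\mathbf{2})$ (ultrafilter space), acting on morphisms by precomposition. Category $\mathsf{Stone}_{\mathbf{L}}$: objects are $(X,\mathbf{v})$ with $X$ a Stone space and $\mathbf{v}\colon X\to\mathbb{S}(\mathbf{L})$ such that $\mathbf{v}^{-1}(\{\mathbf{S}'\mid \mathbf{S}'\le\mathbf{S}\})$ is closed for every $\mathbf{S}\le\mathbf{L}$; morphisms $(X,\mathbf{v})\to(Y,\mathbf{w})$ are continuous maps $m\colon X\to Y$ with $\mathbf{w}(m(x))\le\mathbf{v}(x)$ for all $x\in X$. The contravariant functor $\Pi_{\mathbf{L}}\colon \mathsf{Stone}_{\mathbf{L}}\to\mathcal{A}$ sends $(X,\mathbf{v})$ to the algebra of all continuous maps $g\colon X\to L$ ($L$ discrete) with $g(x)\in\mathbf{v}(x)$ for all $x$, with pointwise operations, and acts on morphisms by precomposition. $\mathsf{V}^\top\colon\mathsf{Stone}\to\mathsf{Stone}_{\mathbf{L}}$ sends $X$ to $(X,\mathbf{v}^\top)$ with $\mathbf{v}^\top(x)=\mathbf{L}$ for all $x$, and is the identity on morphisms. Boolean skeleton: for $\mathbf{A}\in\mathcal{A}$, $\mathfrak{S}(\mathbf{A})$ is the Boolean algebra on $\{a\in A\mid T_1(a)=a\}$ with $\wedge,\vee,0,1$ inherited from $\mathbf{A}$ and complement $T_0$; on homomorphisms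 $\mathfrak{S}$ acts by restriction. Boolean power: $\mathfrak{P}(\mathbf{B})=\mathbf{L}[\mathbf{B}]$ has as carrier all maps $\xi\colon L\to B$ with $\xi(\ell)\wedge\xi(\ell')=0$ for $\ell\neq\ell'$ and $\bigvee_{\ell\in L}\xi(\ell)=1$; for a $k$-ary operation $o$ of $\mathbf{L}$, $o^{\mathbf{L}[\mathbf{B}]}(\xi_1,\dots,\xi_k)(\ell)=\bigvee_{o^{\mathbf{L}}(\ell_1,\dots,\ell_k)=\ell}(\xi_1(\ell_1)\wedge\dots\wedge\xi_k(\ell_k))$. On a Boolean homomorphism $\varphi$, $\mathfrak{P}\varphi$ is $\xi\mapsto\varphi\circ\xi$. *)

theory Defs
  imports "HOL-Analysis.Analysis" "HOL-Algebra.FiniteProduct"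
begin

section \<open>Categories and functors\<close>

text \<open>
  Arrows do not carry their domain and codomain, so composition and the action of a functor on
  arrows take the objects involved as explicit arguments: \<open>Comp C X Y Z g f\<close> is the composite of
  \<open>f : X \<rightarrow> Y\<close> and \<open>g : Y \<rightarrow> Z\<close>.
\<close>

record ('o, 'm) category =
  Obj :: "'o set"
  Hom :: "'o \<Rightarrow> 'o \<Rightarrow> 'm set"
  Ident :: "'o \<Rightarrow> 'm"
  Comp :: "'o \<Rightarrow> 'o \<Rightarrow> 'o \<Rightarrow> 'm \<Rightarrow> 'm \<Rightarrow> 'm"

definition is_category :: "('o, 'm) category \<Rightarrow> bool" where
  "is_category C \<longleftrightarrow>
     (\<forall>X\<in>Obj C. Ident C X \<in> Hom C X X) \<and>
     (\<forall>X\<in>Obj C. \<forall>Y\<in>Obj C. \<forall>Z\<in>Obj C. \<forall>f\<in>Hom C X Y. \<forall>g\<in>Hom C Y Z.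
        Comp C X Y Z g f \<in> Hom C X Z) \<and>
     (\<forall>X\<in>Obj C. \<forall>Y\<in>Obj C. \<forall>f\<in>Hom C X Y.
        Comp C X X Y f (Ident C X) = f \<and> Comp C X Y Y (Ident C Y) f = f) \<and>
     (\<forall>W\<in>Obj C. \<forall>X\<in>Obj C. \<forall>Y\<in>Obj C. \<forall>Z\<in>Obj C.
        \<forall>f\<in>Hom C W X. \<forall>g\<in>Hom C X Y. \<forall>h\<in>Hom C Y Z.
          Comp C W Y Z h (Comp C W X Y g f) = Comp C W X Z (Comp C X Y Z h g) f)"

definition op_category :: "('o, 'm) category \<Rightarrow> ('o, 'm) category" where
  "op_category C = \<lparr>Obj = Obj C, Hom = (\<lambda>X Y. Hom C Y X), Ident = Ident C,
     Comp = (\<lambda>X Y Z g f. Comp C Z Y X f g)\<rparr>"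

text \<open>
  The category with objects \<open>Ob\<close>, underlying sets given by \<open>U\<close>, and arrows certain maps between
  underlying sets.  Arrows are extensional functions (undefined outside the domain), so that
  equality of arrows is equality of maps on the domain.
\<close>

definition concrete_category ::
    "'o set \<Rightarrow> ('o \<Rightarrow> 'a set) \<Rightarrow> ('o \<Rightarrow> 'o \<Rightarrow> ('a \<Rightarrow> 'a) set) \<Rightarrow> ('o, 'a \<Rightarrow> 'a) category" where
  "concrete_category Ob U H = \<lparr>Obj = Ob, Hom = H, Ident = (\<lambda>X. \<lambda>x\<in>U X. x),
     Comp = (\<lambda>X Y Z g f. compose (U X) g f)\<rparr>"

record ('o, 'm, 'p, 'n) functor_data =
  FObj :: "'o \<Rightarrow> 'p"
  FMap :: "'o \<Rightarrow> 'o \<Rightarrow> 'm \<Rightarrow> 'n"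

definition is_functor ::
    "('o, 'm) category \<Rightarrow> ('p, 'n) category \<Rightarrow> ('o, 'm, 'p, 'n) functor_data \<Rightarrow> bool" where
  "is_functor C D F \<longleftrightarrow>
     is_category C \<and> is_category D \<and>
     (\<forall>X\<in>Obj C. FObj F X \<in> Obj D) \<and>
     (\<forall>X\<in>Obj C. \<forall>Y\<in>Obj C. \<forall>f\<in>Hom C X Y. FMap F X Y f \<in> Hom D (FObj F X) (FObj F Y)) \<and>
     (\<forall>X\<in>Obj C. FMap F X X (Ident C X) = Ident D (FObj F X)) \<and>
     (\<forall>X\<in>Obj C. \<forall>Y\<in>Obj C. \<forall>Z\<in>Obj C. \<forall>f\<in>Hom C X Y. \<forall>g\<in>Hom C Y Z.
        FMap F X Z (Comp C X Y Z g f) =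
        Comp D (FObj F X) (FObj F Y) (FObj F Z) (FMap F Y Z g) (FMap F X Y f))"

definition comp_functor ::
    "('p, 'n, 'q, 'k) functor_data \<Rightarrow> ('o, 'm, 'p, 'n) functor_data \<Rightarrow> ('o, 'm, 'q, 'k) functor_data"
    (infixr \<open>\<circ>\<^sub>F\<close> 55) where
  "G \<circ>\<^sub>F F = \<lparr>FObj = (\<lambda>X. FObj G (FObj F X)),
     FMap = (\<lambda>X Y f. FMap G (FObj F X) (FObj F Y) (FMap F X Y f))\<rparr>"


section \<open>Algebras with bounded lattice operations in their signature\<close>

text \<open>The operation symbols are all elements of the type \<open>'f\<close>.\<close>

record 'f lattice_signature =
  arity :: "'f \<Rightarrow> nat"
  meet_sym :: 'f
  join_sym :: 'f
  zero_sym :: 'f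
  one_sym :: 'f

definition is_lattice_signature :: "'f lattice_signature \<Rightarrow> bool" where
  "is_lattice_signature sig \<longleftrightarrow> arity sig (meet_sym sig) = 2 \<and> arity sig (join_sym sig) = 2 \<and>
     arity sig (zero_sym sig) = 0 \<and> arity sig (one_sym sig) = 0"

record ('f, 'a) algebra = "'a partial_object" +
  oper :: "'f \<Rightarrow> 'a list \<Rightarrow> 'a"

definition tuples :: "nat \<Rightarrow> 'a set \<Rightarrow> 'a list set" where
  "tuples n X = {xs. length xs = n \<and> set xs \<subseteq> X}"

definition is_algebra :: "'f lattice_signature \<Rightarrow> ('f, 'a) algebra \<Rightarrow> bool" where
  "is_algebra sig A \<longleftrightarrow> (\<forall>f. \<forall>xs\<in>tuples (arity sig f) (carrier A). oper A f xs \<in> carrier A)"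

definition alg_meet :: "'f lattice_signature \<Rightarrow> ('f, 'a) algebra \<Rightarrow> 'a \<Rightarrow> 'a \<Rightarrow> 'a" where
  "alg_meet sig A x y = oper A (meet_sym sig) [x, y]"

definition alg_join :: "'f lattice_signature \<Rightarrow> ('f, 'a) algebra \<Rightarrow> 'a \<Rightarrow> 'a \<Rightarrow> 'a" where
  "alg_join sig A x y = oper A (join_sym sig) [x, y]"

definition alg_zero :: "'f lattice_signature \<Rightarrow> ('f, 'a) algebra \<Rightarrow> 'a" where
  "alg_zero sig A = oper A (zero_sym sig) []"

definition alg_one :: "'f lattice_signature \<Rightarrow> ('f, 'a) algebra \<Rightarrow> 'a" where
  "alg_one sig A = oper A (one_sym sig) []"

definition has_bounded_lattice_reduct :: "'f lattice_signature \<Rightarrow> ('f, 'a) algebra \<Rightarrow> bool" where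
  "has_bounded_lattice_reduct sig A \<longleftrightarrow>
     (\<forall>x\<in>carrier A. \<forall>y\<in>carrier A.
        alg_meet sig A x y = alg_meet sig A y x \<and>
        alg_join sig A x y = alg_join sig A y x \<and>
        alg_meet sig A x (alg_join sig A x y) = x \<and>
        alg_join sig A x (alg_meet sig A x y) = x) \<and>
     (\<forall>x\<in>carrier A. \<forall>y\<in>carrier A. \<forall>z\<in>carrier A.
        alg_meet sig A (alg_meet sig A x y) z = alg_meet sig A x (alg_meet sig A y z) \<and>
        alg_join sig A (alg_join sig A x y) z = alg_join sig A x (alg_join sig A y z)) \<and>
     (\<forall>x\<in>carrier A. alg_meet sig A x (alg_one sig A) = x \<and> alg_join sig A x (alg_zero sig A) = x)"

definition alg_hom ::
    "'f lattice_signature \<Rightarrow> ('f, 'a) algebra \<Rightarrow> ('f, 'b) algebra \<Rightarrow> ('a \<Rightarrow> 'b) set" where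
  "alg_hom sig A B = {h \<in> carrier A \<rightarrow>\<^sub>E carrier B.
     \<forall>f. \<forall>xs\<in>tuples (arity sig f) (carrier A). h (oper A f xs) = oper B f (map h xs)}"

definition alg_iso ::
    "'f lattice_signature \<Rightarrow> ('f, 'a) algebra \<Rightarrow> ('f, 'b) algebra \<Rightarrow> ('a \<Rightarrow> 'b) set" where
  "alg_iso sig A B = {h \<in> alg_hom sig A B. bij_betw h (carrier A) (carrier B)}"

definition subalgebras :: "'f lattice_signature \<Rightarrow> ('f, 'a) algebra \<Rightarrow> 'a set set" where
  "subalgebras sig A = {S. S \<subseteq> carrier A \<and> (\<forall>f. \<forall>xs\<in>tuples (arity sig f) S. oper A f xs \<in> S)}"

definition generated_subalgebra ::
    "'f lattice_signature \<Rightarrow> ('f, 'a) algebra \<Rightarrow> 'a set \<Rightarrow> 'a set" where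
  "generated_subalgebra sig A X = \<Inter>{S \<in> subalgebras sig A. X \<subseteq> S}"


subsection \<open>Terms and semi-primality\<close>

datatype 'f trm = Var nat | App 'f "'f trm list"

text \<open>\<open>wf_trm sig n t\<close>: \<open>t\<close> respects arities and contains only variables among the first \<open>n\<close>.\<close>

fun wf_trm :: "'f lattice_signature \<Rightarrow> nat \<Rightarrow> 'f trm \<Rightarrow> bool" where
  "wf_trm sig n (Var i) \<longleftrightarrow> i < n"
| "wf_trm sig n (App f ts) \<longleftrightarrow> length ts = arity sig f \<and> (\<forall>t\<in>set ts. wf_trm sig n t)"

fun eval_trm :: "('f, 'a) algebra \<Rightarrow> (nat \<Rightarrow> 'a) \<Rightarrow> 'f trm \<Rightarrow> 'a" where
  "eval_trm A v (Var i) = v i"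
| "eval_trm A v (App f ts) = oper A f (map (eval_trm A v) ts)"

definition defines_function ::
    "'f lattice_signature \<Rightarrow> ('f, 'a) algebra \<Rightarrow> nat \<Rightarrow> 'f trm \<Rightarrow> ('a list \<Rightarrow> 'a) \<Rightarrow> bool" where
  "defines_function sig A n t f \<longleftrightarrow>
     wf_trm sig n t \<and> (\<forall>xs\<in>tuples n (carrier A). eval_trm A (\<lambda>i. xs ! i) t = f xs)"

definition semi_primal :: "'f lattice_signature \<Rightarrow> ('f, 'l) algebra \<Rightarrow> bool" where
  "semi_primal sig L \<longleftrightarrow>
     (\<forall>n\<ge>1. \<forall>f. (\<forall>xs\<in>tuples n (carrier L). f xs \<in> generated_subalgebra sig L (set xs)) \<longrightarrow>
        (\<exists>t. defines_function sig L n t f))"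

text \<open>
  The interpretation in \<open>A\<close> of the term function \<open>T l\<close> of \<open>L\<close>.  Any two terms defining \<open>T l\<close> on
  \<open>L\<close> agree on all algebras of the variety generated by \<open>L\<close>, so the choice of term is immaterial.
\<close>

definition T_trm :: "'f lattice_signature \<Rightarrow> ('f, 'l) algebra \<Rightarrow> 'l \<Rightarrow> 'f trm" where
  "T_trm sig L l = (SOME t. defines_function sig L 1 t
     (\<lambda>xs. if xs ! 0 = l then alg_one sig L else alg_zero sig L))"

definition T_op ::
    "'f lattice_signature \<Rightarrow> ('f, 'l) algebra \<Rightarrow> 'l \<Rightarrow> ('f, 'a) algebra \<Rightarrow> 'a \<Rightarrow> 'a" where
  "T_op sig L l A a = eval_trm A (\<lambda>i. [a] ! i) (T_trm sig L l)"


subsection \<open>The variety generated by an algebra\<close>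

definition power_algebra :: "('f, 'l) algebra \<Rightarrow> 'i set \<Rightarrow> ('f, 'i \<Rightarrow> 'l) algebra" where
  "power_algebra L I = \<lparr>carrier = I \<rightarrow>\<^sub>E carrier L,
     oper = (\<lambda>f xs. \<lambda>i\<in>I. oper L f (map (\<lambda>x. x i) xs))\<rparr>"

text \<open>
  HSP: homomorphic images of subalgebras of powers.  A definition cannot quantify over the type of
  the index set of the power; index sets in \<open>'a \<Rightarrow> 'l\<close> suffice for algebras with carrier in \<open>'a\<close>, as
  lemma \<open>HSP_any_index_type\<close> shows.
\<close>

definition HSP :: "'f lattice_signature \<Rightarrow> ('f, 'l) algebra \<Rightarrow> ('f, 'a) algebra set" where
  "HSP sig L = {A. is_algebra sig A \<and>
     (\<exists>(I :: ('a \<Rightarrow> 'l) set) S h. S \<in> subalgebras sig (power_algebra L I) \<and>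
        h \<in> alg_hom sig (power_algebra L I\<lparr>carrier := S\<rparr>) A \<and> h ` S = carrier A)}"

lemma HSP_any_index_type:
  fixes A :: "('f, 'a) algebra" and L :: "('f, 'l) algebra" and I :: "'i set"
  assumes A: "is_algebra sig A" and L: "is_algebra sig L"
    and S: "S \<in> subalgebras sig (power_algebra L I)"
    and h: "h \<in> alg_hom sig (power_algebra L I\<lparr>carrier := S\<rparr>) A" and surj: "h ` S = carrier A"
  shows "A \<in> HSP sig L"
proof -
  have "\<forall>a\<in>carrier A. \<exists>x\<in>S. h x = a"
    using surj by (metis imageE)
  then obtain s where s: "\<And>a. a \<in> carrier A \<Longrightarrow> s a \<in> S \<and> h (s a) = a"
    by metis
  have S_sub: "S \<subseteq> I \<rightarrow>\<^sub>E carrier L"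
    using S by (auto simp: subalgebras_def power_algebra_def)
  define e where "e j = (\<lambda>a. if a \<in> carrier A then s a j else undefined)" for j
  define J where "J = e ` I"
  define \<phi> where "\<phi> x = (\<lambda>j\<in>I. x (e j))" for x :: "('a \<Rightarrow> 'l) \<Rightarrow> 'l"
  define S' where "S' = {x \<in> J \<rightarrow>\<^sub>E carrier L. \<phi> x \<in> S}"
  define h' where "h' = (\<lambda>x\<in>S'. h (\<phi> x))"
  have \<phi>_op: "\<phi> (oper (power_algebra L J) f xs) = oper (power_algebra L I) f (map \<phi> xs)" for f xs
    by (rule ext) (simp add: \<phi>_def power_algebra_def J_def comp_def)
  have closed: "oper (power_algebra L J) f xs \<in> S'" if "xs \<in> tuples (arity sig f) S'" for f xs
  proof -
    have "oper (power_algebra L J) f xs \<in> J \<rightarrow>\<^sub>E carrier L"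
    proof -
      have "oper L f (map (\<lambda>x. x i) xs) \<in> carrier L" if "i \<in> J" for i
      proof -
        have "map (\<lambda>x. x i) xs \<in> tuples (arity sig f) (carrier L)"
          using \<open>xs \<in> tuples _ _\<close> \<open>i \<in> J\<close> by (force simp: tuples_def S'_def PiE_def Pi_def)
        then show ?thesis
          using L by (auto simp: is_algebra_def)
      qed
      then show ?thesis
        by (auto simp: power_algebra_def)
    qed
    moreover have "map \<phi> xs \<in> tuples (arity sig f) S"
      using that by (auto simp: tuples_def S'_def)
    then have "oper (power_algebra L I) f (map \<phi> xs) \<in> S"
      using S by (auto simp: subalgebras_def)
    ultimately show ?thesis
      by (simp add: S'_def \<phi>_op)
  qed
  have S': "S' \<in> subalgebras sig (power_algebra L J)"
    using closed by (auto simp: subalgebras_def) (auto simp: S'_def power_algebra_def)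
  have "h' \<in> alg_hom sig (power_algebra L J\<lparr>carrier := S'\<rparr>) A"
  proof -
    have "h' (oper (power_algebra L J) f xs) = oper A f (map h' xs)"
      if xs: "xs \<in> tuples (arity sig f) S'" for f xs
    proof -
      have "map \<phi> xs \<in> tuples (arity sig f) S"
        using xs by (auto simp: tuples_def S'_def)
      then have "h (oper (power_algebra L I) f (map \<phi> xs)) = oper A f (map h (map \<phi> xs))"
        using h by (simp add: alg_hom_def)
      also have "map h (map \<phi> xs) = map h' xs"
        using xs by (auto simp: tuples_def h'_def)
      finally show ?thesis
        using closed[OF xs] by (simp add: h'_def \<phi>_op)
    qed
    moreover have "h' \<in> S' \<rightarrow>\<^sub>E carrier A"
      using surj by (auto simp: h'_def S'_def)
    ultimately show ?thesis
      by (simp add: alg_hom_def)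
  qed
  moreover have "h' ` S' = carrier A"
  proof
    show "h' ` S' \<subseteq> carrier A"
      using surj by (auto simp: h'_def S'_def)
    show "carrier A \<subseteq> h' ` S'"
    proof
      fix a assume a: "a \<in> carrier A"
      define x where "x = (\<lambda>c\<in>J. c a)"
      have sa: "s a \<in> I \<rightarrow>\<^sub>E carrier L"
        using s[OF a] S_sub by auto
      have "\<phi> x = s a"
        using a PiE_arb[OF sa] by (auto simp: \<phi>_def x_def J_def e_def fun_eq_iff)
      moreover have "x \<in> J \<rightarrow>\<^sub>E carrier L"
        using PiE_mem[OF sa] a by (auto simp: x_def J_def e_def)
      ultimately have "x \<in> S'" and "h' x = a"
        using s[OF a] by (simp_all add: h'_def S'_def)
      then show "a \<in> h' ` S'"
        by blast
    qed
  qed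
  ultimately show ?thesis
    using A S' unfolding HSP_def by blast
qed

text \<open>
  Members of the variety whose carriers are sets of elements of a fixed but arbitrary type
  \<open>'a\<close>, with all homomorphisms; the same convention applies to the other categories below.
\<close>

definition variety_cat ::
    "'f lattice_signature \<Rightarrow> ('f, 'l) algebra \<Rightarrow> (('f, 'a) algebra, 'a \<Rightarrow> 'a) category" where
  "variety_cat sig L = concrete_category (HSP sig L) carrier (alg_hom sig)"


section \<open>Boolean algebras\<close>

record 'b bool_alg = "'b partial_object" +
  bmeet :: "'b \<Rightarrow> 'b \<Rightarrow> 'b"
  bjoin :: "'b \<Rightarrow> 'b \<Rightarrow> 'b"
  bcompl :: "'b \<Rightarrow> 'b"
  bzero :: 'b
  bone :: 'b

text \<open>
  The axioms of the library locale \<open>abstract_boolean_algebra\<close>, relativised to a carrier set.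
  The one-element Boolean algebra is included.
\<close>

definition is_bool_alg :: "'b bool_alg \<Rightarrow> bool" where
  "is_bool_alg B \<longleftrightarrow>
     bzero B \<in> carrier B \<and> bone B \<in> carrier B \<and>
     (\<forall>x\<in>carrier B. bcompl B x \<in> carrier B \<and>
        bmeet B x (bone B) = x \<and> bjoin B x (bzero B) = x \<and>
        bmeet B x (bcompl B x) = bzero B \<and> bjoin B x (bcompl B x) = bone B) \<and>
     (\<forall>x\<in>carrier B. \<forall>y\<in>carrier B.
        bmeet B x y \<in> carrier B \<and> bjoin B x y \<in> carrier B \<and>
        bmeet B x y = bmeet B y x \<and> bjoin B x y = bjoin B y x) \<and>
     (\<forall>x\<in>carrier B. \<forall>y\<in>carrier B. \<forall>z\<in>carrier B.
        bmeet B (bmeet B x y) z = bmeet B x (bmeet B y z) \<and>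
        bjoin B (bjoin B x y) z = bjoin B x (bjoin B y z) \<and>
        bmeet B x (bjoin B y z) = bjoin B (bmeet B x y) (bmeet B x z) \<and>
        bjoin B x (bmeet B y z) = bmeet B (bjoin B x y) (bjoin B x z))"

definition ba_hom :: "'b bool_alg \<Rightarrow> 'c bool_alg \<Rightarrow> ('b \<Rightarrow> 'c) set" where
  "ba_hom B C = {\<phi> \<in> carrier B \<rightarrow>\<^sub>E carrier C.
     \<phi> (bzero B) = bzero C \<and> \<phi> (bone B) = bone C \<and>
     (\<forall>x\<in>carrier B. \<phi> (bcompl B x) = bcompl C (\<phi> x)) \<and>
     (\<forall>x\<in>carrier B. \<forall>y\<in>carrier B.
        \<phi> (bmeet B x y) = bmeet C (\<phi> x) (\<phi> y) \<and> \<phi> (bjoin B x y) = bjoin C (\<phi> x) (\<phi> y))}"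

definition BA_cat :: "('b bool_alg, 'b \<Rightarrow> 'b) category" where
  "BA_cat = concrete_category {B. is_bool_alg B} carrier ba_hom"

definition two :: "bool bool_alg" where
  "two = \<lparr>carrier = UNIV, bmeet = (\<and>), bjoin = (\<or>), bcompl = Not, bzero = False, bone = True\<rparr>"

text \<open>Joins of finite families, as iterated \<open>bjoin\<close> in the commutative monoid of joins.\<close>

definition ba_Join :: "'b bool_alg \<Rightarrow> ('i \<Rightarrow> 'b) \<Rightarrow> 'i set \<Rightarrow> 'b" where
  "ba_Join B f I = finprod \<lparr>carrier = carrier B, monoid.mult = bjoin B, one = bzero B\<rparr> f I"

definition ba_Meet_list :: "'b bool_alg \<Rightarrow> 'b list \<Rightarrow> 'b" where
  "ba_Meet_list B bs = foldr (bmeet B) bs (bone B)"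


section \<open>Stone spaces\<close>

definition Stone_space :: "'x topology \<Rightarrow> bool" where
  "Stone_space X \<longleftrightarrow> compact_space X \<and> Hausdorff_space X \<and>
     neighbourhood_base_of (\<lambda>V. openin X V \<and> closedin X V) X"

definition Stone_hom :: "'x topology \<Rightarrow> 'y topology \<Rightarrow> ('x \<Rightarrow> 'y) set" where
  "Stone_hom X Y = {m \<in> topspace X \<rightarrow>\<^sub>E topspace Y. continuous_map X Y m}"

definition Stone_cat :: "('x topology, 'x \<Rightarrow> 'x) category" where
  "Stone_cat = concrete_category {X. Stone_space X} topspace Stone_hom"

definition ultrafilter_space :: "'b bool_alg \<Rightarrow> ('b \<Rightarrow> bool) topology" where
  "ultrafilter_space B = topology_generated_by ((\<lambda>b. {u \<in> ba_hom B two. u b}) ` carrier B)"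

definition \<Sigma>_functor ::
    "('b bool_alg, 'b \<Rightarrow> 'b, ('b \<Rightarrow> bool) topology, ('b \<Rightarrow> bool) \<Rightarrow> ('b \<Rightarrow> bool)) functor_data" where
  "\<Sigma>_functor = \<lparr>FObj = ultrafilter_space,
     FMap = (\<lambda>B C \<phi>. \<lambda>u\<in>ba_hom C two. compose (carrier B) u \<phi>)\<rparr>"

text \<open>A subalgebra of \<open>L\<close> is represented by its carrier set, so the order on subalgebras is \<open>\<subseteq>\<close>.\<close>

definition Stone_L_space ::
    "'f lattice_signature \<Rightarrow> ('f, 'l) algebra \<Rightarrow> 'x topology \<times> ('x \<Rightarrow> 'l set) \<Rightarrow> bool" where
  "Stone_L_space sig L = (\<lambda>(X, v). Stone_space X \<and> v \<in> topspace X \<rightarrow>\<^sub>E subalgebras sig L \<and>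
     (\<forall>S\<in>subalgebras sig L. closedin X {x \<in> topspace X. v x \<subseteq> S}))"

definition Stone_L_hom ::
    "'x topology \<times> ('x \<Rightarrow> 'l set) \<Rightarrow> 'y topology \<times> ('y \<Rightarrow> 'l set) \<Rightarrow> ('x \<Rightarrow> 'y) set" where
  "Stone_L_hom = (\<lambda>(X, v) (Y, w). {m \<in> Stone_hom X Y. \<forall>x\<in>topspace X. w (m x) \<subseteq> v x})"

definition Stone_L_cat ::
    "'f lattice_signature \<Rightarrow> ('f, 'l) algebra \<Rightarrow> ('x topology \<times> ('x \<Rightarrow> 'l set), 'x \<Rightarrow> 'x) category" where
  "Stone_L_cat sig L =
     concrete_category {Xv. Stone_L_space sig L Xv} (\<lambda>(X, v). topspace X) Stone_L_hom"

definition V_top_functor :: "('f, 'l) algebra \<Rightarrow>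
    ('x topology, 'x \<Rightarrow> 'x, 'x topology \<times> ('x \<Rightarrow> 'l set), 'x \<Rightarrow> 'x) functor_data" where
  "V_top_functor L = \<lparr>FObj = (\<lambda>X. (X, \<lambda>x\<in>topspace X. carrier L)), FMap = (\<lambda>X Y m. m)\<rparr>"

definition \<Pi>_alg ::
    "('f, 'l) algebra \<Rightarrow> 'x topology \<times> ('x \<Rightarrow> 'l set) \<Rightarrow> ('f, 'x \<Rightarrow> 'l) algebra" where
  "\<Pi>_alg L = (\<lambda>(X, v). \<lparr>carrier = {g \<in> topspace X \<rightarrow>\<^sub>E carrier L.
       continuous_map X (discrete_topology (carrier L)) g \<and> (\<forall>x\<in>topspace X. g x \<in> v x)},
     oper = (\<lambda>f gs. \<lambda>x\<in>topspace X. oper L f (map (\<lambda>g. g x) gs))\<rparr>)"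

text \<open>
  The domain of \<open>\<Pi>_functor\<close> is the opposite of \<open>Stone_L_cat\<close>: an arrow from \<open>Yw\<close> to \<open>Xv\<close> in the opposite category is a map
  \<open>m : Xv \<rightarrow> Yw\<close>.
\<close>

definition \<Pi>_functor :: "('f, 'l) algebra \<Rightarrow>
    ('x topology \<times> ('x \<Rightarrow> 'l set), 'x \<Rightarrow> 'x, ('f, 'x \<Rightarrow> 'l) algebra, ('x \<Rightarrow> 'l) \<Rightarrow> ('x \<Rightarrow> 'l)) functor_data"
  where
  "\<Pi>_functor L = \<lparr>FObj = \<Pi>_alg L,
     FMap = (\<lambda>Yw Xv m. \<lambda>g\<in>carrier (\<Pi>_alg L Yw). compose (topspace (fst Xv)) g m)\<rparr>"


section \<open>Boolean skeleton and Boolean power\<close>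

definition skeleton ::
    "'f lattice_signature \<Rightarrow> ('f, 'l) algebra \<Rightarrow> ('f, 'a) algebra \<Rightarrow> 'a bool_alg" where
  "skeleton sig L A = \<lparr>carrier = {a \<in> carrier A. T_op sig L (alg_one sig L) A a = a},
     bmeet = alg_meet sig A, bjoin = alg_join sig A, bcompl = T_op sig L (alg_zero sig L) A,
     bzero = alg_zero sig A, bone = alg_one sig A\<rparr>"

definition skeleton_functor :: "'f lattice_signature \<Rightarrow> ('f, 'l) algebra \<Rightarrow>
    (('f, 'a) algebra, 'a \<Rightarrow> 'a, 'a bool_alg, 'a \<Rightarrow> 'a) functor_data" where
  "skeleton_functor sig L = \<lparr>FObj = skeleton sig L,
     FMap = (\<lambda>A A' h. restrict h (carrier (skeleton sig L A)))\<rparr>"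

definition boolean_power ::
    "'f lattice_signature \<Rightarrow> ('f, 'l) algebra \<Rightarrow> 'b bool_alg \<Rightarrow> ('f, 'l \<Rightarrow> 'b) algebra" where
  "boolean_power sig L B = \<lparr>carrier = {\<xi> \<in> carrier L \<rightarrow>\<^sub>E carrier B.
       (\<forall>l\<in>carrier L. \<forall>l'\<in>carrier L. l \<noteq> l' \<longrightarrow> bmeet B (\<xi> l) (\<xi> l') = bzero B) \<and>
       ba_Join B \<xi> (carrier L) = bone B},
     oper = (\<lambda>f \<xi>s. \<lambda>l\<in>carrier L.
       ba_Join B (\<lambda>ls. ba_Meet_list B (map2 (\<lambda>\<xi> l'. \<xi> l') \<xi>s ls))
         {ls \<in> tuples (arity sig f) (carrier L). oper L f ls = l})\<rparr>"

definition boolean_power_functor :: "'f lattice_signature \<Rightarrow> ('f, 'l) algebra \<Rightarrow>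
    ('b bool_alg, 'b \<Rightarrow> 'b, ('f, 'l \<Rightarrow> 'b) algebra, ('l \<Rightarrow> 'b) \<Rightarrow> ('l \<Rightarrow> 'b)) functor_data" where
  "boolean_power_functor sig L = \<lparr>FObj = boolean_power sig L,
     FMap = (\<lambda>B C \<phi>. \<lambda>\<xi>\<in>carrier (boolean_power sig L B). compose (carrier L) \<phi> \<xi>)\<rparr>"


section \<open>Natural isomorphism and adjunction\<close>

text \<open>
  Functors with values in the variety may produce algebras with carriers in different types
  (\<open>'x\<close> and \<open>'y\<close>), so the components of a natural isomorphism are homomorphisms between algebras
  over different types.
\<close>

definition naturally_isomorphic :: "'f lattice_signature \<Rightarrow> ('f, 'l) algebra \<Rightarrow> ('o, 'm) category \<Rightarrow>
    ('o, 'm, ('f, 'x) algebra, 'x \<Rightarrow> 'x) functor_data \<Rightarrow>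
    ('o, 'm, ('f, 'y) algebra, 'y \<Rightarrow> 'y) functor_data \<Rightarrow> bool" where
  "naturally_isomorphic sig L C F G \<longleftrightarrow>
     is_functor C (variety_cat sig L) F \<and> is_functor C (variety_cat sig L) G \<and>
     (\<exists>\<alpha>. (\<forall>X\<in>Obj C. \<alpha> X \<in> alg_iso sig (FObj F X) (FObj G X)) \<and>
        (\<forall>X\<in>Obj C. \<forall>Y\<in>Obj C. \<forall>f\<in>Hom C X Y.
           compose (carrier (FObj F X)) (FMap G X Y f) (\<alpha> X) =
           compose (carrier (FObj F X)) (\<alpha> Y) (FMap F X Y f)))"

text \<open>
  \<open>F \<stileturn> G\<close> for \<open>F\<close> from the variety to Boolean algebras and \<open>G\<close> in the other direction: a bijection
  \<open>BA(F A, B) \<cong> Hom(A, G B)\<close>, natural in \<open>A\<close> and \<open>B\<close>.  The types of carriers of \<open>A\<close>,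
  \<open>F A\<close>, \<open>B\<close> and \<open>G B\<close> are independent of each other.
\<close>

definition adjoint_pair :: "'f lattice_signature \<Rightarrow> ('f, 'l) algebra \<Rightarrow>
    (('f, 'a) algebra, 'a \<Rightarrow> 'a, 'c bool_alg, 'c \<Rightarrow> 'c) functor_data \<Rightarrow>
    ('b bool_alg, 'b \<Rightarrow> 'b, ('f, 'd) algebra, 'd \<Rightarrow> 'd) functor_data \<Rightarrow> bool" where
  "adjoint_pair sig L F G \<longleftrightarrow>
     is_functor (variety_cat sig L) BA_cat F \<and> is_functor BA_cat (variety_cat sig L) G \<and>
     (\<exists>\<Phi>. (\<forall>A\<in>HSP sig L. \<forall>B\<in>Obj BA_cat.
           bij_betw (\<Phi> A B) (ba_hom (FObj F A) B) (alg_hom sig A (FObj G B))) \<and>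
        (\<forall>A\<in>HSP sig L. \<forall>A'\<in>HSP sig L. \<forall>B\<in>Obj BA_cat. \<forall>B'\<in>Obj BA_cat.
           \<forall>h\<in>alg_hom sig A' A. \<forall>k\<in>ba_hom B B'. \<forall>f\<in>ba_hom (FObj F A) B.
             \<Phi> A' B' (compose (carrier (FObj F A')) k
                        (compose (carrier (FObj F A')) f (FMap F A' A h))) =
             compose (carrier A') (FMap G B B' k) (compose (carrier A') (\<Phi> A B f) h)))"

end

theory Submission
  imports Defs
begin

text \<open>
  Everything is checked at the points of a Boolean algebra \<open>B\<close>, its homomorphisms
  \<open>u : B \<rightarrow> 2\<close>, which separate elements by the ultrafilter theorem.  An element \<open>\<xi>\<close> of \<open>L[B]\<close> is a
  partition of unity indexed by \<open>L\<close>, so each point \<open>u\<close> singles out exactly one \<open>l\<close> with \<open>u (\<xi> l)\<close>;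
  this assignment is a homomorphism \<open>L[B] \<rightarrow> L\<close>, and letting \<open>u\<close> vary gives a map from \<open>L[B]\<close> to
  continuous functions from the Stone space of \<open>B\<close> to \<open>L\<close>, which is onto because clopen sets of the
  Stone space come from elements of \<open>B\<close>.

  For the adjunction, \<open>\<phi> : S(A) \<rightarrow> B\<close> corresponds to \<open>a \<mapsto> (l \<mapsto> \<phi> (T_l a))\<close>, with inverse
  \<open>g \<mapsto> (a \<mapsto> g a 1)\<close>.  That the former is a homomorphism into \<open>L[B]\<close> rests on identities of \<open>L\<close>, which
  transfer to every algebra of the variety: \<open>T_l x \<and> T_k x = 0\<close> for \<open>l \<noteq> k\<close>, the join of all \<open>T_l x\<close>
  is \<open>1\<close>, and the meet of the \<open>T_{l_i} x_i\<close> lies below \<open>T_{o(l_1,..,l_k)} (o(x_1,..,x_k))\<close>.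
\<close>

section \<open>Categories and functors\<close>

text \<open>The adjunction is not obtained by transporting another one along the dualities. The
  functors involved live over unrelated carrier types (elements of an algebra, of a Boolean algebra,
  maps from \<open>L\<close>, maps on ultrafilters), so an explicit bijection is given and its
  naturality is checked by hand. Semi-primality enters at a single place: \<open>T_l\<close> takes
  only the values 0 and 1, which belong to every subalgebra, so \<open>T_l\<close> is a term
  function. All that follows from this is equational and hence survives passage to HSP. Conversely,
  the duality side is what places \<open>L[B]\<close> in the variety: it is isomorphic to an algebra
  of continuous functions, visibly a subalgebra of a power of \<open>L\<close>. Compactness of the
  Stone space and the description of its clopen sets both come from one algebraic covering lemma,
  which is the ultrafilter theorem applied to finite meets of complements.\<close>

lemma is_category_concrete:
  assumes "\<And>X Y f. \<lbrakk>X \<in> Ob; Y \<in> Ob; f \<in> H X Y\<rbrakk> \<Longrightarrow> f \<in> U X \<rightarrow>\<^sub>E U Y"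
    and "\<And>X. X \<in> Ob \<Longrightarrow> (\<lambda>x\<in>U X. x) \<in> H X X"
    and "\<And>X Y Z f g. \<lbrakk>X \<in> Ob; Y \<in> Ob; Z \<in> Ob; f \<in> H X Y; g \<in> H Y Z\<rbrakk> \<Longrightarrow> compose (U X) g f \<in> H X Z"
  shows "is_category (concrete_category Ob U H)"
proof -
  have id: "compose (U X) f (\<lambda>x\<in>U X. x) = f \<and> compose (U X) (\<lambda>y\<in>U Y. y) f = f"
    if "X \<in> Ob" "Y \<in> Ob" "f \<in> H X Y" for X Y f
    using assms(1)[OF that] by (auto simp: compose_def fun_eq_iff PiE_def Pi_def extensional_def)
  have assoc: "compose (U W) h (compose (U W) g f) = compose (U W) (compose (U X) h g) f"
    if "W \<in> Ob" "X \<in> Ob" "f \<in> H W X" for W X f g h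
    using assms(1)[OF that] by (auto simp: compose_def fun_eq_iff PiE_def Pi_def)
  show ?thesis
    unfolding is_category_def concrete_category_def
    using assms(2,3) id by simp (use assoc in blast)
qed

lemma is_category_op: "is_category C \<Longrightarrow> is_category (op_category C)"
  unfolding is_category_def op_category_def by simp

lemma is_functorI:
  assumes "is_category C" "is_category D"
    and "\<And>X. X \<in> Obj C \<Longrightarrow> FObj F X \<in> Obj D"
    and "\<And>X Y f. \<lbrakk>X \<in> Obj C; Y \<in> Obj C; f \<in> Hom C X Y\<rbrakk> \<Longrightarrow>
      FMap F X Y f \<in> Hom D (FObj F X) (FObj F Y)"
    and "\<And>X. X \<in> Obj C \<Longrightarrow> FMap F X X (Ident C X) = Ident D (FObj F X)"
    and "\<And>X Y Z f g. \<lbrakk>X \<in> Obj C; Y \<in> Obj C; Z \<in> Obj C; f \<in> Hom C X Y; g \<in> Hom C Y Z\<rbrakk> \<Longrightarrow>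
      FMap F X Z (Comp C X Y Z g f) =
      Comp D (FObj F X) (FObj F Y) (FObj F Z) (FMap F Y Z g) (FMap F X Y f)"
  shows "is_functor C D F"
  unfolding is_functor_def using assms by meson

lemma cat_simps [simp]:
  "Obj (concrete_category Ob U H) = Ob" "Hom (concrete_category Ob U H) = H"
  "Ident (concrete_category Ob U H) = (\<lambda>X. \<lambda>x\<in>U X. x)"
  "Comp (concrete_category Ob U H) = (\<lambda>X Y Z g f. compose (U X) g f)"
  "Obj (op_category C) = Obj C" "Hom (op_category C) = (\<lambda>X Y. Hom C Y X)"
  "Ident (op_category C) = Ident C" "Comp (op_category C) = (\<lambda>X Y Z g f. Comp C Z Y X f g)"
  by (simp_all add: concrete_category_def op_category_def)

text \<open>The object arguments of \<open>FMap\<close> are swapped because arrows are reversed. The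
  lemma serves \<open>V_top_functor\<close>, which is covariant on Stone spaces but has to follow
  \<open>\<Sigma>_functor\<close>, whose target is the opposite category.\<close>

lemma is_functor_op:
  assumes "is_functor C D F"
  shows "is_functor (op_category C) (op_category D)
    \<lparr>FObj = FObj F, FMap = (\<lambda>X Y. FMap F Y X)\<rparr>"
  using assms unfolding is_functor_def
  by (simp add: is_category_op)

lemma is_functor_comp:
  assumes "is_functor C D F" and "is_functor D E G"
  shows "is_functor C E (G \<circ>\<^sub>F F)"
  using assms unfolding is_functor_def comp_functor_def by simp


section \<open>Boolean algebras and their ultrafilters\<close>

locale bool_alg =
  fixes B :: "'b bool_alg"
  assumes is_bool_alg: "is_bool_alg B"
begin

lemma closed [simp, intro]:
  "bzero B \<in> carrier B" "bone B \<in> carrier B"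
  "x \<in> carrier B \<Longrightarrow> bcompl B x \<in> carrier B"
  "x \<in> carrier B \<Longrightarrow> y \<in> carrier B \<Longrightarrow> bmeet B x y \<in> carrier B"
  "x \<in> carrier B \<Longrightarrow> y \<in> carrier B \<Longrightarrow> bjoin B x y \<in> carrier B"
  using is_bool_alg unfolding is_bool_alg_def by blast+

lemma ba_laws:
  assumes "x \<in> carrier B"
  shows "bmeet B x (bone B) = x" "bjoin B x (bzero B) = x"
    "bmeet B x (bcompl B x) = bzero B" "bjoin B x (bcompl B x) = bone B"
  using is_bool_alg assms unfolding is_bool_alg_def by blast+

lemma ba_comm:
  assumes "x \<in> carrier B" "y \<in> carrier B"
  shows "bmeet B x y = bmeet B y x" "bjoin B x y = bjoin B y x"
  using is_bool_alg assms unfolding is_bool_alg_def by blast+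

lemma ba_assoc:
  assumes "x \<in> carrier B" "y \<in> carrier B" "z \<in> carrier B"
  shows "bmeet B (bmeet B x y) z = bmeet B x (bmeet B y z)"
    "bjoin B (bjoin B x y) z = bjoin B x (bjoin B y z)"
  using is_bool_alg assms unfolding is_bool_alg_def by blast+

lemma ba_distrib:
  assumes "x \<in> carrier B" "y \<in> carrier B" "z \<in> carrier B"
  shows "bmeet B x (bjoin B y z) = bjoin B (bmeet B x y) (bmeet B x z)"
    "bjoin B x (bmeet B y z) = bmeet B (bjoin B x y) (bjoin B x z)"
  using is_bool_alg assms unfolding is_bool_alg_def by blast+

lemma ba_left_comm:
  assumes "x \<in> carrier B" "y \<in> carrier B" "z \<in> carrier B"
  shows "bmeet B x (bmeet B y z) = bmeet B y (bmeet B x z)"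
  using assms by (metis ba_assoc(1) ba_comm(1))

lemmas meet_ac = ba_assoc(1) ba_comm(1) ba_left_comm

lemma meet_idem:
  assumes "x \<in> carrier B" shows "bmeet B x x = x"
proof -
  have "x = bmeet B x (bjoin B x (bcompl B x))"
    using assms by (simp add: ba_laws)
  also have "\<dots> = bmeet B x x"
    using assms by (simp add: ba_distrib ba_laws del: ba_laws(4))
  finally show ?thesis ..
qed

lemma meet_zero:
  assumes "x \<in> carrier B" shows "bmeet B x (bzero B) = bzero B"
  using assms ba_assoc(1)[of x x "bcompl B x"] by (simp add: ba_laws meet_idem)

lemma meet_join_absorb:
  assumes x: "x \<in> carrier B" and y: "y \<in> carrier B"
  shows "bmeet B x (bjoin B x y) = x"
proof -
  have "bmeet B x (bjoin B x y) = bmeet B (bjoin B x (bzero B)) (bjoin B x y)"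
    using x by (simp add: ba_laws)
  also have "\<dots> = bjoin B x (bmeet B (bzero B) y)"
    using x y by (simp add: ba_distrib(2))
  also have "\<dots> = x"
    using x y ba_comm(1)[of "bzero B" y] by (simp add: meet_zero ba_laws)
  finally show ?thesis .
qed

section \<open>The ultrafilter theorem\<close>

text \<open>A filter base rather than a filter: upward closure is not demanded, because a maximal
  set of this kind has it automatically. This keeps the one-element extension simple and lets
  families of finite meets be used as they are.\<close>

definition proper_meet_closed :: "'b set \<Rightarrow> bool" where
  "proper_meet_closed F \<longleftrightarrow> F \<subseteq> carrier B \<and> bone B \<in> F \<and> bzero B \<notin> F \<and>
     (\<forall>x\<in>F. \<forall>y\<in>F. bmeet B x y \<in> F)"

text \<open>Zorn's lemma gives a maximal set \<open>M\<close> above \<open>F\<close>. Everything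
  rests on \<open>ex\<close>: each element outside \<open>M\<close> is disjoint from some member of
  \<open>M\<close>. The characteristic function of \<open>M\<close> is then compatible with all
  operations.\<close>

lemma ultrafilter_exists:
  assumes F: "proper_meet_closed F"
  shows "\<exists>u\<in>ba_hom B two. \<forall>b\<in>F. u b"
proof -
  define \<A> where "\<A> = {G. proper_meet_closed G \<and> F \<subseteq> G}"
  have "\<exists>M\<in>\<A>. \<forall>X\<in>\<A>. M \<subseteq> X \<longrightarrow> X = M"
  proof (rule subset_Zorn_nonempty)
    show "\<A> \<noteq> {}"
      using F by (auto simp: \<A>_def)
    fix \<C> assume ne: "\<C> \<noteq> {}" and ch: "subset.chain \<A> \<C>"
    have sub: "\<C> \<subseteq> \<A>" and lin: "\<And>X Y. X \<in> \<C> \<Longrightarrow> Y \<in> \<C> \<Longrightarrow> X \<subseteq> Y \<or> Y \<subseteq> X"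
      using ch by (auto simp: subset.chain_def)
    have "bmeet B x y \<in> \<Union>\<C>" if "X \<in> \<C>" "x \<in> X" "Y \<in> \<C>" "y \<in> Y" for x y X Y
    proof -
      have "\<exists>Z\<in>\<C>. x \<in> Z \<and> y \<in> Z"
        using lin[of X Y] that by blast
      then show ?thesis
        using sub by (auto simp: \<A>_def proper_meet_closed_def)
    qed
    then show "\<Union>\<C> \<in> \<A>"
      using ne sub unfolding \<A>_def proper_meet_closed_def by fastforce
  qed
  then obtain M where M: "proper_meet_closed M" "F \<subseteq> M"
    and max: "\<And>X. proper_meet_closed X \<Longrightarrow> M \<subseteq> X \<Longrightarrow> X = M"
    by (auto simp: \<A>_def)
  have sub: "M \<subseteq> carrier B" and one: "bone B \<in> M" and zero: "bzero B \<notin> M"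
    and meet: "\<And>x y. x \<in> M \<Longrightarrow> y \<in> M \<Longrightarrow> bmeet B x y \<in> M"
    using M by (auto simp: proper_meet_closed_def)
  note subD = subsetD[OF sub]
  \<comment> \<open>Otherwise adjoining \<open>b\<close> and all \<open>bmeet B m b\<close> would
    keep zero out and contradict maximality; \<open>b\<close> itself arises from
    \<open>m = bone B\<close>.\<close>
  have ex: "\<exists>m\<in>M. bmeet B m b = bzero B" if b: "b \<in> carrier B" "b \<notin> M" for b
  proof (rule ccontr)
    assume *: "\<not> ?thesis"
    let ?X = "M \<union> (\<lambda>m. bmeet B m b) ` M"
    have mb: "bmeet B (bmeet B m b) n = bmeet B (bmeet B m n) b"
      "bmeet B n (bmeet B m b) = bmeet B (bmeet B n m) b"
      "bmeet B (bmeet B m b) (bmeet B n b) = bmeet B (bmeet B m n) b"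
      if "m \<in> M" "n \<in> M" for m n
    proof -
      have c: "m \<in> carrier B" "n \<in> carrier B"
        using that subD by auto
      then show "bmeet B (bmeet B m b) n = bmeet B (bmeet B m n) b"
        "bmeet B n (bmeet B m b) = bmeet B (bmeet B n m) b"
        using b by (simp_all add: meet_ac)
      have "bmeet B (bmeet B m b) (bmeet B n b) = bmeet B (bmeet B m n) (bmeet B b b)"
        using b c by (simp only: meet_ac closed)
      then show "bmeet B (bmeet B m b) (bmeet B n b) = bmeet B (bmeet B m n) b"
        using b by (simp add: meet_idem)
    qed
    have "proper_meet_closed ?X"
      unfolding proper_meet_closed_def
    proof (intro conjI ballI)
      show "?X \<subseteq> carrier B" "bone B \<in> ?X"
        using b subD one by auto
      show "bzero B \<notin> ?X"
        using zero * by force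
      fix x y assume x: "x \<in> ?X" and y: "y \<in> ?X"
      obtain m where m: "m \<in> M" "x = m \<or> x = bmeet B m b"
        using x by blast
      obtain n where n: "n \<in> M" "y = n \<or> y = bmeet B n b"
        using y by blast
      have "bmeet B x y = bmeet B m n \<or> bmeet B x y = bmeet B (bmeet B m n) b"
        using m n mb[OF m(1) n(1)] mb(2)[OF n(1) m(1)] by presburger
      then show "bmeet B x y \<in> ?X"
        using meet[OF m(1) n(1)] by (elim disjE) simp_all
    qed
    then have "?X = M"
      using max by blast
    moreover have "bmeet B (bone B) b \<in> ?X"
      using one by blast
    ultimately show False
      using b by (metis ba_comm(1) ba_laws(1) closed(2))
  qed
  have no: False if "m \<in> M" "bmeet B m b = bzero B" "b \<in> M" for m b
    using meet[OF that(1,3)] that zero by simp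
  define u where "u = (\<lambda>b\<in>carrier B. b \<in> M)"
  have meet_iff: "bmeet B x y \<in> M \<longleftrightarrow> x \<in> M \<and> y \<in> M"
    if "x \<in> carrier B" "y \<in> carrier B" for x y
  proof -
    \<comment> \<open>This is the upward closure left out of \<open>proper_meet_closed\<close>: an
      \<open>m\<close> disjoint from \<open>x\<close> is also disjoint from
      \<open>bmeet B x y\<close>.\<close>
    have "x \<in> M" if x: "x \<in> carrier B" and y: "y \<in> carrier B" and xy: "bmeet B x y \<in> M" for x y
    proof (rule ccontr)
      assume "x \<notin> M"
      then obtain m where m: "m \<in> M" "bmeet B m x = bzero B"
        using ex x by blast
      then have "bmeet B m (bmeet B x y) = bzero B"
        using x y subD by (metis ba_assoc(1) ba_comm(1) closed(1) meet_zero)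
      then show False
        using no m xy by blast
    qed
    then show ?thesis
      using that meet by (metis ba_comm(1))
  qed
  have compl_iff: "bcompl B x \<in> M \<longleftrightarrow> x \<notin> M" if x: "x \<in> carrier B" for x
  proof
    assume "bcompl B x \<in> M"
    then show "x \<notin> M"
      using no[of x "bcompl B x"] x by (auto simp: ba_laws)
  next
    assume "x \<notin> M"
    then obtain m where m: "m \<in> M" "bmeet B m x = bzero B"
      using ex x by blast
    show "bcompl B x \<in> M"
    proof (rule ccontr)
      assume "bcompl B x \<notin> M"
      then obtain n where n: "n \<in> M" "bmeet B n (bcompl B x) = bzero B"
        using ex x by blast
      have c: "m \<in> carrier B" "n \<in> carrier B"
        using m n subD by auto
      \<comment> \<open>Split along \<open>x\<close> and its complement: \<open>m\<close>
        annihilates one half and \<open>n\<close> the other, so two members of \<open>M\<close>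
        would meet in zero.\<close>
      have "bmeet B m n = bmeet B (bmeet B m n) (bjoin B x (bcompl B x))"
        using x c by (simp add: ba_laws)
      also have "\<dots> = bjoin B (bmeet B n (bmeet B m x)) (bmeet B m (bmeet B n (bcompl B x)))"
        using x c by (simp add: ba_distrib(1) meet_ac del: ba_laws)
      also have "\<dots> = bzero B"
        using m n c by (simp add: meet_zero ba_laws)
      finally show False
        using meet m n zero by metis
    qed
  qed
  have join_iff: "bjoin B x y \<in> M \<longleftrightarrow> x \<in> M \<or> y \<in> M"
    if x: "x \<in> carrier B" and y: "y \<in> carrier B" for x y
  proof -
    have 1: "bjoin B x y \<in> M" if "x \<in> M" "y \<in> carrier B" for x y
      using meet_iff[of x "bjoin B x y"] that meet_join_absorb[of x y] subD by auto
    have False if j: "bjoin B x y \<in> M" and "x \<notin> M" "y \<notin> M"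
    proof -
      \<comment> \<open>\<open>?c\<close> is the complement of the join in De Morgan form. It is
        disjoint from the join, so not both can lie in \<open>M\<close>.\<close>
      have "bmeet B (bcompl B x) (bcompl B y) \<in> M" (is "?c \<in> M")
        using that x y by (simp add: meet_iff compl_iff)
      moreover have "bmeet B ?c (bjoin B x y) =
          bjoin B (bmeet B (bcompl B y) (bmeet B x (bcompl B x)))
            (bmeet B (bcompl B x) (bmeet B y (bcompl B y)))"
        using x y by (simp add: ba_distrib(1) meet_ac del: ba_laws)
      then have "bmeet B ?c (bjoin B x y) = bzero B"
        using x y by (simp add: ba_laws meet_zero)
      ultimately show False
        using no j by blast
    qed
    then show ?thesis
      using 1 x y by (metis ba_comm(2))
  qed
  have "u \<in> ba_hom B two"
    by (simp add: ba_hom_def two_def u_def meet_iff join_iff compl_iff one zero)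
  moreover have "\<forall>b\<in>F. u b"
    using M sub by (auto simp: u_def)
  ultimately show ?thesis
    by blast
qed

end

section \<open>Homomorphisms of Boolean algebras and points\<close>

lemma point_simps [simp]:
  assumes "u \<in> ba_hom B two"
  shows "\<not> u (bzero B)" "u (bone B)"
    "x \<in> carrier B \<Longrightarrow> u (bcompl B x) \<longleftrightarrow> \<not> u x"
    "x \<in> carrier B \<Longrightarrow> y \<in> carrier B \<Longrightarrow> u (bmeet B x y) \<longleftrightarrow> u x \<and> u y"
    "x \<in> carrier B \<Longrightarrow> y \<in> carrier B \<Longrightarrow> u (bjoin B x y) \<longleftrightarrow> u x \<or> u y"
  using assms unfolding ba_hom_def two_def by simp_all

lemma ba_hom_funcset: "\<phi> \<in> ba_hom B C \<Longrightarrow> \<phi> \<in> carrier B \<rightarrow>\<^sub>E carrier C"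
  unfolding ba_hom_def mem_Collect_eq by (elim conjE)

lemma ba_hom_closed: "\<phi> \<in> ba_hom B C \<Longrightarrow> x \<in> carrier B \<Longrightarrow> \<phi> x \<in> carrier C"
  using ba_hom_funcset PiE_mem by metis

lemma ba_hom_simps:
  assumes "\<phi> \<in> ba_hom B C"
  shows "\<phi> (bzero B) = bzero C" "\<phi> (bone B) = bone C"
    "x \<in> carrier B \<Longrightarrow> \<phi> (bcompl B x) = bcompl C (\<phi> x)"
    "x \<in> carrier B \<Longrightarrow> y \<in> carrier B \<Longrightarrow> \<phi> (bmeet B x y) = bmeet C (\<phi> x) (\<phi> y)"
    "x \<in> carrier B \<Longrightarrow> y \<in> carrier B \<Longrightarrow> \<phi> (bjoin B x y) = bjoin C (\<phi> x) (\<phi> y)"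
  using assms unfolding ba_hom_def mem_Collect_eq by meson+

lemma ba_hom_compose:
  assumes B: "is_bool_alg B" and f: "\<phi> \<in> ba_hom B C" and g: "\<psi> \<in> ba_hom C D"
  shows "compose (carrier B) \<psi> \<phi> \<in> ba_hom B D"
proof -
  interpret bool_alg B by standard (rule B)
  have "compose (carrier B) \<psi> \<phi> \<in> carrier B \<rightarrow>\<^sub>E carrier D"
    using ba_hom_closed[OF f] ba_hom_closed[OF g] by (simp add: compose_def)
  then show ?thesis
    unfolding ba_hom_def
    using ba_hom_simps[OF f] ba_hom_simps[OF g] ba_hom_closed[OF f] by (simp add: compose_def)
qed

context bool_alg
begin

text \<open>The seed is the two-element set of \<open>bone B\<close> and \<open>b\<close>, which is
  closed under meets and avoids zero.\<close>

lemma point_exists: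
  assumes b: "b \<in> carrier B" "b \<noteq> bzero B"
  shows "\<exists>u\<in>ba_hom B two. u b"
proof -
  have "proper_meet_closed {bone B, b}"
    using b meet_idem ba_laws ba_comm by (auto simp: proper_meet_closed_def)
      (metis ba_laws(1) closed(2) meet_zero)
  then show ?thesis
    using ultrafilter_exists by blast
qed

text \<open>If \<open>x\<close> were not below \<open>y\<close>, a point would contain
  \<open>x\<close> and the complement of \<open>y\<close>. Hence that meet is zero and the
  decomposition of \<open>x\<close> along \<open>y\<close> gives \<open>x = bmeet B x y\<close>;
  symmetry finishes. From here on equations in \<open>B\<close> are proved in two-valued
  logic.\<close>

lemma eq_by_points:
  assumes x: "x \<in> carrier B" and y: "y \<in> carrier B"
    and eq: "\<And>u. u \<in> ba_hom B two \<Longrightarrow> u x \<longleftrightarrow> u y"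
  shows "x = y"
proof -
  have le: "bmeet B x y = x"
    if x: "x \<in> carrier B" and y: "y \<in> carrier B"
      and eq: "\<And>u. u \<in> ba_hom B two \<Longrightarrow> u x \<longleftrightarrow> u y" for x y
  proof -
    have "bmeet B x (bcompl B y) = bzero B"
      using point_exists[of "bmeet B x (bcompl B y)"] x y eq by auto
    moreover have "x = bjoin B (bmeet B x y) (bmeet B x (bcompl B y))"
      using x y by (metis ba_distrib(1) ba_laws(1,4) closed(3))
    ultimately show ?thesis
      using x y ba_laws(2)[of "bmeet B x y"] by simp
  qed
  show ?thesis
    using le[OF x y eq] le[OF y x] eq ba_comm(1)[OF x y] by metis
qed

section \<open>Finite joins and meets seen from a point\<close>

lemma join_comm_monoid:
  "comm_monoid \<lparr>carrier = carrier B, monoid.mult = bjoin B, one = bzero B\<rparr>"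
  by (rule comm_monoidI) (simp_all add: ba_laws ba_assoc ba_comm[of "bzero B"], rule ba_comm)

lemma ba_Join_closed:
  assumes "f \<in> I \<rightarrow> carrier B"
  shows "ba_Join B f I \<in> carrier B"
  using comm_monoid.finprod_closed[OF join_comm_monoid] assms
  unfolding ba_Join_def by auto

lemma point_Join:
  assumes u: "u \<in> ba_hom B two" and "finite I" "f \<in> I \<rightarrow> carrier B"
  shows "u (ba_Join B f I) \<longleftrightarrow> (\<exists>i\<in>I. u (f i))"
  using assms(2,3)
proof (induction I)
  case empty
  then show ?case
    using u by (simp add: ba_Join_def comm_monoid.finprod_empty[OF join_comm_monoid])
next
  case (insert i I)
  then have "ba_Join B f (insert i I) = bjoin B (f i) (ba_Join B f I)"
    unfolding ba_Join_def
    by (subst comm_monoid.finprod_insert[OF join_comm_monoid]) auto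
  moreover have "ba_Join B f I \<in> carrier B"
    using insert.prems by (intro ba_Join_closed) auto
  ultimately show ?case
    using insert u by auto
qed

lemma ba_Meet_list_closed: "set bs \<subseteq> carrier B \<Longrightarrow> ba_Meet_list B bs \<in> carrier B"
  by (induction bs) (auto simp: ba_Meet_list_def)

lemma point_Meet_list:
  assumes u: "u \<in> ba_hom B two" and "set bs \<subseteq> carrier B"
  shows "u (ba_Meet_list B bs) \<longleftrightarrow> (\<forall>b\<in>set bs. u b)"
  using assms(2)
proof (induction bs)
  case (Cons b bs)
  then show ?case
    using u ba_Meet_list_closed[of bs] by (simp add: ba_Meet_list_def)
qed (use u in \<open>simp add: ba_Meet_list_def\<close>)


section \<open>The Stone space of a Boolean algebra\<close>

definition basic :: "'b \<Rightarrow> ('b \<Rightarrow> bool) set" where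
  "basic b = {u \<in> ba_hom B two. u b}"

lemma basic_iff: "u \<in> basic b \<longleftrightarrow> u \<in> ba_hom B two \<and> u b"
  by (simp add: basic_def)

lemma topspace_ultrafilter_space [simp]: "topspace (ultrafilter_space B) = ba_hom B two"
  by (auto simp: ultrafilter_space_def)

lemma openin_basic: "b \<in> carrier B \<Longrightarrow> openin (ultrafilter_space B) (basic b)"
  unfolding ultrafilter_space_def basic_def by (rule topology_generated_by_Basis) auto

lemma closedin_basic:
  assumes "b \<in> carrier B"
  shows "closedin (ultrafilter_space B) (basic b)"
proof -
  have "topspace (ultrafilter_space B) - basic b = basic (bcompl B b)"
    using assms by (auto simp: basic_def)
  then show ?thesis
    using openin_basic assms unfolding closedin_def by (auto simp: basic_def)
qed

text \<open>\<open>topology_generated_by\<close> only makes these sets a subbase. They form a base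
  because \<open>basic b\<close> and \<open>basic c\<close> intersect in
  \<open>basic (bmeet B b c)\<close>.\<close>

lemma basic_base:
  assumes "openin (ultrafilter_space B) W" "u \<in> W"
  shows "\<exists>b\<in>carrier B. u \<in> basic b \<and> basic b \<subseteq> W"
proof -
  have "generate_topology_on ((\<lambda>b. {u \<in> ba_hom B two. u b}) ` carrier B) W"
    using assms(1) unfolding ultrafilter_space_def by (simp add: openin_topology_generated_by_iff)
  then show ?thesis
    using assms(2)
  proof (induction arbitrary: u)
    case (Int V W)
    obtain b c where bc: "b \<in> carrier B" "c \<in> carrier B" "u \<in> basic b" "u \<in> basic c"
      "basic b \<subseteq> V" "basic c \<subseteq> W"
      using Int.IH(1)[of u] Int.IH(2)[of u] Int.prems by auto
    then have "u \<in> basic (bmeet B b c) \<and> basic (bmeet B b c) \<subseteq> V \<inter> W"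
      by (auto simp: basic_def)
    then show ?case
      using bc by blast
  next
    case (UN K)
    then obtain V where V: "V \<in> K" "u \<in> V"
      by blast
    then show ?case
      using UN.IH[OF V] by blast
  next
    case (Basis W)
    then show ?case by (auto simp: basic_def)
  qed simp
qed

text \<open>Compactness in algebraic form. Let \<open>F\<close> consist of the finite meets of
  complements of elements of \<open>S\<close>. If zero were not in \<open>F\<close>, some point
  would contain all of \<open>F\<close> and so avoid every member of the cover. A list whose meet of
  complements is zero is the desired finite subcover.\<close>

lemma finite_basic_cover:
  assumes S: "S \<subseteq> carrier B" and cover: "ba_hom B two \<subseteq> \<Union>(basic ` S)"
  shows "\<exists>bs. set bs \<subseteq> S \<and> ba_hom B two \<subseteq> \<Union>(basic ` set bs)"
proof -
  define F where "F = {ba_Meet_list B (map (bcompl B) bs) |bs. set bs \<subseteq> S}"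
  have c: "ba_Meet_list B (map (bcompl B) bs) \<in> carrier B" if "set bs \<subseteq> S" for bs
    using S that by (intro ba_Meet_list_closed) auto
  have iff: "u (ba_Meet_list B (map (bcompl B) bs)) \<longleftrightarrow> (\<forall>b\<in>set bs. \<not> u b)"
    if "u \<in> ba_hom B two" "set bs \<subseteq> S" for u bs
  proof -
    have "set (map (bcompl B) bs) \<subseteq> carrier B"
      using S that by auto
    then show ?thesis
      using that S by (simp add: point_Meet_list) (metis point_simps(3) subsetD)
  qed
  \<comment> \<open>At a point both sides say that it avoids every element of the two lists, so no
    computation with iterated meets is required.\<close>
  have app: "bmeet B (ba_Meet_list B (map (bcompl B) bs)) (ba_Meet_list B (map (bcompl B) cs)) =
      ba_Meet_list B (map (bcompl B) (bs @ cs))" if "set bs \<subseteq> S" "set cs \<subseteq> S" for bs cs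
    using that by (intro eq_by_points) (auto simp: c iff simp del: map_append)
  have meet: "bmeet B x y \<in> F" if "x \<in> F" "y \<in> F" for x y
  proof -
    obtain bs where "set bs \<subseteq> S" "x = ba_Meet_list B (map (bcompl B) bs)"
      using \<open>x \<in> F\<close> by (auto simp: F_def)
    moreover obtain cs where "set cs \<subseteq> S" "y = ba_Meet_list B (map (bcompl B) cs)"
      using \<open>y \<in> F\<close> by (auto simp: F_def)
    moreover have "set (bs @ cs) \<subseteq> S"
      using calculation by simp
    ultimately show ?thesis
      using app[of bs cs] unfolding F_def by blast
  qed
  have F: "F \<subseteq> carrier B"
    using c by (auto simp: F_def)
  \<comment> \<open>The empty list supplies the unit.\<close>
  have one: "bone B \<in> F"
    unfolding F_def by (auto intro!: exI[of _ "[]"] simp: ba_Meet_list_def)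
  have "\<not> proper_meet_closed F"
  proof
    assume "proper_meet_closed F"
    then obtain u where u: "u \<in> ba_hom B two" "\<forall>b\<in>F. u b"
      using ultrafilter_exists by blast
    then obtain b where b: "b \<in> S" "u b"
      using cover by (auto simp: basic_def)
    \<comment> \<open>The one-element list puts the complement of \<open>b\<close> into
      \<open>F\<close>, which contradicts \<open>u b\<close>.\<close>
    then have "u (ba_Meet_list B (map (bcompl B) [b]))"
      using u by (auto simp: F_def simp del: list.map)
        (metis empty_subsetI insert_subset list.set(1,2))
    then show False
      using b iff[of u "[b]"] u by simp
  qed
  then have "bzero B \<in> F"
    using one meet F unfolding proper_meet_closed_def by blast
  then obtain bs where bs: "set bs \<subseteq> S" "ba_Meet_list B (map (bcompl B) bs) = bzero B"
    by (auto simp: F_def)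
  have "\<exists>b\<in>set bs. u b" if "u \<in> ba_hom B two" for u
    using iff[OF that bs(1)] bs(2) that by auto
  then show ?thesis
    using bs by (auto simp: basic_def)
qed

text \<open>An open cover is refined by the basic sets that lie inside one of its members; a finite
  subcover of the refinement is lifted back by choosing such a member for each set.\<close>

lemma compact_ultrafilter_space: "compact_space (ultrafilter_space B)"
  unfolding compact_space_alt
proof (intro allI impI)
  fix \<U> assume \<U>: "Ball \<U> (openin (ultrafilter_space B)) \<and>
    topspace (ultrafilter_space B) \<subseteq> \<Union> \<U>"
  define S where "S = {b \<in> carrier B. \<exists>W\<in>\<U>. basic b \<subseteq> W}"
  have "u \<in> \<Union>(basic ` S)" if "u \<in> ba_hom B two" for u
  proof -
    obtain W where "W \<in> \<U>" "u \<in> W" "openin (ultrafilter_space B) W"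
      using \<U> \<open>u \<in> ba_hom B two\<close> by auto
    then show "u \<in> \<Union>(basic ` S)"
      using basic_base[of W u] by (auto simp: S_def)
  qed
  then have cover: "ba_hom B two \<subseteq> \<Union>(basic ` S)"
    by (rule subsetI)
  have S: "S \<subseteq> carrier B"
    by (auto simp: S_def)
  obtain bs where bs: "set bs \<subseteq> S" "ba_hom B two \<subseteq> \<Union>(basic ` set bs)"
    using finite_basic_cover[OF S cover] by (elim exE conjE)
  have "\<forall>b\<in>set bs. \<exists>W. W \<in> \<U> \<and> basic b \<subseteq> W"
    using bs(1) by (auto simp: S_def)
  then obtain W where W: "\<And>b. b \<in> set bs \<Longrightarrow> W b \<in> \<U> \<and> basic b \<subseteq> W b"
    by (metis bchoice)
  then show "\<exists>\<F>. finite \<F> \<and> \<F> \<subseteq> \<U> \<and> topspace (ultrafilter_space B) \<subseteq> \<Union> \<F>"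
    using bs(2) by (intro exI[of _ "W ` set bs"]) (simp, blast)
qed

lemma Stone_space_ultrafilter_space: "Stone_space (ultrafilter_space B)"
proof -
  have "Hausdorff_space (ultrafilter_space B)"
    unfolding Hausdorff_space_def
  proof (intro allI impI)
    fix u w assume "u \<in> topspace (ultrafilter_space B) \<and> w \<in> topspace (ultrafilter_space B) \<and> u \<noteq> w"
    then have u: "u \<in> ba_hom B two" and w: "w \<in> ba_hom B two" and "u \<noteq> w"
      by auto
    then obtain b where b: "b \<in> carrier B" "u b \<noteq> w b"
      using PiE_ext[OF ba_hom_funcset[OF u] ba_hom_funcset[OF w]] by blast
    \<comment> \<open>Two points that disagree at \<open>b\<close> are separated by \<open>b\<close>
      and its complement; the case distinction makes \<open>u\<close> the point containing
      \<open>?c\<close>.\<close>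
    let ?c = "if u b then b else bcompl B b"
    have "openin (ultrafilter_space B) (basic ?c)" "openin (ultrafilter_space B) (basic (bcompl B ?c))"
      "u \<in> basic ?c" "w \<in> basic (bcompl B ?c)" "disjnt (basic ?c) (basic (bcompl B ?c))"
      using b u w by (auto intro!: openin_basic simp: basic_iff disjnt_iff)
    then show "\<exists>U V. openin (ultrafilter_space B) U \<and> openin (ultrafilter_space B) V \<and>
        u \<in> U \<and> w \<in> V \<and> disjnt U V"
      by (intro exI conjI)
  qed
  moreover have "neighbourhood_base_of
      (\<lambda>V. openin (ultrafilter_space B) V \<and> closedin (ultrafilter_space B) V) (ultrafilter_space B)"
    unfolding neighbourhood_base_of
  proof (intro allI impI)
    fix W u assume "openin (ultrafilter_space B) W \<and> u \<in> W"
    then obtain b where "b \<in> carrier B" "u \<in> basic b" "basic b \<subseteq> W"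
      using basic_base[of W u] by blast
    then show "\<exists>U V. openin (ultrafilter_space B) U \<and>
        (openin (ultrafilter_space B) V \<and> closedin (ultrafilter_space B) V) \<and>
        u \<in> U \<and> U \<subseteq> V \<and> V \<subseteq> W"
      using openin_basic closedin_basic by (intro exI[of _ "basic b"]) simp
  qed
  ultimately show ?thesis
    by (simp add: Stone_space_def compact_ultrafilter_space)
qed

text \<open>Since \<open>W\<close> and its complement are both open, the basic sets that lie
  entirely on one side cover the space. In a finite subcover, the join of the elements on the side
  of \<open>W\<close> represents \<open>W\<close>.\<close>

lemma clopen_eq_basic:
  assumes "openin (ultrafilter_space B) W" "closedin (ultrafilter_space B) W"
  shows "\<exists>b\<in>carrier B. W = basic b"
proof -
  let ?X = "ultrafilter_space B"
  have sub: "W \<subseteq> ba_hom B two"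
    using openin_subset[OF assms(1)] by simp
  define S where "S = {b \<in> carrier B. basic b \<subseteq> W \<or> basic b \<subseteq> ba_hom B two - W}"
  have "openin ?X (ba_hom B two - W)"
    using assms(2) by (simp add: closedin_def)
  then have "u \<in> \<Union>(basic ` S)" if "u \<in> ba_hom B two" for u
    using basic_base[OF assms(1), of u] basic_base[of "ba_hom B two - W" u] that
    by (cases "u \<in> W") (auto simp: S_def)
  then have cover: "ba_hom B two \<subseteq> \<Union>(basic ` S)"
    by (rule subsetI)
  have S: "S \<subseteq> carrier B"
    by (auto simp: S_def)
  obtain bs where bs: "set bs \<subseteq> S" "ba_hom B two \<subseteq> \<Union>(basic ` set bs)"
    using finite_basic_cover[OF S cover] by (elim exE conjE)
  let ?I = "{b \<in> set bs. basic b \<subseteq> W}"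
  have I: "(\<lambda>b. b) \<in> ?I \<rightarrow> carrier B"
    using bs by (auto simp: S_def)
  have "u \<in> W \<longleftrightarrow> (\<exists>b\<in>?I. u b)" if u: "u \<in> ba_hom B two" for u
  proof
    assume uW: "u \<in> W"
    obtain b where b: "b \<in> set bs" "u \<in> basic b"
      using bs(2) u by blast
    have "basic b \<subseteq> W"
      using bs(1) b uW by (auto simp: S_def)
    then show "\<exists>b\<in>?I. u b"
      using b by (auto simp: basic_def)
  next
    assume "\<exists>b\<in>?I. u b"
    then obtain b where "basic b \<subseteq> W" "u b"
      by blast
    then show "u \<in> W"
      using u by (auto simp: basic_def)
  qed
  then have "W = basic (ba_Join B (\<lambda>b. b) ?I)"
    using sub point_Join[OF _ _ I] by (auto simp: basic_iff)
  then show ?thesis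
    using ba_Join_closed[OF I] by blast
qed

end


section \<open>Categories of Boolean algebras and Stone spaces\<close>

lemma is_category_BA: "is_category BA_cat"
  unfolding BA_cat_def
proof (rule is_category_concrete)
  show "(\<lambda>x\<in>carrier B. x) \<in> ba_hom B B" if "B \<in> {B. is_bool_alg B}" for B :: "'b bool_alg"
  proof -
    interpret bool_alg B using that by unfold_locales simp
    show ?thesis
      unfolding ba_hom_def by simp
  qed
next
  show "compose (carrier A) g f \<in> ba_hom A C"
    if "A \<in> {B. is_bool_alg B}" "f \<in> ba_hom A B" "g \<in> ba_hom B C" for A B C :: "'b bool_alg" and f g
    using that by (intro ba_hom_compose) simp_all
qed (rule ba_hom_funcset)

section \<open>Morphisms of Stone spaces, plain and labelled by subalgebras\<close>

lemma Stone_homD: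
  assumes "m \<in> Stone_hom X Y"
  shows "m \<in> topspace X \<rightarrow>\<^sub>E topspace Y" "continuous_map X Y m"
  using assms unfolding Stone_hom_def by blast+

lemma Stone_hom_mem: "m \<in> Stone_hom X Y \<Longrightarrow> x \<in> topspace X \<Longrightarrow> m x \<in> topspace Y"
  using Stone_homD(1) by (metis PiE_mem)

lemma Stone_hom_id: "(\<lambda>x\<in>topspace X. x) \<in> Stone_hom X X"
proof -
  have "continuous_map X X (\<lambda>x\<in>topspace X. x)"
    by (rule continuous_map_eq[OF continuous_map_id]) simp
  then show ?thesis
    by (simp add: Stone_hom_def)
qed

lemma Stone_hom_compose:
  assumes f: "f \<in> Stone_hom X Y" and g: "g \<in> Stone_hom Y Z"
  shows "compose (topspace X) g f \<in> Stone_hom X Z"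
proof -
  have "continuous_map X Z (g \<circ> f)"
    using Stone_homD(2)[OF f] Stone_homD(2)[OF g] by (rule continuous_map_compose)
  then have "continuous_map X Z (compose (topspace X) g f)"
    by (rule continuous_map_eq) (simp add: compose_def)
  moreover have "compose (topspace X) g f \<in> topspace X \<rightarrow>\<^sub>E topspace Z"
    using Stone_hom_mem[OF f] Stone_hom_mem[OF g] by (simp add: compose_def)
  ultimately show ?thesis
    by (simp add: Stone_hom_def)
qed

lemma is_category_Stone: "is_category Stone_cat"
  unfolding Stone_cat_def
  by (rule is_category_concrete)
    (rule Stone_homD(1) Stone_hom_id Stone_hom_compose, assumption?, assumption?)+

lemma Stone_L_homD:
  assumes "m \<in> Stone_L_hom Xv Yw"
  shows "m \<in> Stone_hom (fst Xv) (fst Yw)" "x \<in> topspace (fst Xv) \<Longrightarrow> snd Yw (m x) \<subseteq> snd Xv x"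
  using assms unfolding Stone_L_hom_def case_prod_beta' by simp_all

lemma Stone_L_homI:
  assumes "m \<in> Stone_hom (fst Xv) (fst Yw)"
    and "\<And>x. x \<in> topspace (fst Xv) \<Longrightarrow> snd Yw (m x) \<subseteq> snd Xv x"
  shows "m \<in> Stone_L_hom Xv Yw"
  using assms unfolding Stone_L_hom_def case_prod_beta' by simp

lemma Stone_L_cat_alt:
  "Stone_L_cat sig L =
    concrete_category {Xv. Stone_L_space sig L Xv} (\<lambda>Xv. topspace (fst Xv)) Stone_L_hom"
  unfolding Stone_L_cat_def by (simp add: case_prod_beta')

lemma is_category_Stone_L: "is_category (Stone_L_cat sig L)"
  unfolding Stone_L_cat_alt
proof (rule is_category_concrete)
  fix Xv Yw :: "'x topology \<times> ('x \<Rightarrow> 'l set)" and m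
  assume "m \<in> Stone_L_hom Xv Yw"
  then show "m \<in> topspace (fst Xv) \<rightarrow>\<^sub>E topspace (fst Yw)"
    by (intro Stone_homD Stone_L_homD)
next
  fix Xv :: "'x topology \<times> ('x \<Rightarrow> 'l set)"
  show "(\<lambda>x\<in>topspace (fst Xv). x) \<in> Stone_L_hom Xv Xv"
    by (intro Stone_L_homI Stone_hom_id) simp
next
  fix Xv Yw Zu :: "'x topology \<times> ('x \<Rightarrow> 'l set)" and f g
  assume f: "f \<in> Stone_L_hom Xv Yw" and g: "g \<in> Stone_L_hom Yw Zu"
  show "compose (topspace (fst Xv)) g f \<in> Stone_L_hom Xv Zu"
  proof (rule Stone_L_homI)
    show "compose (topspace (fst Xv)) g f \<in> Stone_hom (fst Xv) (fst Zu)"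
      using Stone_L_homD(1)[OF f] Stone_L_homD(1)[OF g] by (rule Stone_hom_compose)
    fix x assume x: "x \<in> topspace (fst Xv)"
    have "snd Zu (g (f x)) \<subseteq> snd Yw (f x)"
      using Stone_hom_mem[OF Stone_L_homD(1)[OF f] x] by (rule Stone_L_homD(2)[OF g])
    also have "\<dots> \<subseteq> snd Xv x"
      using x by (rule Stone_L_homD(2)[OF f])
    finally show "snd Zu (compose (topspace (fst Xv)) g f x) \<subseteq> snd Xv x"
      using x by (simp add: compose_def)
  qed
qed

text \<open>Continuity may be tested on the generating sets, and the preimage of the set of
  \<open>b\<close> under precomposition with \<open>\<phi>\<close> is the set of
  \<open>\<phi> b\<close>.\<close>

lemma ultrafilter_map_continuous:
  assumes "is_bool_alg B" and \<phi>: "\<phi> \<in> ba_hom B C" and "is_bool_alg C"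
  shows "(\<lambda>u\<in>ba_hom C two. compose (carrier B) u \<phi>)
    \<in> Stone_hom (ultrafilter_space C) (ultrafilter_space B)" (is "?m \<in> _")
proof -
  interpret B: bool_alg B by standard (rule assms)
  interpret C: bool_alg C by standard (rule assms)
  have mem: "compose (carrier B) u \<phi> \<in> ba_hom B two" if "u \<in> ba_hom C two" for u
    using assms(1) \<phi> that by (rule ba_hom_compose)
  have "continuous_map (ultrafilter_space C) (ultrafilter_space B) ?m"
    unfolding ultrafilter_space_def[of B]
  proof (rule continuous_on_generated_topo)
    fix U assume "U \<in> (\<lambda>b. {u \<in> ba_hom B two. u b}) ` carrier B"
    then obtain b where b: "b \<in> carrier B" and U: "U = {u \<in> ba_hom B two. u b}"
      by blast
    have "?m -` U \<inter> topspace (ultrafilter_space C) = C.basic (\<phi> b)"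
      unfolding U using mem b by (auto simp: C.basic_iff compose_def)
    then show "openin (ultrafilter_space C) (?m -` U \<inter> topspace (ultrafilter_space C))"
      using C.openin_basic ba_hom_closed[OF \<phi> b] by simp
  next
    \<comment> \<open>The criterion for a generated topology also asks that the image be covered by
      the generators; the generator of the unit already contains every point.\<close>
    have "u (bone B)" if "u \<in> ba_hom B two" for u
      using that by simp
    then show "?m ` topspace (ultrafilter_space C) \<subseteq> \<Union> ((\<lambda>b. {u \<in> ba_hom B two. u b}) ` carrier B)"
      using mem by (auto intro!: bexI[of _ "bone B"])
  qed
  then show ?thesis
    using mem by (simp add: Stone_hom_def)
qed

lemma is_functor_\<Sigma>: "is_functor BA_cat (op_category Stone_cat) \<Sigma>_functor"
proof (rule is_functorI)
  fix B :: "'b bool_alg" assume "B \<in> Obj BA_cat"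
  then interpret bool_alg B by unfold_locales (simp add: BA_cat_def)
  show "FObj \<Sigma>_functor B \<in> Obj (op_category Stone_cat)"
    by (simp add: \<Sigma>_functor_def Stone_cat_def Stone_space_ultrafilter_space)
  have "compose (carrier B) u (\<lambda>x\<in>carrier B. x) = u" if "u \<in> ba_hom B two" for u
    using ba_hom_funcset[OF that] by (auto simp: compose_def fun_eq_iff PiE_def extensional_def)
  then show "FMap \<Sigma>_functor B B (Ident BA_cat B) = Ident (op_category Stone_cat) (FObj \<Sigma>_functor B)"
    by (simp add: \<Sigma>_functor_def Stone_cat_def BA_cat_def cong: restrict_cong)
next
  fix B C :: "'b bool_alg" and \<phi>
  assume "B \<in> Obj BA_cat" "C \<in> Obj BA_cat" "\<phi> \<in> Hom BA_cat B C"
  then show "FMap \<Sigma>_functor B C \<phi> \<in>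
      Hom (op_category Stone_cat) (FObj \<Sigma>_functor B) (FObj \<Sigma>_functor C)"
    using ultrafilter_map_continuous[of B \<phi> C] by (simp add: \<Sigma>_functor_def Stone_cat_def BA_cat_def)
next
  fix B C D :: "'b bool_alg" and \<phi> \<psi>
  assume *: "B \<in> Obj BA_cat" "C \<in> Obj BA_cat" "D \<in> Obj BA_cat"
    "\<phi> \<in> Hom BA_cat B C" "\<psi> \<in> Hom BA_cat C D"
  interpret D: bool_alg D
    using *(3) by unfold_locales (simp add: BA_cat_def)
  have "compose (carrier B) u (compose (carrier B) \<psi> \<phi>) =
      compose (carrier B) (compose (carrier C) u \<psi>) \<phi>" for u :: "'b \<Rightarrow> bool"
    using * ba_hom_closed[of \<phi> B C] by (auto simp: compose_def fun_eq_iff BA_cat_def)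
  moreover have "compose (carrier C) u \<psi> \<in> ba_hom C two" if "u \<in> ba_hom D two" for u
    using * ba_hom_compose[of C \<psi> D u two] that by (simp add: BA_cat_def)
  ultimately show "FMap \<Sigma>_functor B D (Comp BA_cat B C D \<psi> \<phi>) =
      Comp (op_category Stone_cat) (FObj \<Sigma>_functor B) (FObj \<Sigma>_functor C) (FObj \<Sigma>_functor D)
        (FMap \<Sigma>_functor C D \<psi>) (FMap \<Sigma>_functor B C \<phi>)"
    by (auto simp: \<Sigma>_functor_def Stone_cat_def BA_cat_def compose_def[of "ba_hom D two"])
qed (simp_all add: is_category_BA is_category_op is_category_Stone)

lemma is_functor_V_top:
  assumes L: "is_algebra sig L"
  shows "is_functor Stone_cat (Stone_L_cat sig L) (V_top_functor L)"
proof (rule is_functorI[OF is_category_Stone is_category_Stone_L])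
  fix X :: "'x topology" assume X: "X \<in> Obj Stone_cat"
  have "carrier L \<in> subalgebras sig L"
    using L by (auto simp: subalgebras_def is_algebra_def)
  \<comment> \<open>With a constant labelling, each set that must be closed is the whole space or
    empty.\<close>
  moreover have "{x \<in> topspace X. (\<lambda>x\<in>topspace X. carrier L) x \<subseteq> S} =
      (if carrier L \<subseteq> S then topspace X else {})" for S
    by auto
  ultimately show "FObj (V_top_functor L) X \<in> Obj (Stone_L_cat sig L)"
    using X by (simp add: V_top_functor_def Stone_L_cat_def Stone_cat_def Stone_L_space_def)
next
  fix X Y :: "'x topology" and m assume "m \<in> Hom Stone_cat X Y"
  then show "FMap (V_top_functor L) X Y m \<in>
      Hom (Stone_L_cat sig L) (FObj (V_top_functor L) X) (FObj (V_top_functor L) Y)"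
    using Stone_hom_mem[of m X Y]
    by (auto simp: V_top_functor_def Stone_L_cat_def Stone_cat_def Stone_L_hom_def)
qed (simp_all add: V_top_functor_def
    Stone_L_cat_def Stone_cat_def)


section \<open>The variety generated by an algebra\<close>

lemma alg_hom_funcset: "h \<in> alg_hom sig A B \<Longrightarrow> h \<in> carrier A \<rightarrow>\<^sub>E carrier B"
  unfolding alg_hom_def mem_Collect_eq by (elim conjE)

lemma alg_hom_closed: "h \<in> alg_hom sig A B \<Longrightarrow> x \<in> carrier A \<Longrightarrow> h x \<in> carrier B"
  using alg_hom_funcset PiE_mem by metis

lemma alg_hom_oper:
  "h \<in> alg_hom sig A B \<Longrightarrow> xs \<in> tuples (arity sig f) (carrier A) \<Longrightarrow>
    h (oper A f xs) = oper B f (map h xs)"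
  unfolding alg_hom_def mem_Collect_eq by meson

lemma alg_homI:
  assumes "h \<in> carrier A \<rightarrow>\<^sub>E carrier B"
    and "\<And>f xs. xs \<in> tuples (arity sig f) (carrier A) \<Longrightarrow> h (oper A f xs) = oper B f (map h xs)"
  shows "h \<in> alg_hom sig A B"
  using assms unfolding alg_hom_def mem_Collect_eq by meson

lemma is_algebraD:
  "is_algebra sig A \<Longrightarrow> xs \<in> tuples (arity sig f) (carrier A) \<Longrightarrow> oper A f xs \<in> carrier A"
  by (simp add: is_algebra_def)

lemma map_tuples: "xs \<in> tuples n A \<Longrightarrow> (\<And>x. x \<in> A \<Longrightarrow> h x \<in> B) \<Longrightarrow> map h xs \<in> tuples n B"
  by (auto simp: tuples_def)

lemma alg_hom_compose:
  assumes A: "is_algebra sig A" and f: "f \<in> alg_hom sig A B" and g: "g \<in> alg_hom sig B C"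
  shows "compose (carrier A) g f \<in> alg_hom sig A C"
proof (rule alg_homI)
  show "compose (carrier A) g f \<in> carrier A \<rightarrow>\<^sub>E carrier C"
    using alg_hom_closed[OF f] alg_hom_closed[OF g] by (simp add: compose_def)
  fix p xs assume xs: "xs \<in> tuples (arity sig p) (carrier A)"
  have fxs: "map f xs \<in> tuples (arity sig p) (carrier B)"
    using xs alg_hom_closed[OF f] by (rule map_tuples)
  have "map (compose (carrier A) g f) xs = map g (map f xs)"
    using xs by (auto simp: compose_def tuples_def)
  then show "compose (carrier A) g f (oper A p xs) = oper C p (map (compose (carrier A) g f) xs)"
    using is_algebraD[OF A xs] alg_hom_oper[OF f xs] alg_hom_oper[OF g fxs]
    by (simp add: compose_eq del: map_eq_conv map_map)
qed

lemma alg_hom_id: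
  assumes A: "is_algebra sig A"
  shows "(\<lambda>x\<in>carrier A. x) \<in> alg_hom sig A A"
proof (rule alg_homI)
  fix p xs assume xs: "xs \<in> tuples (arity sig p) (carrier A)"
  have "map (\<lambda>x\<in>carrier A. x) xs = xs"
    using xs by (intro map_idI) (auto simp: tuples_def)
  then show "(\<lambda>x\<in>carrier A. x) (oper A p xs) = oper A p (map (\<lambda>x\<in>carrier A. x) xs)"
    using is_algebraD[OF A xs] by simp
qed simp

lemma HSP_is_algebra: "A \<in> HSP sig L \<Longrightarrow> is_algebra sig A"
  by (simp add: HSP_def)

lemma is_category_variety:
  fixes sig :: "'f lattice_signature" and L :: "('f, 'l) algebra"
  shows "is_category (variety_cat sig L)"
  unfolding variety_cat_def
proof (rule is_category_concrete)
  show "f \<in> carrier A \<rightarrow>\<^sub>E carrier B" if "f \<in> alg_hom sig A B" for A B :: "('f, 'a) algebra" and f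
    using that by (rule alg_hom_funcset)
  show "(\<lambda>x\<in>carrier A. x) \<in> alg_hom sig A A" if "A \<in> HSP sig L" for A :: "('f, 'a) algebra"
    using that by (intro alg_hom_id HSP_is_algebra)
  show "compose (carrier A) g f \<in> alg_hom sig A C"
    if "A \<in> HSP sig L" "f \<in> alg_hom sig A B" "g \<in> alg_hom sig B C"
    for A B C :: "('f, 'a) algebra" and f g
    using that by (intro alg_hom_compose HSP_is_algebra)
qed

section \<open>Closure of the variety under images and isomorphisms\<close>

text \<open>Closure under H across carrier types. The index set of the power is taken from the type
  of \<open>A\<close>, so composing the two surjections must be followed by re-indexing over the
  type of \<open>C\<close>, which \<open>HSP_any_index_type\<close> provides.\<close>

lemma HSP_image:
  fixes A :: "('f, 'a) algebra" and C :: "('f, 'c) algebra" and L :: "('f, 'l) algebra"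
  assumes L: "is_algebra sig L" and A: "A \<in> HSP sig L" and C: "is_algebra sig C"
    and k: "k \<in> alg_hom sig A C" and surj: "k ` carrier A = carrier C"
  shows "C \<in> HSP sig L"
proof -
  obtain I :: "('a \<Rightarrow> 'l) set" and S h
    where S: "S \<in> subalgebras sig (power_algebra L I)"
      and h: "h \<in> alg_hom sig (power_algebra L I\<lparr>carrier := S\<rparr>) A" and "h ` S = carrier A"
    using A unfolding HSP_def by blast
  have "is_algebra sig (power_algebra L I\<lparr>carrier := S\<rparr>)"
    using S by (auto simp: is_algebra_def subalgebras_def)
  then have "compose S k h \<in> alg_hom sig (power_algebra L I\<lparr>carrier := S\<rparr>) C"
    using alg_hom_compose[OF _ h k] by simp
  moreover have "compose S k h ` S = carrier C"
    unfolding surj[symmetric] \<open>h ` S = carrier A\<close>[symmetric] by (auto simp: compose_def image_iff)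
  ultimately show ?thesis
    by (rule HSP_any_index_type[OF C L S])
qed

lemma alg_iso_inverse:
  assumes C: "is_algebra sig C" and k: "k \<in> alg_iso sig C A"
  shows "(\<lambda>y\<in>carrier A. inv_into (carrier C) k y) \<in> alg_iso sig A C"
proof -
  have hom: "k \<in> alg_hom sig C A" and bij: "bij_betw k (carrier C) (carrier A)"
    using k by (auto simp: alg_iso_def)
  let ?i = "\<lambda>y\<in>carrier A. inv_into (carrier C) k y"
  have i: "?i y \<in> carrier C" "k (?i y) = y" if "y \<in> carrier A" for y
    using bij that by (simp_all add: bij_betw_def inv_into_into f_inv_into_f)
  have ki: "?i (k x) = x" if "x \<in> carrier C" for x
    using bij that alg_hom_closed[OF hom that] by (simp add: bij_betw_def)
  have "?i \<in> alg_hom sig A C"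
  proof (rule alg_homI)
    show "?i \<in> carrier A \<rightarrow>\<^sub>E carrier C"
      using i(1) by (simp add: PiE_def)
    fix f ys assume ys: "ys \<in> tuples (arity sig f) (carrier A)"
    have iys: "map ?i ys \<in> tuples (arity sig f) (carrier C)"
      using ys i(1) by (rule map_tuples)
    have "map k (map ?i ys) = ys"
      using ys i(2) by (auto simp: tuples_def intro!: map_idI)
    then have "k (oper C f (map ?i ys)) = oper A f ys"
      using alg_hom_oper[OF hom iys] by simp
    then show "?i (oper A f ys) = oper C f (map ?i ys)"
      using ki[OF is_algebraD[OF C iys]] by simp
  qed
  moreover have "bij_betw ?i (carrier A) (carrier C)"
    by (rule bij_betw_byWitness[where f' = k]) (use i ki alg_hom_closed[OF hom] in auto)
  ultimately show ?thesis
    by (simp add: alg_iso_def)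
qed

text \<open>The algebra \<open>C\<close> is the image of \<open>A\<close> under the inverse
  isomorphism. The intended \<open>C\<close> is a Boolean power and the intended \<open>A\<close>
  its dual description.\<close>

lemma HSP_of_iso:
  assumes L: "is_algebra sig L" and A: "A \<in> HSP sig L" and C: "is_algebra sig C"
    and k: "k \<in> alg_iso sig C A"
  shows "C \<in> HSP sig L"
proof -
  have "(\<lambda>y\<in>carrier A. inv_into (carrier C) k y) \<in> alg_iso sig A C"
    using C k by (rule alg_iso_inverse)
  then show ?thesis
    using HSP_image[OF L A C] unfolding alg_iso_def bij_betw_def by blast
qed

section \<open>Algebras of continuous functions and the functor \<Pi>\<close>

text \<open>The algebra sits inside the power of \<open>L\<close> indexed by the points. Values stay
  in \<open>v x\<close> because \<open>v x\<close> is a subalgebra, and continuity is preserved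
  because maps into a discrete space are locally constant and operations are finitary.\<close>

lemma \<Pi>_alg_in_HSP:
  assumes L: "is_algebra sig L" and X: "Stone_L_space sig L Xv"
  shows "\<Pi>_alg L Xv \<in> HSP sig L"
proof -
  obtain X v where Xv: "Xv = (X, v)"
    by (cases Xv)
  let ?P = "\<Pi>_alg L (X, v)"
  have v: "v x \<in> subalgebras sig L" if "x \<in> topspace X" for x
    using X that unfolding Xv Stone_L_space_def by auto
  have closed: "oper ?P f gs \<in> carrier ?P" if gs: "gs \<in> tuples (arity sig f) (carrier ?P)" for f gs
  proof -
    have mem: "oper L f (map (\<lambda>g. g x) gs) \<in> v x" if "x \<in> topspace X" for x
    proof -
      have "map (\<lambda>g. g x) gs \<in> tuples (arity sig f) (v x)"
        using gs that by (auto simp: tuples_def \<Pi>_alg_def)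
      then show ?thesis
        using v[OF that] by (auto simp: subalgebras_def)
    qed
    then have memL: "oper L f (map (\<lambda>g. g x) gs) \<in> carrier L" if "x \<in> topspace X" for x
      using v[OF that] that by (auto simp: subalgebras_def)
    have "openin X {x \<in> topspace X. oper L f (map (\<lambda>g. g x) gs) \<in> U}" for U
    proof (subst openin_subopen, intro ballI)
      fix x assume x: "x \<in> {x \<in> topspace X. oper L f (map (\<lambda>g. g x) gs) \<in> U}"
      \<comment> \<open>On this neighbourhood of \<open>x\<close> every argument keeps its value at
        \<open>x\<close>, hence so does the result. Intersecting with \<open>topspace X\<close>
        covers nullary operations, where no argument restricts anything.\<close>
      let ?W = "topspace X \<inter> (\<Inter>g\<in>set gs. {y \<in> topspace X. g y \<in> {g x}})"
      have "openin X {y \<in> topspace X. g y \<in> {g x}}" if "g \<in> set gs" for g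
      proof (rule openin_continuous_map_preimage)
        show "continuous_map X (discrete_topology (carrier L)) g"
          using gs that by (auto simp: tuples_def \<Pi>_alg_def)
        show "openin (discrete_topology (carrier L)) {g x}"
          using gs that x by (auto simp: tuples_def \<Pi>_alg_def)
      qed
      then have "openin X ?W"
        by (cases "gs = []") (auto intro!: openin_Int_Inter)
      moreover have "?W \<subseteq> {x \<in> topspace X. oper L f (map (\<lambda>g. g x) gs) \<in> U}"
      proof
        fix y assume y: "y \<in> ?W"
        then have "map (\<lambda>g. g y) gs = map (\<lambda>g. g x) gs"
          by simp
        then show "y \<in> {x \<in> topspace X. oper L f (map (\<lambda>g. g x) gs) \<in> U}"
          using x y by (simp del: map_eq_conv)
      qed
      ultimately show "\<exists>T. openin X T \<and> x \<in> T \<and> T \<subseteq> {x \<in> topspace X. oper L f (map (\<lambda>g. g x) gs) \<in> U}"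
        using x by (intro exI[of _ ?W]) auto
    qed
    then have "continuous_map X (discrete_topology (carrier L)) (oper ?P f gs)"
      using memL by (simp add: continuous_map_def \<Pi>_alg_def cong: conj_cong)
    then show ?thesis
      using mem memL by (simp add: \<Pi>_alg_def)
  qed
  let ?I = "topspace X"
  have sub: "carrier ?P \<subseteq> ?I \<rightarrow>\<^sub>E carrier L"
    by (auto simp: \<Pi>_alg_def)
  have op: "oper (power_algebra L ?I) f gs = oper ?P f gs" for f gs
    by (simp add: power_algebra_def \<Pi>_alg_def)
  have "carrier ?P \<in> subalgebras sig (power_algebra L ?I)"
    using sub closed by (simp add: subalgebras_def op) (simp add: power_algebra_def)
  moreover have "(\<lambda>g\<in>carrier ?P. g) \<in> alg_hom sig (power_algebra L ?I\<lparr>carrier := carrier ?P\<rparr>) ?P"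
  proof (rule alg_homI)
    fix f gs assume "gs \<in> tuples (arity sig f) (carrier (power_algebra L ?I\<lparr>carrier := carrier ?P\<rparr>))"
    then have gs: "gs \<in> tuples (arity sig f) (carrier ?P)"
      by simp
    then have "map (\<lambda>g\<in>carrier ?P. g) gs = gs"
      by (intro map_idI) (auto simp: tuples_def)
    then show "(\<lambda>g\<in>carrier ?P. g) (oper (power_algebra L ?I\<lparr>carrier := carrier ?P\<rparr>) f gs) =
        oper ?P f (map (\<lambda>g\<in>carrier ?P. g) gs)"
      using closed[OF gs] by (simp add: op)
  qed simp
  moreover have "is_algebra sig ?P"
    using closed by (simp add: is_algebra_def)
  ultimately show ?thesis
    unfolding Xv by (intro HSP_any_index_type[OF _ L]) auto
qed

lemma \<Pi>_carrierD:
  assumes "g \<in> carrier (\<Pi>_alg L Xv)"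
  shows "g \<in> topspace (fst Xv) \<rightarrow>\<^sub>E carrier L"
    "continuous_map (fst Xv) (discrete_topology (carrier L)) g"
    "x \<in> topspace (fst Xv) \<Longrightarrow> g x \<in> snd Xv x"
  using assms by (auto simp: \<Pi>_alg_def split: prod.splits)

lemma \<Pi>_carrierI:
  assumes "g \<in> topspace (fst Xv) \<rightarrow>\<^sub>E carrier L"
    "continuous_map (fst Xv) (discrete_topology (carrier L)) g"
    "\<And>x. x \<in> topspace (fst Xv) \<Longrightarrow> g x \<in> snd Xv x"
  shows "g \<in> carrier (\<Pi>_alg L Xv)"
  using assms by (auto simp: \<Pi>_alg_def split: prod.splits)

lemma \<Pi>_oper:
  "oper (\<Pi>_alg L Xv) f gs = (\<lambda>x\<in>topspace (fst Xv). oper L f (map (\<lambda>g. g x) gs))"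
  by (simp add: \<Pi>_alg_def split: prod.splits)

lemma is_functor_\<Pi>:
  fixes sig :: "'f lattice_signature" and L :: "('f, 'l) algebra"
  assumes L: "is_algebra sig L"
  shows "is_functor (op_category (Stone_L_cat sig L)) (variety_cat sig L) (\<Pi>_functor L)"
proof (rule is_functorI)
  fix Xv :: "'x topology \<times> ('x \<Rightarrow> 'l set)" assume "Xv \<in> Obj (op_category (Stone_L_cat sig L))"
  then show "FObj (\<Pi>_functor L) Xv \<in> Obj (variety_cat sig L)"
    using \<Pi>_alg_in_HSP[OF L] by (simp add: \<Pi>_functor_def variety_cat_def Stone_L_cat_alt)
  have "compose (topspace (fst Xv)) g (\<lambda>x\<in>topspace (fst Xv). x) = g"
    if "g \<in> carrier (\<Pi>_alg L Xv)" for g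
    using \<Pi>_carrierD(1)[OF that] by (auto simp: compose_def fun_eq_iff PiE_def extensional_def)
  then show "FMap (\<Pi>_functor L) Xv Xv (Ident (op_category (Stone_L_cat sig L)) Xv) =
      Ident (variety_cat sig L) (FObj (\<Pi>_functor L) Xv)"
    by (simp add: \<Pi>_functor_def variety_cat_def Stone_L_cat_alt cong: restrict_cong)
next
  have mem: "compose (topspace (fst Xv)) g m \<in> carrier (\<Pi>_alg L Xv)"
    if m: "m \<in> Stone_L_hom Xv Yw" and g: "g \<in> carrier (\<Pi>_alg L Yw)"
    for Xv Yw :: "'x topology \<times> ('x \<Rightarrow> 'l set)" and m g
  proof (rule \<Pi>_carrierI)
    note m' = Stone_L_homD(1)[OF m]
    have "continuous_map (fst Xv) (discrete_topology (carrier L)) (g \<circ> m)"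
      using Stone_homD(2)[OF m'] \<Pi>_carrierD(2)[OF g] by (rule continuous_map_compose)
    then show "continuous_map (fst Xv) (discrete_topology (carrier L)) (compose (topspace (fst Xv)) g m)"
      by (rule continuous_map_eq) (simp add: compose_def)
    show "compose (topspace (fst Xv)) g m \<in> topspace (fst Xv) \<rightarrow>\<^sub>E carrier L"
      using PiE_mem[OF \<Pi>_carrierD(1)[OF g]] Stone_hom_mem[OF m'] by (simp add: compose_def)
    \<comment> \<open>The direction of the inequality for morphisms is what is wanted here:
      \<open>g (m x)\<close> lies in \<open>snd Yw (m x)\<close>, which is contained in
      \<open>snd Xv x\<close>.\<close>
    show "compose (topspace (fst Xv)) g m x \<in> snd Xv x" if x: "x \<in> topspace (fst Xv)" for x
      using \<Pi>_carrierD(3)[OF g Stone_hom_mem[OF m' x]] Stone_L_homD(2)[OF m x] x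
      by (auto simp: compose_def)
  qed
  {
    fix Xv Yw :: "'x topology \<times> ('x \<Rightarrow> 'l set)" and m
    assume "Xv \<in> Obj (op_category (Stone_L_cat sig L))" "Yw \<in> Obj (op_category (Stone_L_cat sig L))"
      and "m \<in> Hom (op_category (Stone_L_cat sig L)) Yw Xv"
    then have Y: "is_algebra sig (\<Pi>_alg L Yw)" and m: "m \<in> Stone_L_hom Xv Yw"
      using HSP_is_algebra[OF \<Pi>_alg_in_HSP[OF L, of Yw]] by (simp_all add: Stone_L_cat_alt)
    show "FMap (\<Pi>_functor L) Yw Xv m \<in>
        Hom (variety_cat sig L) (FObj (\<Pi>_functor L) Yw) (FObj (\<Pi>_functor L) Xv)"
      unfolding variety_cat_def cat_simps
    proof (rule alg_homI)
      show "FMap (\<Pi>_functor L) Yw Xv m \<in>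
          carrier (FObj (\<Pi>_functor L) Yw) \<rightarrow>\<^sub>E carrier (FObj (\<Pi>_functor L) Xv)"
        using mem[OF m] by (simp add: \<Pi>_functor_def)
      fix f gs assume "gs \<in> tuples (arity sig f) (carrier (FObj (\<Pi>_functor L) Yw))"
      then have gs: "gs \<in> tuples (arity sig f) (carrier (\<Pi>_alg L Yw))"
        by (simp add: \<Pi>_functor_def)
      then have eq: "map (\<lambda>g. g (m x)) gs =
          map (\<lambda>g. g x) (map (\<lambda>g\<in>carrier (\<Pi>_alg L Yw). compose (topspace (fst Xv)) g m) gs)"
        if "x \<in> topspace (fst Xv)" for x
        using that by (auto simp: tuples_def compose_def)
      show "FMap (\<Pi>_functor L) Yw Xv m (oper (FObj (\<Pi>_functor L) Yw) f gs) =
          oper (FObj (\<Pi>_functor L) Xv) f (map (FMap (\<Pi>_functor L) Yw Xv m) gs)"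
        using is_algebraD[OF Y gs] Stone_hom_mem[OF Stone_L_homD(1)[OF m]]
        by (simp add: \<Pi>_functor_def \<Pi>_oper eq[symmetric] compose_def[of _ "restrict h D" for h D]
            del: map_eq_conv map_map cong: restrict_cong)
    qed
  }
  {
    fix Xv Yw Zu :: "'x topology \<times> ('x \<Rightarrow> 'l set)" and m n
    assume "m \<in> Hom (op_category (Stone_L_cat sig L)) Zu Yw"
      "n \<in> Hom (op_category (Stone_L_cat sig L)) Yw Xv"
    then have m: "m \<in> Stone_L_hom Yw Zu" and n: "n \<in> Stone_L_hom Xv Yw"
      by (simp_all add: Stone_L_cat_alt)
    have "compose (topspace (fst Xv)) g (compose (topspace (fst Xv)) m n) =
        compose (topspace (fst Xv)) (compose (topspace (fst Yw)) g m) n" for g :: "'x \<Rightarrow> 'l"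
      using Stone_hom_mem[OF Stone_L_homD(1)[OF n]] by (auto simp: compose_def fun_eq_iff)
    then show "FMap (\<Pi>_functor L) Zu Xv (Comp (op_category (Stone_L_cat sig L)) Zu Yw Xv n m) =
        Comp (variety_cat sig L) (FObj (\<Pi>_functor L) Zu) (FObj (\<Pi>_functor L) Yw)
          (FObj (\<Pi>_functor L) Xv) (FMap (\<Pi>_functor L) Yw Xv n) (FMap (\<Pi>_functor L) Zu Yw m)"
      using mem[OF m]
      by (simp add: \<Pi>_functor_def variety_cat_def Stone_L_cat_alt
          compose_def[of "carrier (\<Pi>_alg L Zu)"] cong: restrict_cong)
  }
qed (simp_all add: is_category_op is_category_Stone_L is_category_variety)

section \<open>Boolean powers\<close>

locale finite_boolean_power = bool_alg B for B :: "'b bool_alg" +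
  fixes sig :: "'f lattice_signature" and L :: "('f, 'l) algebra"
  assumes L: "is_algebra sig L" and fin: "finite (carrier L)"
begin

lemma finite_tuples: "finite {ls \<in> tuples n (carrier L). P ls}"
  using finite_lists_length_eq[OF fin, of n] by (auto simp: tuples_def conj_commute intro: finite_subset)

text \<open>Evaluated at a point, disjointness of the entries says that at most one of them holds,
  and join equal to one says that at least one does. Later membership proofs in \<open>L[B]\<close>
  go through this form.\<close>

lemma boolean_power_carrier_iff:
  assumes \<xi>: "\<xi> \<in> carrier L \<rightarrow>\<^sub>E carrier B"
  shows "\<xi> \<in> carrier (boolean_power sig L B) \<longleftrightarrow>
    (\<forall>u\<in>ba_hom B two. \<exists>!l. l \<in> carrier L \<and> u (\<xi> l))"
proof -
  have mem: "\<xi> l \<in> carrier B" if "l \<in> carrier L" for l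
    using PiE_mem[OF \<xi> that] .
  then have F: "\<xi> \<in> carrier L \<rightarrow> carrier B"
    by blast
  have disj: "bmeet B (\<xi> l) (\<xi> l') = bzero B \<longleftrightarrow> (\<forall>u\<in>ba_hom B two. \<not> (u (\<xi> l) \<and> u (\<xi> l')))"
    if "l \<in> carrier L" "l' \<in> carrier L" for l l'
  proof
    assume *: "bmeet B (\<xi> l) (\<xi> l') = bzero B"
    show "\<forall>u\<in>ba_hom B two. \<not> (u (\<xi> l) \<and> u (\<xi> l'))"
    proof
      fix u assume u: "u \<in> ba_hom B two"
      then show "\<not> (u (\<xi> l) \<and> u (\<xi> l'))"
        using point_simps(4)[OF u mem[OF that(1)] mem[OF that(2)]] * by simp
    qed
  next
    assume *: "\<forall>u\<in>ba_hom B two. \<not> (u (\<xi> l) \<and> u (\<xi> l'))"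
    show "bmeet B (\<xi> l) (\<xi> l') = bzero B"
      by (rule eq_by_points) (use * mem that in auto)
  qed
  have join: "ba_Join B \<xi> (carrier L) = bone B \<longleftrightarrow> (\<forall>u\<in>ba_hom B two. \<exists>l\<in>carrier L. u (\<xi> l))"
  proof
    assume *: "ba_Join B \<xi> (carrier L) = bone B"
    show "\<forall>u\<in>ba_hom B two. \<exists>l\<in>carrier L. u (\<xi> l)"
    proof
      fix u assume "u \<in> ba_hom B two"
      then show "\<exists>l\<in>carrier L. u (\<xi> l)"
        using point_Join[OF _ fin F, of u] * by simp
    qed
  next
    assume *: "\<forall>u\<in>ba_hom B two. \<exists>l\<in>carrier L. u (\<xi> l)"
    show "ba_Join B \<xi> (carrier L) = bone B"
    proof (rule eq_by_points)
      show "u (ba_Join B \<xi> (carrier L)) \<longleftrightarrow> u (bone B)" if "u \<in> ba_hom B two" for u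
        using point_Join[OF that fin F] * that by simp
    qed (simp_all add: ba_Join_closed[OF F])
  qed
  have all_disj: "(\<forall>l\<in>carrier L. \<forall>l'\<in>carrier L. l \<noteq> l' \<longrightarrow> bmeet B (\<xi> l) (\<xi> l') = bzero B) \<longleftrightarrow>
      (\<forall>u\<in>ba_hom B two. \<forall>l\<in>carrier L. \<forall>l'\<in>carrier L. l \<noteq> l' \<longrightarrow> \<not> (u (\<xi> l) \<and> u (\<xi> l')))"
    using disj by meson
  have ex1: "(\<exists>!l. l \<in> carrier L \<and> u (\<xi> l)) \<longleftrightarrow> (\<exists>l\<in>carrier L. u (\<xi> l)) \<and>
      (\<forall>l\<in>carrier L. \<forall>l'\<in>carrier L. l \<noteq> l' \<longrightarrow> \<not> (u (\<xi> l) \<and> u (\<xi> l')))" for u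
    unfolding ex1_iff_ex_Uniq Uniq_def by (rule arg_cong2[of _ _ _ _ "(\<and>)"]; metis)
  have "\<xi> \<in> carrier (boolean_power sig L B) \<longleftrightarrow>
      (\<forall>l\<in>carrier L. \<forall>l'\<in>carrier L. l \<noteq> l' \<longrightarrow> bmeet B (\<xi> l) (\<xi> l') = bzero B) \<and>
      ba_Join B \<xi> (carrier L) = bone B"
    using \<xi> by (simp add: boolean_power_def)
  also have "\<dots> \<longleftrightarrow> (\<forall>u\<in>ba_hom B two. \<exists>!l. l \<in> carrier L \<and> u (\<xi> l))"
    unfolding join ex1 all_disj ball_conj_distrib by (rule conj_commute)
  finally show ?thesis .
qed

definition value_at :: "('b \<Rightarrow> bool) \<Rightarrow> ('l \<Rightarrow> 'b) \<Rightarrow> 'l" where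
  "value_at u \<xi> = (THE l. l \<in> carrier L \<and> u (\<xi> l))"

lemma boolean_power_funcset:
  "\<xi> \<in> carrier (boolean_power sig L B) \<Longrightarrow> \<xi> \<in> carrier L \<rightarrow>\<^sub>E carrier B"
  by (simp add: boolean_power_def)

lemma boolean_power_mem:
  "\<xi> \<in> carrier (boolean_power sig L B) \<Longrightarrow> l \<in> carrier L \<Longrightarrow> \<xi> l \<in> carrier B"
  using boolean_power_funcset PiE_mem by metis

lemma value_at:
  assumes u: "u \<in> ba_hom B two" and \<xi>: "\<xi> \<in> carrier (boolean_power sig L B)"
  shows "value_at u \<xi> \<in> carrier L" "l \<in> carrier L \<Longrightarrow> u (\<xi> l) \<longleftrightarrow> value_at u \<xi> = l"
proof -
  have ex: "\<exists>!l. l \<in> carrier L \<and> u (\<xi> l)"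
    using boolean_power_carrier_iff[OF boolean_power_funcset[OF \<xi>]] \<xi> u by blast
  show "value_at u \<xi> \<in> carrier L"
    using theI'[OF ex] unfolding value_at_def by blast
  show "u (\<xi> l) \<longleftrightarrow> value_at u \<xi> = l" if "l \<in> carrier L"
    using theI'[OF ex] ex that unfolding value_at_def by blast
qed

lemma boolean_power_eqI:
  assumes "\<xi> \<in> carrier (boolean_power sig L B)" "\<zeta> \<in> carrier (boolean_power sig L B)"
    and "\<And>u. u \<in> ba_hom B two \<Longrightarrow> value_at u \<xi> = value_at u \<zeta>"
  shows "\<xi> = \<zeta>"
proof (rule PiE_ext[OF boolean_power_funcset[OF assms(1)] boolean_power_funcset[OF assms(2)]])
  fix l assume "l \<in> carrier L"
  then show "\<xi> l = \<zeta> l"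
    using assms boolean_power_mem by (intro eq_by_points) (simp_all add: value_at)
qed

lemma map2_closed:
  assumes \<xi>s: "\<xi>s \<in> tuples m (carrier (boolean_power sig L B))" and ls: "ls \<in> tuples n (carrier L)"
  shows "set (map2 (\<lambda>\<xi> l. \<xi> l) \<xi>s ls) \<subseteq> carrier B"
proof
  fix b assume "b \<in> set (map2 (\<lambda>\<xi> l. \<xi> l) \<xi>s ls)"
  then obtain \<xi> l where b: "b = \<xi> l" and in_zip: "(\<xi>, l) \<in> set (zip \<xi>s ls)"
    by auto
  have "\<xi> \<in> carrier (boolean_power sig L B)" "l \<in> carrier L"
    using set_zip_leftD[OF in_zip] set_zip_rightD[OF in_zip] \<xi>s ls by (auto simp: tuples_def)
  then show "b \<in> carrier B"
    unfolding b by (rule boolean_power_mem)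
qed

text \<open>At \<open>u\<close>, the meet belonging to the tuple \<open>ls\<close> holds for exactly
  one \<open>ls\<close>, the tuple of values of the arguments. The join therefore holds iff that
  tuple belongs to its index set, that is, iff the operation of \<open>L\<close> sends it to
  \<open>l\<close>.\<close>

lemma point_boolean_power_oper:
  assumes u: "u \<in> ba_hom B two" and \<xi>s: "\<xi>s \<in> tuples (arity sig f) (carrier (boolean_power sig L B))"
    and l: "l \<in> carrier L"
  shows "u (oper (boolean_power sig L B) f \<xi>s l) \<longleftrightarrow> oper L f (map (value_at u) \<xi>s) = l"
proof -
  let ?I = "{ls \<in> tuples (arity sig f) (carrier L). oper L f ls = l}"
  let ?g = "\<lambda>ls. ba_Meet_list B (map2 (\<lambda>\<xi> l'. \<xi> l') \<xi>s ls)"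
  have op: "oper (boolean_power sig L B) f \<xi>s l = ba_Join B ?g ?I"
    using l by (simp add: boolean_power_def)
  note sub = map2_closed[OF \<xi>s]
  have g: "?g \<in> ?I \<rightarrow> carrier B"
    by (intro Pi_I ba_Meet_list_closed sub) (elim CollectE conjE)
  have "u (?g ls) \<longleftrightarrow> ls = map (value_at u) \<xi>s" if ls: "ls \<in> tuples (arity sig f) (carrier L)" for ls
  proof -
    have len: "length \<xi>s = length ls" and \<xi>: "\<And>i. i < length ls \<Longrightarrow> \<xi>s ! i \<in> carrier (boolean_power sig L B)"
      and li: "\<And>i. i < length ls \<Longrightarrow> ls ! i \<in> carrier L"
      using ls \<xi>s nth_mem subsetD unfolding tuples_def mem_Collect_eq by metis+
    have "u (?g ls) \<longleftrightarrow> (\<forall>b\<in>set (map2 (\<lambda>\<xi> l'. \<xi> l') \<xi>s ls). u b)"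
      by (rule point_Meet_list[OF u sub[OF ls]])
    also have "\<dots> \<longleftrightarrow> (\<forall>i<length ls. u ((\<xi>s ! i) (ls ! i)))"
    proof -
      have "set (map2 (\<lambda>\<xi> l'. \<xi> l') \<xi>s ls) = (\<lambda>i. (\<xi>s ! i) (ls ! i)) ` {..<length ls}"
        using len by (auto simp: set_zip image_iff)
      then show ?thesis
        by simp (simp add: Ball_def)
    qed
    also have "\<dots> \<longleftrightarrow> (\<forall>i<length ls. ls ! i = value_at u (\<xi>s ! i))"
      using value_at(2)[OF u \<xi> li] by metis
    also have "\<dots> \<longleftrightarrow> ls = map (value_at u) \<xi>s"
      using len by (simp add: list_eq_iff_nth_eq)
    finally show ?thesis .
  qed
  moreover have "map (value_at u) \<xi>s \<in> tuples (arity sig f) (carrier L)"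
    using \<xi>s value_at(1)[OF u] by (rule map_tuples)
  ultimately show "u (oper (boolean_power sig L B) f \<xi>s l) \<longleftrightarrow> oper L f (map (value_at u) \<xi>s) = l"
    unfolding op point_Join[OF u finite_tuples g] by auto
qed

lemma is_algebra_boolean_power: "is_algebra sig (boolean_power sig L B)"
  unfolding is_algebra_def
proof (intro allI ballI)
  fix f \<xi>s assume \<xi>s: "\<xi>s \<in> tuples (arity sig f) (carrier (boolean_power sig L B))"
  have ex: "\<exists>!l. l \<in> carrier L \<and> u (oper (boolean_power sig L B) f \<xi>s l)" if u: "u \<in> ba_hom B two" for u
  proof -
    have "oper L f (map (value_at u) \<xi>s) \<in> carrier L"
      using map_tuples[OF \<xi>s value_at(1)[OF u]] by (rule is_algebraD[OF L])
    then show ?thesis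
      using point_boolean_power_oper[OF u \<xi>s] by blast
  qed
  have fs: "oper (boolean_power sig L B) f \<xi>s \<in> carrier L \<rightarrow>\<^sub>E carrier B"
  proof
    show "oper (boolean_power sig L B) f \<xi>s l \<in> carrier B" if "l \<in> carrier L" for l
    proof -
      have "(\<lambda>ls. ba_Meet_list B (map2 (\<lambda>\<xi> l'. \<xi> l') \<xi>s ls))
          \<in> {ls \<in> tuples (arity sig f) (carrier L). oper L f ls = l} \<rightarrow> carrier B"
        by (intro Pi_I ba_Meet_list_closed map2_closed[OF \<xi>s]) (elim CollectE conjE)
      then show ?thesis
        using that ba_Join_closed by (simp add: boolean_power_def)
    qed
  qed (simp add: boolean_power_def)
  show "oper (boolean_power sig L B) f \<xi>s \<in> carrier (boolean_power sig L B)"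
    using boolean_power_carrier_iff[OF fs] ex by blast
qed

lemma value_at_oper:
  assumes u: "u \<in> ba_hom B two" and \<xi>s: "\<xi>s \<in> tuples (arity sig f) (carrier (boolean_power sig L B))"
  shows "value_at u (oper (boolean_power sig L B) f \<xi>s) = oper L f (map (value_at u) \<xi>s)"
proof -
  have l: "oper L f (map (value_at u) \<xi>s) \<in> carrier L"
    using map_tuples[OF \<xi>s value_at(1)[OF u]] by (rule is_algebraD[OF L])
  show ?thesis
    using value_at(2)[OF u is_algebraD[OF is_algebra_boolean_power \<xi>s] l]
      point_boolean_power_oper[OF u \<xi>s l] by simp
qed

text \<open>Stated for the extensional restriction, so that it can be composed with a homomorphism
  from an algebra \<open>A\<close> into \<open>L[B]\<close> and yield one from \<open>A\<close> to
  \<open>L\<close>.\<close>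

lemma value_at_hom:
  assumes "u \<in> ba_hom B two"
  shows "(\<lambda>\<xi>\<in>carrier (boolean_power sig L B). value_at u \<xi>) \<in> alg_hom sig (boolean_power sig L B) L"
proof (rule alg_homI)
  fix f \<xi>s assume \<xi>s: "\<xi>s \<in> tuples (arity sig f) (carrier (boolean_power sig L B))"
  have "map (restrict (value_at u) (carrier (boolean_power sig L B))) \<xi>s = map (value_at u) \<xi>s"
    using \<xi>s by (auto simp: tuples_def)
  then show "restrict (value_at u) (carrier (boolean_power sig L B)) (oper (boolean_power sig L B) f \<xi>s) =
      oper L f (map (restrict (value_at u) (carrier (boolean_power sig L B))) \<xi>s)"
    using is_algebraD[OF is_algebra_boolean_power \<xi>s] value_at_oper[OF assms \<xi>s]
    by (simp del: map_eq_conv)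
qed (use value_at(1)[OF assms] in simp)

section \<open>The Boolean power as an algebra of continuous functions\<close>

abbreviation dual_alg :: "('f, ('b \<Rightarrow> bool) \<Rightarrow> 'l) algebra" where
  "dual_alg \<equiv> \<Pi>_alg L (FObj (V_top_functor L) (ultrafilter_space B))"

definition to_dual :: "('l \<Rightarrow> 'b) \<Rightarrow> ('b \<Rightarrow> bool) \<Rightarrow> 'l" where
  "to_dual = (\<lambda>\<xi>\<in>carrier (boolean_power sig L B). \<lambda>u\<in>ba_hom B two. value_at u \<xi>)"

lemma to_dual_mem:
  assumes \<xi>: "\<xi> \<in> carrier (boolean_power sig L B)"
  shows "to_dual \<xi> \<in> carrier dual_alg"
proof (rule \<Pi>_carrierI)
  have mem: "to_dual \<xi> u = value_at u \<xi>" "value_at u \<xi> \<in> carrier L" if "u \<in> ba_hom B two" for u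
    using that \<xi> value_at(1)[OF that \<xi>] by (simp_all add: to_dual_def)
  show "to_dual \<xi> \<in> topspace (fst (FObj (V_top_functor L) (ultrafilter_space B))) \<rightarrow>\<^sub>E carrier L"
    using \<xi> mem by (auto simp: V_top_functor_def to_dual_def)
  show "to_dual \<xi> u \<in> snd (FObj (V_top_functor L) (ultrafilter_space B)) u"
    if "u \<in> topspace (fst (FObj (V_top_functor L) (ultrafilter_space B)))" for u
    using that mem by (simp add: V_top_functor_def)
  \<comment> \<open>The preimage of \<open>U\<close> is the union of the basic sets of
    \<open>\<xi> l\<close> for \<open>l\<close> in \<open>U\<close>.\<close>
  have "openin (ultrafilter_space B) {u \<in> ba_hom B two. value_at u \<xi> \<in> U}" if U: "U \<subseteq> carrier L" for U
  proof -
    have "value_at u \<xi> \<in> U \<longleftrightarrow> (\<exists>l\<in>U. u (\<xi> l))" if "u \<in> ba_hom B two" for u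
      using value_at(2)[OF that \<xi> subsetD[OF U]] by metis
    then have "{u \<in> ba_hom B two. value_at u \<xi> \<in> U} = (\<Union>l\<in>U. basic (\<xi> l))"
      by (auto simp: basic_iff)
    moreover have "openin (ultrafilter_space B) (\<Union>l\<in>U. basic (\<xi> l))"
      using boolean_power_mem[OF \<xi>] U by (intro openin_Union) (auto intro!: openin_basic)
    ultimately show ?thesis
      by simp
  qed
  then show "continuous_map (fst (FObj (V_top_functor L) (ultrafilter_space B)))
      (discrete_topology (carrier L)) (to_dual \<xi>)"
    using mem by (simp add: continuous_map_def V_top_functor_def cong: conj_cong)
qed

lemma to_dual_iso: "to_dual \<in> alg_iso sig (boolean_power sig L B) dual_alg"
proof -
  have dual_top: "topspace (fst (FObj (V_top_functor L) (ultrafilter_space B))) = ba_hom B two"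
    "fst (FObj (V_top_functor L) (ultrafilter_space B)) = ultrafilter_space B"
    by (simp_all add: V_top_functor_def)
  have hom: "to_dual \<in> alg_hom sig (boolean_power sig L B) dual_alg"
  proof (rule alg_homI)
    show "to_dual \<in> carrier (boolean_power sig L B) \<rightarrow>\<^sub>E carrier dual_alg"
      using to_dual_mem by (auto simp: to_dual_def)
    fix f \<xi>s assume \<xi>s: "\<xi>s \<in> tuples (arity sig f) (carrier (boolean_power sig L B))"
    have "map (value_at u) \<xi>s = map (\<lambda>g. g u) (map to_dual \<xi>s)" if "u \<in> ba_hom B two" for u
      using \<xi>s that by (auto simp: tuples_def to_dual_def)
    then show "to_dual (oper (boolean_power sig L B) f \<xi>s) = oper dual_alg f (map to_dual \<xi>s)"
      unfolding \<Pi>_oper dual_top using is_algebraD[OF is_algebra_boolean_power \<xi>s] value_at_oper[OF _ \<xi>s]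
      by (simp add: to_dual_def[THEN fun_cong] del: map_map map_eq_conv cong: restrict_cong)
  qed
  have "inj_on to_dual (carrier (boolean_power sig L B))"
  proof (rule inj_onI)
    fix \<xi> \<zeta> assume *: "\<xi> \<in> carrier (boolean_power sig L B)" "\<zeta> \<in> carrier (boolean_power sig L B)"
      "to_dual \<xi> = to_dual \<zeta>"
    show "\<xi> = \<zeta>"
    proof (rule boolean_power_eqI[OF *(1,2)])
      fix u assume "u \<in> ba_hom B two"
      then show "value_at u \<xi> = value_at u \<zeta>"
        using *(1,2) fun_cong[OF *(3), of u] by (simp add: to_dual_def)
    qed
  qed
  moreover have "g \<in> to_dual ` carrier (boolean_power sig L B)" if g: "g \<in> carrier dual_alg" for g
  proof -
    note g' = \<Pi>_carrierD(1,2)[OF g, unfolded dual_top topspace_ultrafilter_space]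
    \<comment> \<open>The fibres of a continuous \<open>g\<close> are clopen, hence represented by
      elements of \<open>B\<close>. As the fibres partition the space, these elements form the
      preimage of \<open>g\<close> in \<open>L[B]\<close>.\<close>
    have "\<exists>b\<in>carrier B. {u \<in> ba_hom B two. g u = l} = basic b" if l: "l \<in> carrier L" for l
    proof (rule clopen_eq_basic)
      show "openin (ultrafilter_space B) {u \<in> ba_hom B two. g u = l}"
        using openin_continuous_map_preimage[OF g'(2), of "{l}"] l by simp
      show "closedin (ultrafilter_space B) {u \<in> ba_hom B two. g u = l}"
        using closedin_continuous_map_preimage[OF g'(2), of "{l}"] l by simp
    qed
    then obtain c where c: "\<And>l. l \<in> carrier L \<Longrightarrow>
        c l \<in> carrier B \<and> {u \<in> ba_hom B two. g u = l} = basic (c l)"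
      by metis
    define \<xi> where "\<xi> = (\<lambda>l\<in>carrier L. c l)"
    have iff: "u (\<xi> l) \<longleftrightarrow> g u = l" if "u \<in> ba_hom B two" "l \<in> carrier L" for u l
      using c[OF that(2)] that by (auto simp: \<xi>_def basic_def)
    have fs: "\<xi> \<in> carrier L \<rightarrow>\<^sub>E carrier B"
      using c by (auto simp: \<xi>_def)
    have \<xi>: "\<xi> \<in> carrier (boolean_power sig L B)"
      unfolding boolean_power_carrier_iff[OF fs]
    proof
      fix u assume u: "u \<in> ba_hom B two"
      show "\<exists>!l. l \<in> carrier L \<and> u (\<xi> l)"
        using PiE_mem[OF g'(1) u] iff[OF u] by auto
    qed
    have "to_dual \<xi> = g"
    proof
      fix u show "to_dual \<xi> u = g u"
      proof (cases "u \<in> ba_hom B two")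
        case True
        then show ?thesis
          using iff[OF True value_at(1)[OF True \<xi>]] value_at(2)[OF True \<xi> value_at(1)[OF True \<xi>]] \<xi>
          by (simp add: to_dual_def)
      next
        case False
        then show ?thesis
          using PiE_arb[OF g'(1) False] \<xi> by (simp add: to_dual_def)
      qed
    qed
    then show ?thesis
      using \<xi> by blast
  qed
  ultimately have "bij_betw to_dual (carrier (boolean_power sig L B)) (carrier dual_alg)"
    using to_dual_mem unfolding bij_betw_def by blast
  then show ?thesis
    using hom by (simp add: alg_iso_def)
qed

end

section \<open>The Boolean power functor and its natural isomorphism with the dual\<close>

text \<open>The two claims are proved together because they depend on each other:
  \<open>L[B]\<close> belongs to the variety since it is isomorphic to the value of
  \<open>?D\<close> at \<open>B\<close>, and the natural isomorphism has functoriality among its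
  conjuncts.\<close>

lemma is_functor_boolean_power:
  fixes sig :: "'f lattice_signature" and L :: "('f, 'l) algebra"
  assumes L: "is_algebra sig L" and fin: "finite (carrier L)"
  shows "is_functor (BA_cat :: ('b bool_alg, _) category) (variety_cat sig L)
      (boolean_power_functor sig L)"
    and "naturally_isomorphic sig L BA_cat
      (boolean_power_functor sig L :: ('b bool_alg, _, _, _) functor_data)
      (\<Pi>_functor L \<circ>\<^sub>F V_top_functor L \<circ>\<^sub>F \<Sigma>_functor)"
proof -
  let ?P = "boolean_power_functor sig L :: ('b bool_alg, _, _, _) functor_data"
  let ?D = "\<Pi>_functor L \<circ>\<^sub>F V_top_functor L \<circ>\<^sub>F (\<Sigma>_functor :: ('b bool_alg, _, _, _) functor_data)"
  have loc: "finite_boolean_power B sig L" if "is_bool_alg B" for B :: "'b bool_alg"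
    using that L fin by unfold_locales
  have Obj: "Obj BA_cat = {B. is_bool_alg B}" and Hom: "Hom BA_cat = ba_hom"
    by (simp_all add: BA_cat_def)
  \<comment> \<open>Passing to opposites leaves \<open>V_top_functor\<close> unchanged, because its
    action on arrows ignores the object arguments.\<close>
  have "is_functor (op_category Stone_cat) (op_category (Stone_L_cat sig L))
      (V_top_functor L :: (('b \<Rightarrow> bool) topology, _, _, _) functor_data)"
    using is_functor_op[OF is_functor_V_top[OF L]] by (simp add: V_top_functor_def)
  then have D: "is_functor BA_cat (variety_cat sig L) ?D"
    by (rule is_functor_comp[OF is_functor_comp[OF is_functor_\<Sigma>] is_functor_\<Pi>[OF L]])
  \<comment> \<open>At a point \<open>v\<close> of \<open>C\<close>, the image of
    \<open>\<xi>\<close> has the value that \<open>\<xi>\<close> has at the point of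
    \<open>B\<close> obtained by precomposing \<open>v\<close> with \<open>\<phi>\<close>. This
    formula yields both the homomorphism property and naturality.\<close>
  have map_mem: "compose (carrier L) \<phi> \<xi> \<in> carrier (boolean_power sig L C)"
    and map_value: "v \<in> ba_hom C two \<Longrightarrow> finite_boolean_power.value_at L v (compose (carrier L) \<phi> \<xi>) =
      finite_boolean_power.value_at L (compose (carrier B) v \<phi>) \<xi>"
    if "is_bool_alg B" "is_bool_alg C" and \<phi>: "\<phi> \<in> ba_hom B C"
      and \<xi>: "\<xi> \<in> carrier (boolean_power sig L B)" for B C :: "'b bool_alg" and \<phi> \<xi> v
  proof -
    interpret B: finite_boolean_power B sig L by (rule loc) fact
    interpret C: finite_boolean_power C sig L by (rule loc) fact
    have pull: "compose (carrier B) u \<phi> \<in> ba_hom B two" if "u \<in> ba_hom C two" for u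
      using B.is_bool_alg \<phi> that by (rule ba_hom_compose)
    have iff: "u (compose (carrier L) \<phi> \<xi> l) \<longleftrightarrow> B.value_at (compose (carrier B) u \<phi>) \<xi> = l"
      if "u \<in> ba_hom C two" "l \<in> carrier L" for u l
      using B.value_at(2)[OF pull[OF that(1)] \<xi> that(2)] that B.boolean_power_mem[OF \<xi>]
      by (simp add: compose_def)
    have fs: "compose (carrier L) \<phi> \<xi> \<in> carrier L \<rightarrow>\<^sub>E carrier C"
      using ba_hom_closed[OF \<phi>] B.boolean_power_mem[OF \<xi>] by (simp add: compose_def)
    show mem: "compose (carrier L) \<phi> \<xi> \<in> carrier (boolean_power sig L C)"
      unfolding C.boolean_power_carrier_iff[OF fs]
    proof
      fix u assume u: "u \<in> ba_hom C two"
      show "\<exists>!l. l \<in> carrier L \<and> u (compose (carrier L) \<phi> \<xi> l)"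
        using B.value_at(1)[OF pull[OF u] \<xi>] iff[OF u] by auto
    qed
    show "C.value_at v (compose (carrier L) \<phi> \<xi>) = B.value_at (compose (carrier B) v \<phi>) \<xi>"
      if v: "v \<in> ba_hom C two"
    proof -
      have l: "B.value_at (compose (carrier B) v \<phi>) \<xi> \<in> carrier L"
        using pull[OF v] \<xi> by (rule B.value_at(1))
      show ?thesis
        using C.value_at(2)[OF v mem l] iff[OF v l] by simp
    qed
  qed
  have hom: "FMap ?P B C \<phi> \<in> alg_hom sig (boolean_power sig L B) (boolean_power sig L C)"
    if B: "is_bool_alg B" and C: "is_bool_alg C" and \<phi>: "\<phi> \<in> ba_hom B C" for B C \<phi>
  proof -
    interpret B: finite_boolean_power B sig L by (rule loc) fact
    interpret C: finite_boolean_power C sig L by (rule loc) fact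
    show ?thesis
    proof (rule alg_homI)
      show fs: "FMap ?P B C \<phi> \<in> carrier (boolean_power sig L B) \<rightarrow>\<^sub>E carrier (boolean_power sig L C)"
        using map_mem[OF B C \<phi>] by (simp add: boolean_power_functor_def)
      fix f \<xi>s assume \<xi>s: "\<xi>s \<in> tuples (arity sig f) (carrier (boolean_power sig L B))"
      have \<phi>\<xi>s: "map (FMap ?P B C \<phi>) \<xi>s \<in> tuples (arity sig f) (carrier (boolean_power sig L C))"
        using \<xi>s PiE_mem[OF fs] by (rule map_tuples)
      have mem: "oper (boolean_power sig L B) f \<xi>s \<in> carrier (boolean_power sig L B)"
        using B.is_algebra_boolean_power \<xi>s by (rule is_algebraD)
      show "FMap ?P B C \<phi> (oper (boolean_power sig L B) f \<xi>s) =
          oper (boolean_power sig L C) f (map (FMap ?P B C \<phi>) \<xi>s)"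
      proof (rule C.boolean_power_eqI)
        fix v assume v: "v \<in> ba_hom C two"
        have pull: "compose (carrier B) v \<phi> \<in> ba_hom B two"
          using B \<phi> v by (rule ba_hom_compose)
        have eq: "map (C.value_at v) (map (FMap ?P B C \<phi>) \<xi>s) =
            map (B.value_at (compose (carrier B) v \<phi>)) \<xi>s"
          using \<xi>s map_value[OF B C \<phi> _ v] by (auto simp: boolean_power_functor_def tuples_def)
        show "C.value_at v (FMap ?P B C \<phi> (oper (boolean_power sig L B) f \<xi>s)) =
            C.value_at v (oper (boolean_power sig L C) f (map (FMap ?P B C \<phi>) \<xi>s))"
          unfolding C.value_at_oper[OF v \<phi>\<xi>s] eq
          using B.value_at_oper[OF pull \<xi>s] map_value[OF B C \<phi> mem v] mem
          by (simp add: boolean_power_functor_def)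
      qed (rule PiE_mem[OF fs mem], rule is_algebraD[OF C.is_algebra_boolean_power \<phi>\<xi>s])
    qed
  qed
  show P: "is_functor BA_cat (variety_cat sig L) ?P"
  proof (rule is_functorI[OF is_category_BA is_category_variety], unfold Obj Hom mem_Collect_eq)
    fix B :: "'b bool_alg" assume B: "is_bool_alg B"
    interpret B: finite_boolean_power B sig L by (rule loc) fact
    have "B.dual_alg \<in> HSP sig L"
      using D B unfolding is_functor_def
      by (simp add: Obj comp_functor_def \<Pi>_functor_def \<Sigma>_functor_def variety_cat_def)
    then show "FObj ?P B \<in> Obj (variety_cat sig L)"
      using HSP_of_iso[OF L _ B.is_algebra_boolean_power B.to_dual_iso]
      by (simp add: variety_cat_def boolean_power_functor_def)
    have "compose (carrier L) (\<lambda>x\<in>carrier B. x) \<xi> = \<xi>" if "\<xi> \<in> carrier (boolean_power sig L B)" for \<xi>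
      using B.boolean_power_funcset[OF that] by (auto simp: compose_def fun_eq_iff PiE_def extensional_def)
    then show "FMap ?P B B (Ident BA_cat B) = Ident (variety_cat sig L) (FObj ?P B)"
      by (simp add: variety_cat_def BA_cat_def boolean_power_functor_def cong: restrict_cong)
  next
    fix B C :: "'b bool_alg" and \<phi> assume "is_bool_alg B" "is_bool_alg C" "\<phi> \<in> ba_hom B C"
    then show "FMap ?P B C \<phi> \<in> Hom (variety_cat sig L) (FObj ?P B) (FObj ?P C)"
      using hom by (simp add: variety_cat_def boolean_power_functor_def)
  next
    fix B C D :: "'b bool_alg" and \<phi> \<psi>
    assume B: "is_bool_alg B" and C: "is_bool_alg C" and "is_bool_alg D"
      and \<phi>: "\<phi> \<in> ba_hom B C" and \<psi>: "\<psi> \<in> ba_hom C D"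
    interpret B: finite_boolean_power B sig L by (rule loc) fact
    have "compose (carrier L) (compose (carrier B) \<psi> \<phi>) \<xi> =
        compose (carrier L) \<psi> (compose (carrier L) \<phi> \<xi>)" if "\<xi> \<in> carrier (boolean_power sig L B)" for \<xi>
      using B.boolean_power_mem[OF that] by (auto simp: compose_def fun_eq_iff)
    then show "FMap ?P B D (Comp BA_cat B C D \<psi> \<phi>) =
        Comp (variety_cat sig L) (FObj ?P B) (FObj ?P C) (FObj ?P D) (FMap ?P C D \<psi>) (FMap ?P B C \<phi>)"
      using map_mem[OF B C \<phi>]
      by (simp add: variety_cat_def BA_cat_def boolean_power_functor_def
          compose_def[of "carrier (boolean_power sig L B)"] cong: restrict_cong)
  qed
  have nat: "compose (carrier (boolean_power sig L B)) (FMap ?D B C \<phi>) (finite_boolean_power.to_dual B sig L) =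
      compose (carrier (boolean_power sig L B)) (finite_boolean_power.to_dual C sig L) (FMap ?P B C \<phi>)"
    if B: "is_bool_alg B" and C: "is_bool_alg C" and \<phi>: "\<phi> \<in> ba_hom B C" for B C \<phi>
  proof -
    interpret B: finite_boolean_power B sig L by (rule loc) fact
    interpret C: finite_boolean_power C sig L by (rule loc) fact
    have "FMap ?D B C \<phi> (B.to_dual \<xi>) = C.to_dual (FMap ?P B C \<phi> \<xi>)"
      if \<xi>: "\<xi> \<in> carrier (boolean_power sig L B)" for \<xi>
    proof -
      have "B.to_dual \<xi> (compose (carrier B) v \<phi>) = C.value_at v (compose (carrier L) \<phi> \<xi>)"
        if v: "v \<in> ba_hom C two" for v
        using map_value[OF B C \<phi> \<xi> v] ba_hom_compose[OF B \<phi> v] \<xi> by (simp add: B.to_dual_def)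
      then show ?thesis
        using map_mem[OF B C \<phi> \<xi>] B.to_dual_mem[OF \<xi>] \<xi>
        by (simp add: comp_functor_def \<Pi>_functor_def V_top_functor_def \<Sigma>_functor_def
            boolean_power_functor_def C.to_dual_def compose_def[of "ba_hom C two"] cong: restrict_cong)
    qed
    then show ?thesis
      by (simp add: compose_def cong: restrict_cong)
  qed
  show "naturally_isomorphic sig L BA_cat ?P ?D"
    unfolding naturally_isomorphic_def
  proof (intro conjI P D exI[of _ "\<lambda>B. finite_boolean_power.to_dual B sig L"] ballI,
      unfold Obj Hom mem_Collect_eq)
    fix B :: "'b bool_alg" assume "is_bool_alg B"
    then interpret B: finite_boolean_power B sig L by (rule loc)
    show "B.to_dual \<in> alg_iso sig (FObj ?P B) (FObj ?D B)"
      using B.to_dual_iso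
      by (simp add: comp_functor_def \<Pi>_functor_def \<Sigma>_functor_def boolean_power_functor_def)
  qed (use nat in \<open>simp add: boolean_power_functor_def\<close>)
qed


section \<open>Identities of the generating algebra\<close>

primrec tsubst :: "(nat \<Rightarrow> 'f trm) \<Rightarrow> 'f trm \<Rightarrow> 'f trm" where
  "tsubst \<sigma> (Var i) = \<sigma> i"
| "tsubst \<sigma> (App f ts) = App f (map (tsubst \<sigma>) ts)"

lemma eval_tsubst: "eval_trm A v (tsubst \<sigma> t) = eval_trm A (\<lambda>i. eval_trm A v (\<sigma> i)) t"
proof (induction t)
  case (App f ts)
  then have "map (eval_trm A v \<circ> tsubst \<sigma>) ts = map (eval_trm A (\<lambda>i. eval_trm A v (\<sigma> i))) ts"
    by simp
  then show ?case
    by (simp del: map_eq_conv)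
qed simp

lemma wf_tsubst: "wf_trm sig n t \<Longrightarrow> (\<And>i. i < n \<Longrightarrow> wf_trm sig m (\<sigma> i)) \<Longrightarrow> wf_trm sig m (tsubst \<sigma> t)"
  by (induction t) auto

lemma eval_cong:
  "wf_trm sig n t \<Longrightarrow> (\<And>i. i < n \<Longrightarrow> v i = w i) \<Longrightarrow> eval_trm A v t = eval_trm A w t"
proof (induction t)
  case (App f ts)
  then have "map (eval_trm A v) ts = map (eval_trm A w) ts"
    by simp
  then show ?case
    by (simp del: map_eq_conv)
qed simp

lemma eval_closed:
  assumes A: "is_algebra sig A"
  shows "wf_trm sig n t \<Longrightarrow> (\<And>i. i < n \<Longrightarrow> v i \<in> carrier A) \<Longrightarrow> eval_trm A v t \<in> carrier A"
proof (induction t)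
  case (App f ts)
  then have "map (eval_trm A v) ts \<in> tuples (arity sig f) (carrier A)"
    by (auto simp: tuples_def)
  then show ?case
    using is_algebraD[OF A] by simp
qed simp

lemma eval_hom:
  assumes A: "is_algebra sig A" and h: "h \<in> alg_hom sig A B"
  shows "wf_trm sig n t \<Longrightarrow> (\<And>i. i < n \<Longrightarrow> v i \<in> carrier A) \<Longrightarrow>
    h (eval_trm A v t) = eval_trm B (\<lambda>i. h (v i)) t"
proof (induction t)
  case (App f ts)
  then have "map (eval_trm A v) ts \<in> tuples (arity sig f) (carrier A)"
    using eval_closed[OF A, of n _ v] by (auto simp: tuples_def)
  then have "h (oper A f (map (eval_trm A v) ts)) = oper B f (map h (map (eval_trm A v) ts))"
    by (rule alg_hom_oper[OF h])
  moreover have "map h (map (eval_trm A v) ts) = map (eval_trm B (\<lambda>i. h (v i))) ts"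
    using App by simp
  ultimately show ?case
    by (simp del: map_map map_eq_conv)
qed simp

text \<open>Lift the valuation along the surjection to a subalgebra of a power, compare the two
  terms coordinate by coordinate, where the identity of \<open>L\<close> applies, and push the
  equality down to \<open>A\<close>.\<close>

lemma HSP_identity:
  fixes A :: "('f, 'a) algebra" and L :: "('f, 'l) algebra"
  assumes A: "A \<in> HSP sig L" and s: "wf_trm sig n s" and t: "wf_trm sig n t"
    and L: "\<And>v. (\<And>i. i < n \<Longrightarrow> v i \<in> carrier L) \<Longrightarrow> eval_trm L v s = eval_trm L v t"
    and v: "\<And>i. i < n \<Longrightarrow> v i \<in> carrier A"
  shows "eval_trm A v s = eval_trm A v t"
proof -
  obtain I :: "('a \<Rightarrow> 'l) set" and S h
    where S: "S \<in> subalgebras sig (power_algebra L I)"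
      and h: "h \<in> alg_hom sig (power_algebra L I\<lparr>carrier := S\<rparr>) A" and surj: "h ` S = carrier A"
    using A unfolding HSP_def by blast
  let ?Q = "power_algebra L I\<lparr>carrier := S\<rparr>"
  have Q: "is_algebra sig ?Q"
    using S by (auto simp: is_algebra_def subalgebras_def)
  have sub: "S \<subseteq> I \<rightarrow>\<^sub>E carrier L"
    using S by (auto simp: subalgebras_def power_algebra_def)
  have "\<forall>i. \<exists>x. i < n \<longrightarrow> x \<in> S \<and> h x = v i"
    using v surj by (metis imageE)
  then obtain x where x: "\<And>i. i < n \<Longrightarrow> x i \<in> S \<and> h (x i) = v i"
    by metis
  have xQ: "x i \<in> carrier ?Q" if "i < n" for i
    using x[OF that] by simp
  \<comment> \<open>Projection to a coordinate is a homomorphism to \<open>L\<close>, so each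
    coordinate of a term value is a term value in \<open>L\<close>.\<close>
  have pr: "restrict (\<lambda>y. y j) S \<in> alg_hom sig ?Q L" if "j \<in> I" for j
  proof (rule alg_homI)
    show "restrict (\<lambda>y. y j) S \<in> carrier ?Q \<rightarrow>\<^sub>E carrier L"
      using sub that by auto
    fix f ys assume "ys \<in> tuples (arity sig f) (carrier ?Q)"
    then have ys: "ys \<in> tuples (arity sig f) (carrier ?Q)" "set ys \<subseteq> S"
      by (auto simp: tuples_def)
    have "map (restrict (\<lambda>y. y j) S) ys = map (\<lambda>y. y j) ys"
      using ys by auto
    then show "restrict (\<lambda>y. y j) S (oper ?Q f ys) = oper L f (map (restrict (\<lambda>y. y j) S) ys)"
      using is_algebraD[OF Q ys(1)] that by (simp add: power_algebra_def del: map_eq_conv)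
  qed
  have closed: "eval_trm ?Q x r \<in> S" if "wf_trm sig n r" for r
    using eval_closed[OF Q that xQ] by simp
  have coord: "eval_trm ?Q x r j = eval_trm L (\<lambda>i. restrict (\<lambda>y. y j) S (x i)) r"
    if "wf_trm sig n r" "j \<in> I" for r j
    using eval_hom[OF Q pr[OF that(2)] that(1), of x, OF xQ] closed[OF that(1)] by simp
  have "eval_trm ?Q x s = eval_trm ?Q x t"
  proof (rule PiE_ext)
    show "eval_trm ?Q x s \<in> I \<rightarrow>\<^sub>E carrier L" "eval_trm ?Q x t \<in> I \<rightarrow>\<^sub>E carrier L"
      using closed s t sub by blast+
    show "eval_trm ?Q x s j = eval_trm ?Q x t j" if j: "j \<in> I" for j
      unfolding coord[OF s j] coord[OF t j]
      by (rule L) (use alg_hom_closed[OF pr[OF j] xQ] in simp)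
  qed
  moreover have "eval_trm A v r = h (eval_trm ?Q x r)" if r: "wf_trm sig n r" for r
  proof -
    have "h (eval_trm ?Q x r) = eval_trm A (\<lambda>i. h (x i)) r"
      using xQ by (rule eval_hom[OF Q h r])
    also have "\<dots> = eval_trm A v r"
      by (rule eval_cong[OF r]) (simp add: x)
    finally show ?thesis ..
  qed
  ultimately show ?thesis
    using s t by simp
qed

section \<open>The Boolean skeleton\<close>

definition meet_trm where "meet_trm sig s t = App (meet_sym sig) [s, t]"
definition join_trm where "join_trm sig s t = App (join_sym sig) [s, t]"
definition zero_trm where "zero_trm sig = App (zero_sym sig) []"
definition one_trm where "one_trm sig = App (one_sym sig) []"

lemma eval_lattice_trm [simp]:
  "eval_trm A v (meet_trm sig s t) = alg_meet sig A (eval_trm A v s) (eval_trm A v t)"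
  "eval_trm A v (join_trm sig s t) = alg_join sig A (eval_trm A v s) (eval_trm A v t)"
  "eval_trm A v (zero_trm sig) = alg_zero sig A"
  "eval_trm A v (one_trm sig) = alg_one sig A"
  by (simp_all add: meet_trm_def join_trm_def zero_trm_def one_trm_def
      alg_meet_def alg_join_def alg_zero_def alg_one_def)

lemma alg_hom_lattice:
  assumes "is_lattice_signature sig" "h \<in> alg_hom sig A B"
  shows "x \<in> carrier A \<Longrightarrow> y \<in> carrier A \<Longrightarrow> h (alg_meet sig A x y) = alg_meet sig B (h x) (h y)"
    "x \<in> carrier A \<Longrightarrow> y \<in> carrier A \<Longrightarrow> h (alg_join sig A x y) = alg_join sig B (h x) (h y)"
    "h (alg_zero sig A) = alg_zero sig B" "h (alg_one sig A) = alg_one sig B"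
  using assms(1) alg_hom_oper[OF assms(2), of "[x, y]" "meet_sym sig"]
    alg_hom_oper[OF assms(2), of "[x, y]" "join_sym sig"]
    alg_hom_oper[OF assms(2), of "[]" "zero_sym sig"]
    alg_hom_oper[OF assms(2), of "[]" "one_sym sig"]
  by (simp_all add: is_lattice_signature_def tuples_def
      alg_meet_def alg_join_def alg_zero_def alg_one_def)

locale semi_primal_lattice =
  fixes sig :: "'f lattice_signature" and L :: "('f, 'l) algebra"
  assumes sig: "is_lattice_signature sig"
    and L: "is_algebra sig L"
    and fin: "finite (carrier L)"
    and lattice: "has_bounded_lattice_reduct sig L"
    and zero_neq_one: "alg_zero sig L \<noteq> alg_one sig L"
    and semi_primal: "semi_primal sig L"
begin

abbreviation "zeroL \<equiv> alg_zero sig L"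
abbreviation "oneL \<equiv> alg_one sig L"

lemma wf_lattice_trm [simp]:
  "wf_trm sig n (meet_trm sig s t) \<longleftrightarrow> wf_trm sig n s \<and> wf_trm sig n t"
  "wf_trm sig n (join_trm sig s t) \<longleftrightarrow> wf_trm sig n s \<and> wf_trm sig n t"
  "wf_trm sig n (zero_trm sig)" "wf_trm sig n (one_trm sig)"
  using sig by (simp_all add: meet_trm_def join_trm_def zero_trm_def one_trm_def is_lattice_signature_def)

lemma lattice_closed [simp]:
  assumes "is_algebra sig A"
  shows "x \<in> carrier A \<Longrightarrow> y \<in> carrier A \<Longrightarrow> alg_meet sig A x y \<in> carrier A"
    "x \<in> carrier A \<Longrightarrow> y \<in> carrier A \<Longrightarrow> alg_join sig A x y \<in> carrier A"
    "alg_zero sig A \<in> carrier A" "alg_one sig A \<in> carrier A"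
  using sig is_algebraD[OF assms, of "[x, y]" "meet_sym sig"]
    is_algebraD[OF assms, of "[x, y]" "join_sym sig"]
    is_algebraD[OF assms, of "[]" "zero_sym sig"] is_algebraD[OF assms, of "[]" "one_sym sig"]
  by (simp_all add: is_lattice_signature_def tuples_def
      alg_meet_def alg_join_def alg_zero_def alg_one_def)

text \<open>The entries beyond the unit laws follow by commutativity and absorption. As rewrite
  rules they let the Boolean laws on the two bounds be checked by cases.\<close>

lemma zero_one_table [simp]:
  "alg_meet sig L zeroL zeroL = zeroL" "alg_meet sig L zeroL oneL = zeroL"
  "alg_meet sig L oneL zeroL = zeroL" "alg_meet sig L oneL oneL = oneL"
  "alg_join sig L zeroL zeroL = zeroL" "alg_join sig L zeroL oneL = oneL"
  "alg_join sig L oneL zeroL = oneL" "alg_join sig L oneL oneL = oneL"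
proof -
  have c: "zeroL \<in> carrier L" "oneL \<in> carrier L"
    using L by simp_all
  have m1: "\<And>x. x \<in> carrier L \<Longrightarrow> alg_meet sig L x oneL = x"
    and j0: "\<And>x. x \<in> carrier L \<Longrightarrow> alg_join sig L x zeroL = x"
    and mc: "\<And>x y. x \<in> carrier L \<Longrightarrow> y \<in> carrier L \<Longrightarrow> alg_meet sig L x y = alg_meet sig L y x"
    and jc: "\<And>x y. x \<in> carrier L \<Longrightarrow> y \<in> carrier L \<Longrightarrow> alg_join sig L x y = alg_join sig L y x"
    and mj: "\<And>x y. x \<in> carrier L \<Longrightarrow> y \<in> carrier L \<Longrightarrow> alg_meet sig L x (alg_join sig L x y) = x"
    and jm: "\<And>x y. x \<in> carrier L \<Longrightarrow> y \<in> carrier L \<Longrightarrow> alg_join sig L x (alg_meet sig L x y) = x"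
    using lattice unfolding has_bounded_lattice_reduct_def by meson+
  show "alg_meet sig L zeroL oneL = zeroL" "alg_meet sig L oneL oneL = oneL"
    "alg_join sig L zeroL zeroL = zeroL" "alg_join sig L oneL zeroL = oneL"
    using c m1 j0 by blast+
  then show "alg_meet sig L zeroL zeroL = zeroL" "alg_meet sig L oneL zeroL = zeroL"
    "alg_join sig L zeroL oneL = oneL" "alg_join sig L oneL oneL = oneL"
    using mj[OF c(1) c(1)] mc[OF c(2) c(1)] jc[OF c(1) c(2)] jm[OF c(2) c(2)] by simp_all
qed

text \<open>Every subalgebra contains both constants, so a function with values among them preserves
  subalgebras and semi-primality supplies a unary term. This shows that the choice in
  \<open>T_trm\<close> is met.\<close>

lemma T_trm_defines:
  "defines_function sig L 1 (T_trm sig L l) (\<lambda>xs. if xs ! 0 = l then oneL else zeroL)"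
proof -
  have "zeroL \<in> S" "oneL \<in> S" if "S \<in> subalgebras sig L" for S
  proof -
    have "[] \<in> tuples (arity sig (zero_sym sig)) S" "[] \<in> tuples (arity sig (one_sym sig)) S"
      using sig by (simp_all add: tuples_def is_lattice_signature_def)
    then show "zeroL \<in> S" "oneL \<in> S"
      using that unfolding subalgebras_def alg_zero_def alg_one_def by blast+
  qed
  then have "\<exists>t. defines_function sig L 1 t (\<lambda>xs. if xs ! 0 = l then oneL else zeroL)"
    using semi_primal unfolding semi_primal_def generated_subalgebra_def by auto
  then show ?thesis
    unfolding T_trm_def by (rule someI_ex)
qed

lemma wf_T_trm: "wf_trm sig 1 (T_trm sig L l)"
  using T_trm_defines by (simp add: defines_function_def)

lemma T_op_L: "x \<in> carrier L \<Longrightarrow> T_op sig L l L x = (if x = l then oneL else zeroL)"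
  using T_trm_defines[of l] by (auto simp: defines_function_def T_op_def tuples_def)

lemma T_op_L_simps [simp]:
  "T_op sig L oneL L zeroL = zeroL" "T_op sig L oneL L oneL = oneL"
  "T_op sig L zeroL L zeroL = oneL" "T_op sig L zeroL L oneL = zeroL"
  using zero_neq_one L by (auto simp: T_op_L)

text \<open>The term \<open>T_l(s)\<close>. A constant substitution suffices since the term for
  \<open>T_l\<close> contains at most the variable 0.\<close>

definition T_at :: "'l \<Rightarrow> 'f trm \<Rightarrow> 'f trm" where
  "T_at l s = tsubst (\<lambda>_. s) (T_trm sig L l)"

lemma eval_T_at [simp]: "eval_trm A v (T_at l s) = T_op sig L l A (eval_trm A v s)"
  unfolding T_at_def T_op_def eval_tsubst by (rule eval_cong[OF wf_T_trm]) simp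

lemma wf_T_at [simp]: "wf_trm sig n s \<Longrightarrow> wf_trm sig n (T_at l s)"
  unfolding T_at_def by (rule wf_tsubst[OF wf_T_trm])

lemma T_op_closed: "is_algebra sig A \<Longrightarrow> a \<in> carrier A \<Longrightarrow> T_op sig L l A a \<in> carrier A"
  unfolding T_op_def by (rule eval_closed[OF _ wf_T_trm]) simp_all

lemma T_op_hom:
  assumes A: "is_algebra sig A" and h: "h \<in> alg_hom sig A C" and a: "a \<in> carrier A"
  shows "h (T_op sig L l A a) = T_op sig L l C (h a)"
proof -
  have "h (eval_trm A (\<lambda>i. [a] ! i) (T_trm sig L l)) = eval_trm C (\<lambda>i. h ([a] ! i)) (T_trm sig L l)"
    using a by (intro eval_hom[OF A h wf_T_trm]) simp
  also have "\<dots> = eval_trm C (\<lambda>i. [h a] ! i) (T_trm sig L l)"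
    by (rule eval_cong[OF wf_T_trm]) simp
  finally show ?thesis
    by (simp add: T_op_def)
qed

lemma skeleton_simps [simp]:
  "bmeet (skeleton sig L A) = alg_meet sig A" "bjoin (skeleton sig L A) = alg_join sig A"
  "bcompl (skeleton sig L A) = T_op sig L zeroL A"
  "bzero (skeleton sig L A) = alg_zero sig A" "bone (skeleton sig L A) = alg_one sig A"
  "a \<in> carrier (skeleton sig L A) \<longleftrightarrow> a \<in> carrier A \<and> T_op sig L oneL A a = a"
  by (simp_all add: skeleton_def)

text \<open>In \<open>L\<close> the values of \<open>T_l\<close> are 0 and 1, both fixed by
  \<open>T_1\<close>; so \<open>T_1 (T_l x) = T_l x\<close> is an identity of the variety.\<close>

lemma T_op_in_skeleton:
  assumes A: "A \<in> HSP sig L" and a: "a \<in> carrier A"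
  shows "T_op sig L l A a \<in> carrier (skeleton sig L A)"
proof -
  have "eval_trm A (\<lambda>_. a) (T_at oneL (T_at l (Var 0))) = eval_trm A (\<lambda>_. a) (T_at l (Var 0))"
    by (rule HSP_identity[OF A, of 1]) (use a L in \<open>auto simp: T_op_L\<close>)
  then show ?thesis
    using T_op_closed[OF HSP_is_algebra[OF A] a] by simp
qed

text \<open>On skeleton elements \<open>T_1\<close> acts as the identity, so substituting \<open>T_1\<close> of each variable
  reduces identities on the skeleton to identities on the two-element set of bounds of \<open>L\<close>.\<close>

lemma skeleton_identity:
  assumes A: "A \<in> HSP sig L" and s: "wf_trm sig 3 s" and t: "wf_trm sig 3 t"
    and eq: "\<And>v. v 0 \<in> {zeroL, oneL} \<Longrightarrow> v 1 \<in> {zeroL, oneL} \<Longrightarrow> v 2 \<in> {zeroL, oneL} \<Longrightarrow>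
      eval_trm L v s = eval_trm L v t"
    and abc: "{a, b, c} \<subseteq> carrier (skeleton sig L A)"
  shows "eval_trm A (\<lambda>i. [a, b, c] ! i) s = eval_trm A (\<lambda>i. [a, b, c] ! i) t"
proof -
  let ?\<sigma> = "\<lambda>i. T_at oneL (Var i)"
  let ?v = "\<lambda>i. [a, b, c] ! i"
  have v: "?v i \<in> carrier A" "T_op sig L oneL A (?v i) = ?v i" if "i < 3" for i
    using abc that by (auto simp: less_Suc_eq numeral_3_eq_3)
  have restore: "eval_trm A ?v (tsubst ?\<sigma> r) = eval_trm A ?v r" if r: "wf_trm sig 3 r" for r
    unfolding eval_tsubst by (rule eval_cong[OF r]) (use v in simp)
  have "eval_trm A ?v (tsubst ?\<sigma> s) = eval_trm A ?v (tsubst ?\<sigma> t)"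
  proof (rule HSP_identity[OF A, of 3])
    show "wf_trm sig 3 (tsubst ?\<sigma> s)" "wf_trm sig 3 (tsubst ?\<sigma> t)"
      by (rule wf_tsubst[OF s] wf_tsubst[OF t]; simp)+
    fix v :: "nat \<Rightarrow> 'l" assume "\<And>i. i < 3 \<Longrightarrow> v i \<in> carrier L"
    \<comment> \<open>Whatever the valuation, \<open>T_1\<close> forces its values into the two
      bounds, which is where \<open>eq\<close> is assumed.\<close>
    then have "T_op sig L oneL L (v i) \<in> {zeroL, oneL}" if "i < 3" for i
      using that by (simp add: T_op_L)
    then show "eval_trm L v (tsubst ?\<sigma> s) = eval_trm L v (tsubst ?\<sigma> t)"
      unfolding eval_tsubst by (intro eq) simp_all
  qed (rule v(1))
  then show ?thesis
    by (simp only: restore[OF s] restore[OF t])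
qed

text \<open>All Boolean laws use at most three variables and hold on the bounds of \<open>L\<close>;
  distributivity, which may fail in \<open>L\<close> itself, thus holds on the skeleton. Closure
  under meet and join is the law that \<open>T_1\<close> fixes the result.\<close>

lemma skeleton_bool_alg:
  assumes A: "A \<in> HSP sig L"
  shows "is_bool_alg (skeleton sig L A)"
proof -
  let ?S = "carrier (skeleton sig L A)"
  note id = skeleton_identity[OF A]
  have alg: "is_algebra sig A"
    using A by (rule HSP_is_algebra)
  have S: "a \<in> carrier A" if "a \<in> ?S" for a
    using that by simp
  have closed0: "alg_zero sig A \<in> ?S" "alg_one sig A \<in> ?S"
  proof -
    \<comment> \<open>For the bounds these are identities in no variables, and the valuation is a
      dummy.\<close>
    have "eval_trm A (\<lambda>_. alg_zero sig A) (T_at oneL r) = eval_trm A (\<lambda>_. alg_zero sig A) r"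
      if "r \<in> {zero_trm sig, one_trm sig}" for r
      by (rule HSP_identity[OF A, of 0]) (use that in auto)
    from this[of "zero_trm sig"] this[of "one_trm sig"]
    show "alg_zero sig A \<in> ?S" "alg_one sig A \<in> ?S"
      using alg by simp_all
  qed
  have 2: "alg_meet sig A a b \<in> ?S \<and> alg_join sig A a b \<in> ?S \<and>
      alg_meet sig A a b = alg_meet sig A b a \<and> alg_join sig A a b = alg_join sig A b a"
    if "a \<in> ?S" "b \<in> ?S" for a b
  proof -
    \<comment> \<open>Laws in fewer variables are fitted to three arguments by repeating
      one.\<close>
    have abc: "{a, b, b} \<subseteq> ?S"
      using that by blast
    have "eval_trm A (\<lambda>i. [a, b, b] ! i) (T_at oneL (meet_trm sig (Var 0) (Var 1))) =
        eval_trm A (\<lambda>i. [a, b, b] ! i) (meet_trm sig (Var 0) (Var 1))"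
      by (rule id[OF _ _ _ abc]) auto
    moreover have "eval_trm A (\<lambda>i. [a, b, b] ! i) (T_at oneL (join_trm sig (Var 0) (Var 1))) =
        eval_trm A (\<lambda>i. [a, b, b] ! i) (join_trm sig (Var 0) (Var 1))"
      by (rule id[OF _ _ _ abc]) auto
    moreover have "eval_trm A (\<lambda>i. [a, b, b] ! i) (meet_trm sig (Var 0) (Var 1)) =
        eval_trm A (\<lambda>i. [a, b, b] ! i) (meet_trm sig (Var 1) (Var 0))"
      by (rule id[OF _ _ _ abc]) auto
    moreover have "eval_trm A (\<lambda>i. [a, b, b] ! i) (join_trm sig (Var 0) (Var 1)) =
        eval_trm A (\<lambda>i. [a, b, b] ! i) (join_trm sig (Var 1) (Var 0))"
      by (rule id[OF _ _ _ abc]) auto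
    ultimately show ?thesis
      using alg S[OF that(1)] S[OF that(2)] by simp
  qed
  have 1: "T_op sig L zeroL A a \<in> ?S \<and> alg_meet sig A a (alg_one sig A) = a \<and>
      alg_join sig A a (alg_zero sig A) = a \<and>
      alg_meet sig A a (T_op sig L zeroL A a) = alg_zero sig A \<and>
      alg_join sig A a (T_op sig L zeroL A a) = alg_one sig A"
    if "a \<in> ?S" for a
  proof -
    have abc: "{a, a, a} \<subseteq> ?S"
      using that by blast
    have "eval_trm A (\<lambda>i. [a, a, a] ! i) (meet_trm sig (Var 0) (one_trm sig)) =
        eval_trm A (\<lambda>i. [a, a, a] ! i) (Var 0)"
      by (rule id[OF _ _ _ abc]) auto
    moreover have "eval_trm A (\<lambda>i. [a, a, a] ! i) (join_trm sig (Var 0) (zero_trm sig)) =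
        eval_trm A (\<lambda>i. [a, a, a] ! i) (Var 0)"
      by (rule id[OF _ _ _ abc]) auto
    moreover have "eval_trm A (\<lambda>i. [a, a, a] ! i) (meet_trm sig (Var 0) (T_at zeroL (Var 0))) =
        eval_trm A (\<lambda>i. [a, a, a] ! i) (zero_trm sig)"
      by (rule id[OF _ _ _ abc]) auto
    moreover have "eval_trm A (\<lambda>i. [a, a, a] ! i) (join_trm sig (Var 0) (T_at zeroL (Var 0))) =
        eval_trm A (\<lambda>i. [a, a, a] ! i) (one_trm sig)"
      by (rule id[OF _ _ _ abc]) auto
    ultimately show ?thesis
      using T_op_in_skeleton[OF A S[OF that]] by simp
  qed
  have 3: "alg_meet sig A (alg_meet sig A a b) c = alg_meet sig A a (alg_meet sig A b c) \<and>
      alg_join sig A (alg_join sig A a b) c = alg_join sig A a (alg_join sig A b c) \<and>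
      alg_meet sig A a (alg_join sig A b c) = alg_join sig A (alg_meet sig A a b) (alg_meet sig A a c) \<and>
      alg_join sig A a (alg_meet sig A b c) = alg_meet sig A (alg_join sig A a b) (alg_join sig A a c)"
    if "a \<in> ?S" "b \<in> ?S" "c \<in> ?S" for a b c
  proof -
    have abc: "{a, b, c} \<subseteq> ?S"
      using that by blast
    let ?M = "meet_trm sig" and ?J = "join_trm sig" and ?x = "Var 0" and ?y = "Var 1" and ?z = "Var 2"
    have "eval_trm A (\<lambda>i. [a, b, c] ! i) (?M (?M ?x ?y) ?z) =
        eval_trm A (\<lambda>i. [a, b, c] ! i) (?M ?x (?M ?y ?z))"
      by (rule id[OF _ _ _ abc]) auto
    moreover have "eval_trm A (\<lambda>i. [a, b, c] ! i) (?J (?J ?x ?y) ?z) =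
        eval_trm A (\<lambda>i. [a, b, c] ! i) (?J ?x (?J ?y ?z))"
      by (rule id[OF _ _ _ abc]) auto
    moreover have "eval_trm A (\<lambda>i. [a, b, c] ! i) (?M ?x (?J ?y ?z)) =
        eval_trm A (\<lambda>i. [a, b, c] ! i) (?J (?M ?x ?y) (?M ?x ?z))"
      by (rule id[OF _ _ _ abc]) auto
    moreover have "eval_trm A (\<lambda>i. [a, b, c] ! i) (?J ?x (?M ?y ?z)) =
        eval_trm A (\<lambda>i. [a, b, c] ! i) (?M (?J ?x ?y) (?J ?x ?z))"
      by (rule id[OF _ _ _ abc]) auto
    ultimately show ?thesis
      by simp
  qed
  show ?thesis
    unfolding is_bool_alg_def
  proof (intro conjI)
    show "bzero (skeleton sig L A) \<in> ?S" "bone (skeleton sig L A) \<in> ?S"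
      using closed0 by (simp_all only: skeleton_simps)
  qed (simp_all only: skeleton_simps(1-5), (use 1 2 3 in blast)+)
qed

text \<open>Homomorphisms commute with term functions: with \<open>T_1\<close> they map skeleton to
  skeleton, and with \<open>T_0\<close> they preserve complements.\<close>

lemma skeleton_hom:
  assumes A: "A \<in> HSP sig L" and C: "C \<in> HSP sig L" and h: "h \<in> alg_hom sig A C"
  shows "restrict h (carrier (skeleton sig L A)) \<in> ba_hom (skeleton sig L A) (skeleton sig L C)"
proof -
  interpret bool_alg "skeleton sig L A"
    by unfold_locales (rule skeleton_bool_alg[OF A])
  note T = T_op_hom[OF HSP_is_algebra[OF A] h]
  note hl = alg_hom_lattice[OF sig h]
  have "restrict h (carrier (skeleton sig L A)) \<in> carrier (skeleton sig L A) \<rightarrow>\<^sub>E carrier (skeleton sig L C)"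
    using alg_hom_closed[OF h] T by (auto simp flip: T)
  then show ?thesis
    unfolding ba_hom_def mem_Collect_eq
    using closed hl T by (simp del: skeleton_simps(6)) (simp add: hl)
qed

lemma is_functor_skeleton:
  "is_functor (variety_cat sig L) BA_cat
    (skeleton_functor sig L :: (('f, 'a) algebra, _, _, _) functor_data)"
proof (rule is_functorI[OF is_category_variety is_category_BA])
  fix A :: "('f, 'a) algebra"
  assume "A \<in> Obj (variety_cat sig L)"
  then have A: "A \<in> HSP sig L"
    by (simp add: variety_cat_def)
  show "FObj (skeleton_functor sig L) A \<in> Obj BA_cat"
    using skeleton_bool_alg[OF A] by (simp add: skeleton_functor_def BA_cat_def)
  show "FMap (skeleton_functor sig L) A A (Ident (variety_cat sig L) A) =
      Ident BA_cat (FObj (skeleton_functor sig L) A)"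
    by (auto simp: skeleton_functor_def BA_cat_def variety_cat_def fun_eq_iff)
next
  fix A C :: "('f, 'a) algebra" and h
  assume "A \<in> Obj (variety_cat sig L)" "C \<in> Obj (variety_cat sig L)" "h \<in> Hom (variety_cat sig L) A C"
  then show "FMap (skeleton_functor sig L) A C h \<in>
      Hom BA_cat (FObj (skeleton_functor sig L) A) (FObj (skeleton_functor sig L) C)"
    using skeleton_hom[of A C h] by (simp add: skeleton_functor_def BA_cat_def variety_cat_def)
next
  fix A C D :: "('f, 'a) algebra" and g h :: "'a \<Rightarrow> 'a"
  assume A: "A \<in> Obj (variety_cat sig L)" and C: "C \<in> Obj (variety_cat sig L)"
    and h: "h \<in> Hom (variety_cat sig L) A C"
  have "restrict h (carrier (skeleton sig L A)) \<in> ba_hom (skeleton sig L A) (skeleton sig L C)"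
    using A C h by (intro skeleton_hom) (simp_all add: variety_cat_def)
  then have "h a \<in> carrier (skeleton sig L C)" if "a \<in> carrier (skeleton sig L A)" for a
    using ba_hom_closed that by (metis restrict_apply')
  then have "restrict (compose (carrier A) g h) (carrier (skeleton sig L A)) =
      compose (carrier (skeleton sig L A)) (restrict g (carrier (skeleton sig L C)))
        (restrict h (carrier (skeleton sig L A)))"
    by (auto simp: compose_def fun_eq_iff)
  then show "FMap (skeleton_functor sig L) A D (Comp (variety_cat sig L) A C D g h) =
      Comp BA_cat (FObj (skeleton_functor sig L) A) (FObj (skeleton_functor sig L) C)
        (FObj (skeleton_functor sig L) D) (FMap (skeleton_functor sig L) C D g)
        (FMap (skeleton_functor sig L) A C h)"
    by (simp add: skeleton_functor_def BA_cat_def variety_cat_def)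
qed

end

section \<open>The adjunction\<close>

context semi_primal_lattice
begin

section \<open>Points of the skeleton select values in L\<close>

lemma skeleton_point_disjoint:
  assumes A: "A \<in> HSP sig L" and w: "w \<in> ba_hom (skeleton sig L A) two" and a: "a \<in> carrier A"
    and "l \<noteq> l'" "w (T_op sig L l A a)"
  shows "\<not> w (T_op sig L l' A a)"
proof -
  have "eval_trm A (\<lambda>_. a) (meet_trm sig (T_at l (Var 0)) (T_at l' (Var 0))) =
      eval_trm A (\<lambda>_. a) (zero_trm sig)"
    by (rule HSP_identity[OF A, of 1]) (use a \<open>l \<noteq> l'\<close> in \<open>auto simp: T_op_L\<close>)
  then have "bmeet (skeleton sig L A) (T_op sig L l A a) (T_op sig L l' A a) = bzero (skeleton sig L A)"
    by simp
  then show ?thesis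
    using point_simps(1,4)[OF w] T_op_in_skeleton[OF A a] assms(5) by metis
qed

text \<open>The join of all \<open>T_l x\<close> is assembled as one term along an enumeration of
  \<open>L\<close>; its equality with 1 is an identity, and a point preserving joins must satisfy
  some disjunct.\<close>

lemma skeleton_point_exists:
  assumes A: "A \<in> HSP sig L" and w: "w \<in> ba_hom (skeleton sig L A) two" and a: "a \<in> carrier A"
  shows "\<exists>l\<in>carrier L. w (T_op sig L l A a)"
proof -
  interpret bool_alg "skeleton sig L A"
    by unfold_locales (rule skeleton_bool_alg[OF A])
  obtain ls where ls: "set ls = carrier L"
    using finite_list[OF fin] by blast
  define t where "t = (\<lambda>ls. foldr (\<lambda>l. join_trm sig (T_at l (Var 0))) ls (zero_trm sig))"
  have wf: "wf_trm sig 1 (t ls)" for ls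
    by (induction ls) (simp_all add: t_def)
  have L: "eval_trm L v (t ls) = (if v 0 \<in> set ls then oneL else zeroL)" if "v 0 \<in> carrier L" for v ls
    using that by (induction ls) (auto simp: t_def T_op_L)
  have "eval_trm A (\<lambda>_. a) (t ls) = eval_trm A (\<lambda>_. a) (one_trm sig)"
    by (rule HSP_identity[OF A wf]) (use a L ls in auto)
  then have one: "eval_trm A (\<lambda>_. a) (t ls) = bone (skeleton sig L A)"
    by simp
  \<comment> \<open>Membership in the skeleton is carried through the induction because
    \<open>w\<close> respects joins only there.\<close>
  have "eval_trm A (\<lambda>_. a) (t ls) \<in> carrier (skeleton sig L A) \<and>
      (w (eval_trm A (\<lambda>_. a) (t ls)) \<longleftrightarrow> (\<exists>l\<in>set ls. w (T_op sig L l A a)))" for ls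
  proof (induction ls)
    case Nil
    have "eval_trm A (\<lambda>_. a) (t []) = bzero (skeleton sig L A)"
      by (simp add: t_def)
    then show ?case
      using w closed(1) by (simp del: skeleton_simps)
  next
    case (Cons l ls)
    have "eval_trm A (\<lambda>_. a) (t (l # ls)) =
        bjoin (skeleton sig L A) (T_op sig L l A a) (eval_trm A (\<lambda>_. a) (t ls))"
      by (simp add: t_def)
    then show ?case
      using w Cons T_op_in_skeleton[OF A a] by (simp del: skeleton_simps)
  qed
  then show ?thesis
    using one ls point_simps(2)[OF w] by metis
qed

text \<open>If the point assigns \<open>ls ! i\<close> to each argument, it satisfies the meet
  \<open>?M\<close> of the corresponding \<open>T\<close> terms. In \<open>L\<close> this meet is 1
  only at the tuple \<open>ls\<close>, where the result is \<open>oper L f ls\<close>, so it lies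
  below \<open>?T\<close>.\<close>

lemma skeleton_point_oper:
  assumes A: "A \<in> HSP sig L" and w: "w \<in> ba_hom (skeleton sig L A) two"
    and as: "as \<in> tuples (arity sig f) (carrier A)" and ls: "ls \<in> tuples (arity sig f) (carrier L)"
    and pts: "\<And>i. i < arity sig f \<Longrightarrow> w (T_op sig L (ls ! i) A (as ! i))"
  shows "w (T_op sig L (oper L f ls) A (oper A f as))"
proof -
  interpret bool_alg "skeleton sig L A"
    by unfold_locales (rule skeleton_bool_alg[OF A])
  let ?k = "arity sig f" and ?S = "skeleton sig L A"
  have mem: "as ! i \<in> carrier A" if "i < ?k" for i
    using as that by (auto simp: tuples_def)
  have len: "length as = ?k" "length ls = ?k"
    using as ls by (auto simp: tuples_def)
  define m where "m = (\<lambda>js. foldr (\<lambda>i. meet_trm sig (T_at (ls ! i) (Var i))) js (one_trm sig))"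
  define o_trm where "o_trm = App f (map Var [0..<?k])"
  have wf_m: "wf_trm sig ?k (m js)" if "set js \<subseteq> {..<?k}" for js
    using that by (induction js) (simp_all add: m_def)
  have wf_o: "wf_trm sig ?k o_trm"
    by (simp add: o_trm_def)
  have eval_m: "eval_trm L v (m js) = (if \<forall>i\<in>set js. v i = ls ! i then oneL else zeroL)"
    if "\<And>i. i < ?k \<Longrightarrow> v i \<in> carrier L" "set js \<subseteq> {..<?k}" for v js
    using that(2) by (induction js) (auto simp: m_def T_op_L that(1))
  have eval_o: "eval_trm C v o_trm = oper C f (map v [0..<?k])" for C :: "('f, 'c) algebra" and v
    by (simp add: o_trm_def comp_def)
  let ?M = "m [0..<?k]" and ?T = "T_at (oper L f ls) o_trm" and ?v = "\<lambda>i. as ! i"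
  \<comment> \<open>The inequality is written as the equation \<open>?M\<close> meet
    \<open>?T\<close> equals \<open>?M\<close>, so that it transfers as an identity.\<close>
  have M_below: "eval_trm A ?v (meet_trm sig ?M ?T) = eval_trm A ?v ?M"
  proof (rule HSP_identity[OF A, of ?k])
    show "wf_trm sig ?k (meet_trm sig ?M ?T)" "wf_trm sig ?k ?M"
      using wf_m wf_o by (simp_all add: atLeast0LessThan)
    fix v :: "nat \<Rightarrow> 'l" assume v: "\<And>i. i < ?k \<Longrightarrow> v i \<in> carrier L"
    then have "map v [0..<?k] \<in> tuples ?k (carrier L)"
      by (auto simp: tuples_def)
    then have op: "oper L f (map v [0..<?k]) \<in> carrier L"
      by (rule is_algebraD[OF L])
    have M: "eval_trm L v ?M = (if \<forall>i<?k. v i = ls ! i then oneL else zeroL)"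
      using eval_m[of v "[0..<?k]"] v by (simp add: atLeast0LessThan Ball_def)
    show "eval_trm L v (meet_trm sig ?M ?T) = eval_trm L v ?M"
    proof (cases "\<forall>i<?k. v i = ls ! i")
      case True
      then have "map v [0..<?k] = ls"
        using len by (simp add: list_eq_iff_nth_eq)
      then show ?thesis
        using M True op by (simp add: eval_o T_op_L del: map_eq_conv)
    next
      case False
      then have "eval_trm L v ?M = zeroL"
        using M by (simp only: if_False)
      then show ?thesis
        using op by (simp add: eval_o T_op_L del: map_eq_conv)
    qed
  qed (rule mem)
  have "eval_trm A ?v (m js) \<in> carrier ?S \<and>
      (w (eval_trm A ?v (m js)) \<longleftrightarrow> (\<forall>i\<in>set js. w (T_op sig L (ls ! i) A (as ! i))))"
    if "set js \<subseteq> {..<?k}" for js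
    using that
  proof (induction js)
    case Nil
    have "eval_trm A ?v (m []) = bone ?S"
      by (simp add: m_def)
    then show ?case
      using w closed(2) by (simp del: skeleton_simps)
  next
    case (Cons i js)
    have "eval_trm A ?v (m (i # js)) =
        bmeet ?S (T_op sig L (ls ! i) A (as ! i)) (eval_trm A ?v (m js))"
      by (simp add: m_def)
    then show ?case
      using w Cons T_op_in_skeleton[OF A mem[of i]] by (simp del: skeleton_simps)
  qed
  from this[of "[0..<?k]"] have M: "eval_trm A ?v ?M \<in> carrier ?S" "w (eval_trm A ?v ?M)"
    using pts by (simp_all add: atLeast0LessThan del: skeleton_simps)
  have "map ?v [0..<?k] = as"
    using len by (simp add: list_eq_iff_nth_eq)
  then have "bmeet ?S (eval_trm A ?v ?M) (T_op sig L (oper L f ls) A (oper A f as)) = eval_trm A ?v ?M"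
    using M_below by (simp add: eval_o del: map_eq_conv)
  then show ?thesis
    using point_simps(4)[OF w M(1) T_op_in_skeleton[OF A is_algebraD[OF HSP_is_algebra[OF A] as]]] M(2)
    by metis
qed

section \<open>Transposition across the adjunction\<close>

definition transpose_hom ::
    "('f, 'a) algebra \<Rightarrow> 'b bool_alg \<Rightarrow> ('a \<Rightarrow> 'b) \<Rightarrow> 'a \<Rightarrow> 'l \<Rightarrow> 'b" where
  "transpose_hom A B \<phi> = (\<lambda>a\<in>carrier A. \<lambda>l\<in>carrier L. \<phi> (T_op sig L l A a))"

text \<open>Each point \<open>u\<close> of \<open>B\<close> pulls back along \<open>\<phi>\<close>
  to a point of the skeleton. The facts about such points give a unique label for every
  \<open>a\<close>, hence membership in \<open>L[B]\<close>, and compatibility of labels with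
  operations.\<close>

lemma transpose_hom_hom:
  assumes A: "A \<in> HSP sig L" and B: "is_bool_alg B" and \<phi>: "\<phi> \<in> ba_hom (skeleton sig L A) B"
  shows "transpose_hom A B \<phi> \<in> alg_hom sig A (boolean_power sig L B)"
proof -
  interpret B: finite_boolean_power B sig L
    using B L fin by unfold_locales
  let ?\<Phi> = "transpose_hom A B \<phi>"
  have alg: "is_algebra sig A"
    using A by (rule HSP_is_algebra)
  have pull: "compose (carrier (skeleton sig L A)) u \<phi> \<in> ba_hom (skeleton sig L A) two"
    if "u \<in> ba_hom B two" for u
    using skeleton_bool_alg[OF A] \<phi> that by (rule ba_hom_compose)
  have pt: "u (?\<Phi> a l) \<longleftrightarrow> compose (carrier (skeleton sig L A)) u \<phi> (T_op sig L l A a)"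
    if "a \<in> carrier A" "l \<in> carrier L" for u a l
    using that T_op_in_skeleton[OF A that(1)]
    by (simp add: transpose_hom_def compose_def del: skeleton_simps)
  have mem: "?\<Phi> a \<in> carrier (boolean_power sig L B)" if a: "a \<in> carrier A" for a
  proof -
    have fs: "?\<Phi> a \<in> carrier L \<rightarrow>\<^sub>E carrier B"
      using ba_hom_closed[OF \<phi> T_op_in_skeleton[OF A a]] a by (simp add: transpose_hom_def)
    show ?thesis
      unfolding B.boolean_power_carrier_iff[OF fs]
    proof
      fix u assume u: "u \<in> ba_hom B two"
      show "\<exists>!l. l \<in> carrier L \<and> u (?\<Phi> a l)"
        using skeleton_point_exists[OF A pull[OF u] a] skeleton_point_disjoint[OF A pull[OF u] a]
          pt[OF a] by metis
    qed
  qed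
  show ?thesis
  proof (rule alg_homI)
    show "?\<Phi> \<in> carrier A \<rightarrow>\<^sub>E carrier (boolean_power sig L B)"
      using mem by (simp add: transpose_hom_def PiE_def)
    fix f as assume as: "as \<in> tuples (arity sig f) (carrier A)"
    have \<Phi>as: "map ?\<Phi> as \<in> tuples (arity sig f) (carrier (boolean_power sig L B))"
      using as mem by (rule map_tuples)
    have o: "oper A f as \<in> carrier A"
      using alg as by (rule is_algebraD)
    show "?\<Phi> (oper A f as) = oper (boolean_power sig L B) f (map ?\<Phi> as)"
    proof (rule B.boolean_power_eqI[OF mem[OF o] is_algebraD[OF B.is_algebra_boolean_power \<Phi>as]])
      fix u assume u: "u \<in> ba_hom B two"
      let ?ls = "map (B.value_at u) (map ?\<Phi> as)"
      have ls: "?ls \<in> tuples (arity sig f) (carrier L)"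
        using \<Phi>as B.value_at(1)[OF u] by (rule map_tuples)
      have l: "oper L f ?ls \<in> carrier L"
        using L ls by (rule is_algebraD)
      \<comment> \<open>\<open>?ls\<close> collects the labels of the arguments at \<open>u\<close>;
        the label of the result is then \<open>oper L f ?ls\<close>.\<close>
      have "compose (carrier (skeleton sig L A)) u \<phi> (T_op sig L (oper L f ?ls) A (oper A f as))"
      proof (rule skeleton_point_oper[OF A pull[OF u] as ls])
        fix i assume "i < arity sig f"
        then have i: "i < length as" "as ! i \<in> carrier A"
          using as by (auto simp: tuples_def)
        then show "compose (carrier (skeleton sig L A)) u \<phi> (T_op sig L (?ls ! i) A (as ! i))"
          using pt[OF i(2)] B.value_at[OF u mem[OF i(2)]] by simp
      qed
      then have "u (?\<Phi> (oper A f as) (oper L f ?ls))"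
        using pt[OF o l] by simp
      then show "B.value_at u (?\<Phi> (oper A f as)) =
          B.value_at u (oper (boolean_power sig L B) f (map ?\<Phi> as))"
        unfolding B.value_at_oper[OF u \<Phi>as] using B.value_at(2)[OF u mem[OF o] l] by blast
    qed
  qed
qed

text \<open>Every point \<open>u\<close> of \<open>B\<close> turns \<open>g\<close> into a
  homomorphism \<open>\<kappa> u\<close> from \<open>A\<close> to \<open>L\<close>. The candidate
  \<open>\<phi>\<close> holds at \<open>u\<close> exactly where \<open>\<kappa> u\<close> takes the
  value 1, so its Boolean laws reduce to lattice computations with 0 and 1.\<close>

lemma transpose_hom_surj:
  assumes A: "A \<in> HSP sig L" and B: "is_bool_alg B"
    and g: "g \<in> alg_hom sig A (boolean_power sig L B)"
  shows "\<exists>\<phi>\<in>ba_hom (skeleton sig L A) B. transpose_hom A B \<phi> = g"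
proof
  interpret B: finite_boolean_power B sig L
    using B L fin by unfold_locales
  interpret S: bool_alg "skeleton sig L A"
    by unfold_locales (rule skeleton_bool_alg[OF A])
  let ?S = "skeleton sig L A"
  have alg: "is_algebra sig A"
    using A by (rule HSP_is_algebra)
  have one: "oneL \<in> carrier L"
    using L by simp
  define \<phi> where "\<phi> = (\<lambda>a\<in>carrier ?S. g a oneL)"
  have SA: "a \<in> carrier A" if "a \<in> carrier ?S" for a
    using that by simp
  have gm: "g a \<in> carrier (boolean_power sig L B)" if "a \<in> carrier A" for a
    using g that by (rule alg_hom_closed)
  define \<kappa> where "\<kappa> u = compose (carrier A) (restrict (B.value_at u) (carrier (boolean_power sig L B))) g" for u
  have \<kappa>: "\<kappa> u \<in> alg_hom sig A L" if "u \<in> ba_hom B two" for u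
    unfolding \<kappa>_def using alg g B.value_at_hom[OF that] by (rule alg_hom_compose)
  have \<kappa>_iff: "u (g a l) \<longleftrightarrow> \<kappa> u a = l" if "u \<in> ba_hom B two" "a \<in> carrier A" "l \<in> carrier L" for u a l
    using B.value_at(2)[OF that(1) gm[OF that(2)] that(3)] gm[OF that(2)] that(2)
    by (simp add: \<kappa>_def compose_def)
  have \<kappa>_T: "\<kappa> u (T_op sig L l A a) = T_op sig L l L (\<kappa> u a)" if "u \<in> ba_hom B two" "a \<in> carrier A" for u a l
    using alg \<kappa>[OF that(1)] that(2) by (rule T_op_hom)
  \<comment> \<open>A skeleton element satisfies \<open>a = T_1 a\<close>, hence its image equals
    \<open>T_1\<close> of itself and is one of the bounds.\<close>
  have \<kappa>_01: "\<kappa> u a = zeroL \<or> \<kappa> u a = oneL" if u: "u \<in> ba_hom B two" and a: "a \<in> carrier ?S" for u a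
    using \<kappa>_T[OF u SA[OF a], of oneL] T_op_L[OF alg_hom_closed[OF \<kappa>[OF u] SA[OF a]], of oneL] a
    by (simp split: if_splits)
  have point: "u (\<phi> a) \<longleftrightarrow> \<kappa> u a = oneL" if "u \<in> ba_hom B two" "a \<in> carrier ?S" for u a
    using \<kappa>_iff[OF that(1) SA[OF that(2)] one] that(2) by (simp add: \<phi>_def del: skeleton_simps)
  have \<phi>m: "\<phi> a \<in> carrier B" if "a \<in> carrier ?S" for a
    using B.boolean_power_mem[OF gm[OF SA[OF that]] one] that by (simp add: \<phi>_def del: skeleton_simps)
  show "\<phi> \<in> ba_hom ?S B"
    unfolding ba_hom_def mem_Collect_eq
  proof (intro conjI ballI)
    show "\<phi> \<in> carrier ?S \<rightarrow>\<^sub>E carrier B"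
      using \<phi>m by (simp add: \<phi>_def PiE_def)
    note hom = alg_hom_lattice[OF sig \<kappa>]
    show "\<phi> (bzero ?S) = bzero B"
    proof (rule B.eq_by_points)
      fix u assume u: "u \<in> ba_hom B two"
      show "u (\<phi> (bzero ?S)) \<longleftrightarrow> u (bzero B)"
        unfolding point[OF u S.closed(1)] using hom(3)[OF u] zero_neq_one u by simp
    qed (rule \<phi>m S.closed B.closed)+
    show "\<phi> (bone ?S) = bone B"
    proof (rule B.eq_by_points)
      fix u assume u: "u \<in> ba_hom B two"
      show "u (\<phi> (bone ?S)) \<longleftrightarrow> u (bone B)"
        unfolding point[OF u S.closed(2)] using hom(4)[OF u] u by simp
    qed (rule \<phi>m S.closed B.closed)+
    fix a assume a: "a \<in> carrier ?S"
    show "\<phi> (bcompl ?S a) = bcompl B (\<phi> a)"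
    proof (rule B.eq_by_points)
      fix u assume u: "u \<in> ba_hom B two"
      show "u (\<phi> (bcompl ?S a)) \<longleftrightarrow> u (bcompl B (\<phi> a))"
        unfolding point[OF u S.closed(3)[OF a]] point_simps(3)[OF u \<phi>m[OF a]] point[OF u a]
        using \<kappa>_T[OF u SA[OF a], of zeroL] \<kappa>_01[OF u a] zero_neq_one by auto
    qed (rule \<phi>m S.closed B.closed a)+
    fix b assume b: "b \<in> carrier ?S"
    show "\<phi> (bmeet ?S a b) = bmeet B (\<phi> a) (\<phi> b)"
    proof (rule B.eq_by_points)
      fix u assume u: "u \<in> ba_hom B two"
      show "u (\<phi> (bmeet ?S a b)) \<longleftrightarrow> u (bmeet B (\<phi> a) (\<phi> b))"
        unfolding point[OF u S.closed(4)[OF a b]] point_simps(4)[OF u \<phi>m[OF a] \<phi>m[OF b]]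
          point[OF u a] point[OF u b]
        using hom(1)[OF u SA[OF a] SA[OF b]] \<kappa>_01[OF u a] \<kappa>_01[OF u b] zero_neq_one by auto
    qed (rule \<phi>m S.closed B.closed a b)+
    show "\<phi> (bjoin ?S a b) = bjoin B (\<phi> a) (\<phi> b)"
    proof (rule B.eq_by_points)
      fix u assume u: "u \<in> ba_hom B two"
      show "u (\<phi> (bjoin ?S a b)) \<longleftrightarrow> u (bjoin B (\<phi> a) (\<phi> b))"
        unfolding point[OF u S.closed(5)[OF a b]] point_simps(5)[OF u \<phi>m[OF a] \<phi>m[OF b]]
          point[OF u a] point[OF u b]
        using hom(2)[OF u SA[OF a] SA[OF b]] \<kappa>_01[OF u a] \<kappa>_01[OF u b] zero_neq_one by auto
    qed (rule \<phi>m S.closed B.closed a b)+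
  qed
  show "transpose_hom A B \<phi> = g"
  proof
    fix a show "transpose_hom A B \<phi> a = g a"
    proof (cases "a \<in> carrier A")
      case True
      \<comment> \<open>At a point \<open>u\<close> both sides say that \<open>\<kappa> u a\<close>
        equals \<open>l\<close>.\<close>
      have "\<phi> (T_op sig L l A a) = g a l" if l: "l \<in> carrier L" for l
      proof (rule B.eq_by_points)
        show "\<phi> (T_op sig L l A a) \<in> carrier B"
          using A True by (intro \<phi>m T_op_in_skeleton)
        show "g a l \<in> carrier B"
          using gm[OF True] l by (rule B.boolean_power_mem)
        fix u assume u: "u \<in> ba_hom B two"
        show "u (\<phi> (T_op sig L l A a)) \<longleftrightarrow> u (g a l)"
          unfolding point[OF u T_op_in_skeleton[OF A True]] \<kappa>_T[OF u True] \<kappa>_iff[OF u True l]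
          using T_op_L[OF alg_hom_closed[OF \<kappa>[OF u] True], of l] zero_neq_one by simp
      qed
      then show ?thesis
        using True B.boolean_power_funcset[OF gm[OF True]]
        by (auto simp: transpose_hom_def fun_eq_iff PiE_def extensional_def)
    next
      case False
      then show ?thesis
        using PiE_arb[OF alg_hom_funcset[OF g] False] by (simp add: transpose_hom_def)
    qed
  qed
qed

text \<open>The map \<open>\<phi>\<close> is recovered from the label 1, as \<open>T_1 a = a\<close>
  on the skeleton.\<close>

lemma transpose_hom_inj: "inj_on (transpose_hom A B) (ba_hom (skeleton sig L A) B)"
proof (rule inj_onI)
  fix \<phi> \<psi> assume \<phi>: "\<phi> \<in> ba_hom (skeleton sig L A) B" and \<psi>: "\<psi> \<in> ba_hom (skeleton sig L A) B"
    and eq: "transpose_hom A B \<phi> = transpose_hom A B \<psi>"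
  show "\<phi> = \<psi>"
  proof (rule PiE_ext[OF ba_hom_funcset[OF \<phi>] ba_hom_funcset[OF \<psi>]])
    fix a assume "a \<in> carrier (skeleton sig L A)"
    then have a: "a \<in> carrier A" "T_op sig L oneL A a = a"
      by simp_all
    have "transpose_hom A B \<phi> a oneL = transpose_hom A B \<psi> a oneL"
      using eq by simp
    then show "\<phi> a = \<psi> a"
      using a L by (simp add: transpose_hom_def)
  qed
qed

text \<open>After unfolding, the content is that \<open>h\<close> commutes with each
  \<open>T_l\<close>; outside the carrier of \<open>A'\<close> both sides are undefined.\<close>

lemma transpose_hom_natural:
  assumes A: "A \<in> HSP sig L" and A': "A' \<in> HSP sig L"
    and h: "h \<in> alg_hom sig A' A" and \<phi>: "\<phi> \<in> ba_hom (skeleton sig L A) B" and B: "is_bool_alg B"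
  shows "transpose_hom A' B' (compose (carrier (skeleton sig L A')) \<psi>
      (compose (carrier (skeleton sig L A')) \<phi> (restrict h (carrier (skeleton sig L A'))))) =
    compose (carrier A') (\<lambda>\<xi>\<in>carrier (boolean_power sig L B). compose (carrier L) \<psi> \<xi>)
      (compose (carrier A') (transpose_hom A B \<phi>) h)"
proof
  fix a
  show "transpose_hom A' B' (compose (carrier (skeleton sig L A')) \<psi>
      (compose (carrier (skeleton sig L A')) \<phi> (restrict h (carrier (skeleton sig L A'))))) a =
    compose (carrier A') (\<lambda>\<xi>\<in>carrier (boolean_power sig L B). compose (carrier L) \<psi> \<xi>)
      (compose (carrier A') (transpose_hom A B \<phi>) h) a"
  proof (cases "a \<in> carrier A'")
    case True
    have ha: "h a \<in> carrier A"
      using h True by (rule alg_hom_closed)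
    have "transpose_hom A B \<phi> (h a) \<in> carrier (boolean_power sig L B)"
      using transpose_hom_hom[OF A B \<phi>] ha by (rule alg_hom_closed)
    then show ?thesis
      using True ha T_op_in_skeleton[OF A' True] T_op_hom[OF HSP_is_algebra[OF A'] h True]
      by (auto simp: transpose_hom_def compose_def fun_eq_iff simp del: skeleton_simps)
  qed (simp add: transpose_hom_def compose_def)
qed

lemma adjoint_skeleton_boolean_power:
  "adjoint_pair sig L (skeleton_functor sig L :: (('f, 'a) algebra, _, _, _) functor_data)
    (boolean_power_functor sig L :: ('b bool_alg, _, _, _) functor_data)"
  unfolding adjoint_pair_def
proof (intro conjI is_functor_skeleton is_functor_boolean_power(1) L fin
    exI[of _ transpose_hom] ballI)
  fix A :: "('f, 'a) algebra" and B :: "'b bool_alg"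
  assume A: "A \<in> HSP sig L" and "B \<in> Obj BA_cat"
  then have B: "is_bool_alg B"
    by (simp add: BA_cat_def)
  have "bij_betw (transpose_hom A B) (ba_hom (skeleton sig L A) B)
      (alg_hom sig A (boolean_power sig L B))"
    unfolding bij_betw_def
    using transpose_hom_inj transpose_hom_hom[OF A B] transpose_hom_surj[OF A B] by blast
  then show "bij_betw (transpose_hom A B) (ba_hom (FObj (skeleton_functor sig L) A) B)
      (alg_hom sig A (FObj (boolean_power_functor sig L) B))"
    by (simp add: skeleton_functor_def boolean_power_functor_def)
next
  fix A A' :: "('f, 'a) algebra" and B B' :: "'b bool_alg" and h \<psi> \<phi>
  assume "A \<in> HSP sig L" "A' \<in> HSP sig L" "B \<in> Obj BA_cat" "h \<in> alg_hom sig A' A"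
    "\<phi> \<in> ba_hom (FObj (skeleton_functor sig L) A) B"
  then show "transpose_hom A' B' (compose (carrier (FObj (skeleton_functor sig L) A')) \<psi>
        (compose (carrier (FObj (skeleton_functor sig L) A')) \<phi> (FMap (skeleton_functor sig L) A' A h))) =
      compose (carrier A') (FMap (boolean_power_functor sig L) B B' \<psi>)
        (compose (carrier A') (transpose_hom A B \<phi>) h)"
    using transpose_hom_natural[of A A' h \<phi> B B' \<psi>]
    by (simp add: skeleton_functor_def boolean_power_functor_def BA_cat_def del: skeleton_simps)
qed

end

text \<open>The three functors of the composite are also asserted separately, with an arbitrary
  point type for the last two, because the natural isomorphism speaks only of their composite on
  ultrafilter spaces.\<close>

theorem theorem4p11:
  fixes sig :: "'f lattice_signature" and L :: "('f, 'l) algebra"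
  assumes "is_lattice_signature sig"
    and "is_algebra sig L"
    and "finite (carrier L)"
    and "has_bounded_lattice_reduct sig L"
    and "alg_zero sig L \<noteq> alg_one sig L"
    and "semi_primal sig L"
  shows
    "is_functor BA_cat (op_category Stone_cat)
       (\<Sigma>_functor :: ('b bool_alg, 'b \<Rightarrow> 'b, ('b \<Rightarrow> bool) topology, _) functor_data) \<and>
     is_functor Stone_cat (Stone_L_cat sig L)
       (V_top_functor L :: ('x topology, _, _, _) functor_data) \<and>
     is_functor (op_category (Stone_L_cat sig L)) (variety_cat sig L)
       (\<Pi>_functor L :: ('x topology \<times> _, _, _, _) functor_data) \<and>
     naturally_isomorphic sig L BA_cat
       (boolean_power_functor sig L :: ('b bool_alg, _, _, _) functor_data)
       (\<Pi>_functor L \<circ>\<^sub>F V_top_functor L \<circ>\<^sub>F \<Sigma>_functor) \<and>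
     adjoint_pair sig L
       (skeleton_functor sig L :: (('f, 'a) algebra, _, _, _) functor_data)
       (boolean_power_functor sig L :: ('b bool_alg, _, _, _) functor_data)"
proof -
  interpret semi_primal_lattice sig L
    using assms by unfold_locales
  show ?thesis
    by (intro conjI is_functor_\<Sigma> is_functor_V_top is_functor_\<Pi> is_functor_boolean_power(2)
        adjoint_skeleton_boolean_power assms)
qed

end
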